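(* Let $k\ge 1$ be an integer, let $N$ be an even dimensional Euclidean vector space, let $\zeta\in SO(N)$ satisfy $\zeta^k=\mathrm{Id}_N$, and let $\gamma\in\mathbb{C}$ be of order $k$ in $E_\tau$, with $k\gamma=\alpha+\beta\tau$, $\alpha,\beta\in\mathbb{Z}$. Let $N=N_0\oplus N_1$ be the $\zeta$-invariant orthogonal decomposition such that $\zeta$ acts by the identity on $N_0$ and $\mathrm{Id}-\zeta$ is invertible on $N_1$. Let $J\in\mathfrak{so}(N)$ be invertible, commuting with $\zeta$ and such that $\exp(J/k)=\zeta$ in $SO(N)$, and write $J=J_0\oplus J_1$ in the decomposition $N=N_0\oplus N_1$. Choose orientations $o_{N_0},o_{N_1},o_N$ on $N_0,N_1,N$. Then, for $R\in\mathfrak{so}(N,J)$ (near $0$) and $y\in\mathbb{C}$ sufficiently small (wherever both sides are defined), $$Z(\tau,N_0,o_{N_0})(yJ+R)\;\mathrm{EM}(\gamma,\zeta;\tau,N_1,o_{N_1})(yJ+R)=\epsilon\; Z(\gamma+y,J;\tau,N,o_N)(R),$$ with $$\epsilon=\mathrm{Os}(J_1/k,o_{N_1})^{\alpha+\beta}\;\epsilon(J_0/k,N_0)^{\alpha+\beta}\;\frac{o_N}{o_{N_0}\wedge o_{N_1}} .$$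
   Context: Conventions. $\tau$ is a fixed point of the upper half-plane, $q=e^{2i\pi\tau}$, $q^{s}=e^{2i\pi s\tau}$ for $s\in\mathbb{Q}$, $L_\tau=\mathbb{Z}\oplus\mathbb{Z}\tau$, $E_\tau=\mathbb{C}/L_\tau$. "$\gamma\in\mathbb{C}$ is of order $k$ in $E_\tau$" means its image in $E_\tau$ has exact order $k$; then $k\gamma=\alpha+\beta\tau$ with $\alpha,\beta\in\mathbb{Z}$. For $A$ in a Lie algebra or group acting on $N$, $\mathfrak{so}(N,A)$ and $SO(N,A)$ denote the elements of $\mathfrak{so}(N)$, $SO(N)$ commuting with $A$. A matrix respecting $N=N_0\oplus N_1$ is restricted to $N_i$ when it is the argument of a function attached to $N_i$. All functions are extended holomorphically to the complexified Lie algebras. A quotient of two orientations of the same space is the sign $\pm1$ comparing them; $o_{N_0}\wedge o_{N_1}$ is the product orientation. Spinors. $(N,o_N)$ is an oriented even dimensional Euclidean space; in the Clifford algebra unit vectors satisfy $e^2=-1$; $\mathrm{Spin}(N)\to SO(N)$ is the double cover, whose Lie algebras are identified: if $Xe_1=\phi e_2$, $Xe_2=-\phi e_1$ then $X\leftrightarrow\frac{\phi}{2}e_1e_2$ and $\exp X=\cos(\phi/2)+\sin(\phi/2)e_1e_2$ in $\mathrm{Spin}$. $S_N=S_N^+\oplus S_N^-$ is the complex spinor space, graded by $o_N$; $\mathrm{Str}(g,S_N,o_N)=\mathrm{Tr}(g,S_N^+)-\mathrm{Tr}(g,S_N^-)$. If $X\in\mathfrak{so}(N)$, $Xe_{2j-1}=\phi_je_{2j}$,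 $Xe_{2j}=-\phi_je_{2j-1}$ in an oriented orthonormal basis, then $\mathrm{Tr}(e^X,S_N)=\prod_j(e^{-i\phi_j/2}+e^{i\phi_j/2})$ and $\mathrm{Str}(e^X,S_N,o_N)=\prod_j(e^{-i\phi_j/2}-e^{i\phi_j/2})$. With $\sigma:\mathrm{Clifford}(N)\to\Lambda N$ the symbol isomorphism, if $g\in\mathrm{Spin}(N)$ and $\mathrm{Id}-g$ is invertible on $N$, the top degree term of $\sigma(g)$ is nonzero and defines an orientation $o_g$. For $Y\in\mathfrak{so}(N)$ with $\det_N(\mathrm{Id}-e^Y)\ne0$, $\mathrm{Os}(Y,o_N)\in\{\pm1\}$ is the ratio of the orientation $o_{\exp Y}$ ($\exp Y$ computed in $\mathrm{Spin}(N)$) and $o_N$. Witten traces. For a complex vector space $V$ and a transformation $g$ of $V$, $\mathrm{Tr}(g,W_{1,q}(V))=\prod_{n\ge1}\frac{\det_V(1+q^{n-1/2}g)}{\det_V(1-q^ng)}$, $\mathrm{Tr}(g,W_{2,q}(V))=\prod_{n\ge1}\frac{\det_V(1-q^{n-1/2}g)}{\det_V(1+q^ng)}$, $\mathrm{Tr}(g,W_{3,q}(V))=\prod_{n\ge1}\frac{\det_V(1+q^{n}g)}{\det_V(1-q^{n-1/2}g)}$, $\mathrm{Tr}(g,W_{4,q}(V))=\prod_{n\ge1}\frac{\det_V(1-q^{n}g)}{\det_V(1+q^{n-1/2}g)}$. Functions $Z$. $Z(\tau,N,o_N)(R)=\dfrac{\mathrm{Tr}(e^R,W_{1,q}(N\otimes_{\mathbb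 R}\mathbb{C}))}{\mathrm{Str}(e^R,S_N,o_N)}$ for $R\in\mathfrak{so}(N)$. For $J\in\mathfrak{so}(N)$ invertible with $\exp(J)=\mathrm{Id}_N$ in $SO(N)$, $\gamma\in\mathbb{C}$, $R\in\mathfrak{so}(N,J)$, $Z(\gamma,J;\tau,N,o_N)(R)=\dfrac{\mathrm{Tr}(e^{\gamma J}e^R,W_{1,q}(N\otimes_{\mathbb R}\mathbb{C}))}{\mathrm{Str}(e^{\gamma J}e^R,S_N,o_N)}$, where $z\mapsto\mathrm{Str}(e^{zJ}e^R,S_N,o_N)$ is the holomorphic extension from $z\in\mathbb{R}$ (exponentials in $\mathrm{Spin}(N)$). Signs. For such $J$, write $N\otimes\mathbb{C}=\oplus_{a\in\Delta}N_a$ with $\dim N_a=1$, $J=2i\pi a$ on $N_a$, $\Delta$ a multilist of nonzero integers, $\Delta=\Delta_+\cup\Delta_-$ with $\Delta_-=-\Delta_+$. Then $\epsilon(J,N)=(-1)^{\sum_{a\in\Delta_+}a}$, independent of the choice of $\Delta_+$. In particular, if $\exp(J/k)=\mathrm{Id}_N$, $\epsilon(J/k,N)=(-1)^{\sum_{a\in\Delta_+}a/k}$. Functions $\mathrm{EM}$. Let $\gamma$ be of order $k$, $k\gamma=\alpha+\beta\tau$. (i) If $k$ is even (then $\alpha,\beta$ are not both even), define on a neighborhood of $0$ in $\mathfrak{so}(N)$: if $\alpha$ odd, $\beta$ even, $\mathrm{EM}_\epsilon(\gamma;\tau,N,o_N)(R)=i^{\dim N/2}(-1)^{(\alpha+\beta-1)\dim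 N/4}\frac{1}{\mathrm{Tr}(e^R,S_N)}\mathrm{Tr}(e^R,W_{2,q}(N\otimes\mathbb{C}))$; if $\alpha$ even, $\beta$ odd, $\mathrm{EM}_\epsilon=q^{\dim N/8}(-1)^{(\alpha+\beta-1)\dim N/4}\,\mathrm{Tr}(e^R,S_N)\,\mathrm{Tr}(e^R,W_{3,q}(N\otimes\mathbb{C}))$; if $\alpha,\beta$ both odd, $\mathrm{EM}_\epsilon=i^{\dim N/2}q^{\dim N/8}(-1)^{(\alpha+\beta)\dim N/4}\,\mathrm{Str}(e^R,S_N,o_N)\,\mathrm{Tr}(e^R,W_{4,q}(N\otimes\mathbb{C}))$. (ii) If $\zeta\in SO(N)$, $\zeta^k=\mathrm{Id}_N$ and $\mathrm{Id}\pm\zeta$ are invertible: let $N\otimes\mathbb{C}=\oplus_{u\in F}N_u$ be the eigenspace decomposition of $\zeta$, $F=F^+\cup F^-$ with $F^-=\{\overline u:u\in F^+\}$ (disjoint). $K\in\mathfrak{so}(N)$ is adapted to $\zeta$ if $Kv=2i\pi a_uv$ for $u\in F^+$, $v\in N_u$, with $a_u\in\mathbb{Z}$, $u=e^{2i\pi a_u/k}$. Then $\exp(K/k)=\zeta$, $\mathfrak{so}(N,K)=\mathfrak{so}(N,\zeta)$, and for $R\in\mathfrak{so}(N,\zeta)$, $\mathrm{EM}(\gamma,\zeta;\tau,N,o_N)(R)=\mathrm{Os}(K/k,o_N)^{\alpha+\beta}Z(\gamma,K;\tau,N,o_N)(R)$ (independent of the choice of adapted $K$). (iii) If $\zeta^k=\mathrm{Id}_N$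 and only $\mathrm{Id}-\zeta$ is invertible: write $N=N_B\oplus N_G$, $\zeta=-\mathrm{Id}$ on $N_B$, $\mathrm{Id}\pm\zeta$ invertible on $N_G$, and set $\mathrm{EM}(\gamma,\zeta;\tau,N,o_{N_B}\wedge o_{N_G})=\mathrm{EM}_\epsilon(\gamma;\tau,N_B,o_{N_B})\,\mathrm{EM}(\gamma,\zeta;\tau,N_G,o_{N_G})$ on $\mathfrak{so}(N,\zeta)$. Zero space. If a space is $\{0\}$, an orientation is a sign $o$, $\mathrm{Spin}=\{\pm1\}$, $S=\mathbb{C}$, $\mathrm{Str}(g,S,o)=o\,g$, the orientation defined by $g\in\{\pm1\}$ is $g$, $\mathrm{Os}(0,o)=o$, $Z=o$ and $\mathrm{EM}=o^{\alpha+\beta+1}$. *)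

theory Defs
  imports "HOL-Analysis.Analysis" "HOL-Library.Multiset"
begin

text \<open>
  Euclidean spaces are linear subspaces \<open>N\<close> of an ambient \<open>real^'n\<close>; this includes the zero space
  and lets a space and its summands be compared. The linear order on the index type only fixes
  signs in the standard bases of the Clifford and exterior algebras.

  An element of \<open>so(N)\<close> or \<open>SO(N)\<close> is the ambient matrix that is zero, respectively the identity,
  on the orthogonal complement of \<open>N\<close>. Elements of the complexified Lie algebra are complex matrices.
\<close>

section \<open>Linear algebra on a subspace\<close>

type_synonym 'n rmatrix = "real^'n^'n"
type_synonym 'n cmatrix = "complex^'n^'n"

definition cvec :: "real^'n \<Rightarrow> complex^'n" where
  "cvec v = (\<chi> i. complex_of_real (v $ i))"

definition cmat :: "'n::finite rmatrix \<Rightarrow> 'n cmatrix" where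
  "cmat A = map_matrix complex_of_real A"

definition mscale :: "complex \<Rightarrow> 'n::finite cmatrix \<Rightarrow> 'n cmatrix" where
  "mscale c A = map_matrix ((*) c) A"

definition complexification :: "(real^'n) set \<Rightarrow> (complex^'n) set" where
  "complexification N = {v. (\<chi> i. Re (v $ i)) \<in> N \<and> (\<chi> i. Im (v $ i)) \<in> N}"

definition orth_proj :: "(real^'n) set \<Rightarrow> 'n rmatrix" where
  "orth_proj N = matrix (\<lambda>v. THE u. u \<in> N \<and> (\<forall>w\<in>N. (v - u) \<bullet> w = 0))"

definition restr :: "(real^'n) set \<Rightarrow> 'n cmatrix \<Rightarrow> 'n cmatrix" where
  "restr N A = cmat (orth_proj N) ** A ** cmat (orth_proj N)"

definition rrestr :: "(real^'n) set \<Rightarrow> 'n rmatrix \<Rightarrow> 'n rmatrix" where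
  "rrestr N A = orth_proj N ** A ** orth_proj N"

definition orthogonal_sum :: "(real^'n) set \<Rightarrow> (real^'n) set \<Rightarrow> (real^'n) set \<Rightarrow> bool" where
  "orthogonal_sum N N0 N1 \<longleftrightarrow> subspace N0 \<and> subspace N1 \<and>
     (\<forall>x\<in>N0. \<forall>y\<in>N1. x \<bullet> y = 0) \<and> N = {x + y | x y. x \<in> N0 \<and> y \<in> N1}"

definition invertible_on :: "(real^'n) set \<Rightarrow> 'n rmatrix \<Rightarrow> bool" where
  "invertible_on N A \<longleftrightarrow> bij_betw (\<lambda>v. A *v v) N N"

text \<open>The determinant of \<open>A\<close> on the complexification of \<open>N\<close>, as the ambient determinant of the map
  that is \<open>A\<close> there and the identity on the orthogonal complement.\<close>

definition det_on :: "(real^'n) set \<Rightarrow> 'n cmatrix \<Rightarrow> complex" where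
  "det_on N A = det (A ** cmat (orth_proj N) + (mat 1 - cmat (orth_proj N)))"

definition trace_on :: "(complex^'m) set \<Rightarrow> (complex^'m \<Rightarrow> complex^'m) \<Rightarrow> complex" where
  "trace_on V T = (let B = (SOME B. vec.independent B \<and> vec.span B = V)
                   in \<Sum>b\<in>B. vec.representation B (T b) b)"

definition mat_power :: "'a::semiring_1^'n^'n \<Rightarrow> nat \<Rightarrow> 'a^'n^'n" where
  "mat_power A m = (((**) A) ^^ m) (mat 1)"

definition mat_exp :: "'a::real_normed_field^'n^'n \<Rightarrow> 'a^'n^'n" where
  "mat_exp A = (\<Sum>m. (1 / fact m) *\<^sub>R mat_power A m)"

definition so :: "(real^'n) set \<Rightarrow> ('n rmatrix) set" where
  "so N = {X. transpose X = - X \<and> (\<forall>v. X *v v \<in> N)}"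

definition so_commuting :: "(real^'n) set \<Rightarrow> 'n rmatrix \<Rightarrow> ('n rmatrix) set" where
  "so_commuting N A = {X \<in> so N. X ** A = A ** X}"

definition SO :: "(real^'n) set \<Rightarrow> ('n rmatrix) set" where
  "SO N = {g. orthogonal_matrix g \<and> det g = 1 \<and> (\<forall>v. (\<forall>w\<in>N. v \<bullet> w = 0) \<longrightarrow> g *v v = v)}"


section \<open>Exterior and Clifford algebras\<close>

text \<open>
  A multivector lists coefficients with respect to the products \<open>e\<^sub>I\<close> of standard basis vectors
  \<open>e\<^sub>i\<close>, \<open>i \<in> I\<close>, in increasing order. The complexified exterior and Clifford algebras of the
  ambient space share this underlying vector space. The symbol isomorphism sends the Clifford product
  \<open>e\<^sub>I\<close> to the wedge product \<open>e\<^sub>I\<close>, hence is the identity on coefficients; it is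
  compatible with inclusions of Euclidean spaces.
\<close>

type_synonym 'n multivector = "complex^('n set)"

definition reorder_sign :: "'n::{finite,linorder} set \<Rightarrow> 'n set \<Rightarrow> complex" where
  "reorder_sign I J = (-1) ^ card {(i, j). i \<in> I \<and> j \<in> J \<and> j < i}"

definition mv_one :: "'n::{finite,linorder} multivector" where
  "mv_one = axis {} 1"

definition mv_vec :: "complex^'n::{finite,linorder} \<Rightarrow> 'n multivector" where
  "mv_vec v = (\<Sum>i\<in>UNIV. axis {i} (v $ i))"

definition ext_mult :: "'n::{finite,linorder} multivector \<Rightarrow> 'n multivector \<Rightarrow> 'n multivector" where
  "ext_mult a b = (\<chi> K. \<Sum>I\<in>Pow K. reorder_sign I (K - I) * a $ I * b $ (K - I))"

text \<open>Normalization \<open>e\<^sub>i * e\<^sub>i = -1\<close>: the second sign contracts the common indices.\<close>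

definition cl_mult :: "'n::{finite,linorder} multivector \<Rightarrow> 'n multivector \<Rightarrow> 'n multivector" where
  "cl_mult a b = (\<chi> K. \<Sum>I\<in>UNIV. reorder_sign I (sym_diff I K) *
     (-1) ^ card (I \<inter> sym_diff I K) * a $ I * b $ (sym_diff I K))"

definition cl_exp :: "'n::{finite,linorder} multivector \<Rightarrow> 'n multivector" where
  "cl_exp a = (\<Sum>m. (1 / fact m) *\<^sub>R ((cl_mult a ^^ m) mv_one))"

definition clifford :: "(real^'n::{finite,linorder}) set \<Rightarrow> 'n multivector set" where
  "clifford N = vec.span {foldr cl_mult (map (\<lambda>v. mv_vec (cvec v)) vs) mv_one | vs. set vs \<subseteq> N}"

text \<open>The identification of \<open>so(N)\<close> with the Lie algebra of \<open>Spin(N)\<close>: the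
  element \<open>1/4 * (\<Sum>i. e\<^sub>i * X e\<^sub>i)\<close> does not depend on the orthonormal basis, and is
  \<open>\<phi>/2 * e\<^sub>1 * e\<^sub>2\<close> if \<open>X e\<^sub>1 = \<phi> e\<^sub>2\<close>, \<open>X e\<^sub>2 = - \<phi> e\<^sub>1\<close>.\<close>

definition spin_lift :: "'n::{finite,linorder} cmatrix \<Rightarrow> 'n multivector" where
  "spin_lift X = (1 / 4) *s (\<Sum>i\<in>UNIV. cl_mult (mv_vec (axis i 1)) (mv_vec (X *v axis i 1)))"

definition spin_exp :: "'n::{finite,linorder} cmatrix \<Rightarrow> 'n multivector" where
  "spin_exp X = cl_exp (spin_lift X)"


section \<open>Orientations\<close>

definition orthonormal_basis :: "(real^'n) set \<Rightarrow> (real^'n) list \<Rightarrow> bool" where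
  "orthonormal_basis N bs \<longleftrightarrow> length bs = dim N \<and> set bs \<subseteq> N \<and>
     (\<forall>i<length bs. \<forall>j<length bs. bs ! i \<bullet> bs ! j = (if i = j then 1 else 0))"

definition wedge_list :: "(real^'n::{finite,linorder}) list \<Rightarrow> 'n multivector" where
  "wedge_list bs = foldr ext_mult (map (\<lambda>v. mv_vec (cvec v)) bs) mv_one"

text \<open>An orientation of \<open>N\<close> is a unit vector of the top exterior power of \<open>N\<close>. For the
  zero space these are the scalars \<open>1\<close> and \<open>-1\<close>. Product orientations are exterior products.\<close>

definition is_orientation :: "(real^'n::{finite,linorder}) set \<Rightarrow> 'n multivector \<Rightarrow> bool" where
  "is_orientation N \<omega> \<longleftrightarrow> (\<exists>bs. orthonormal_basis N bs \<and> (\<omega> = wedge_list bs \<or> \<omega> = - wedge_list bs))"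

text \<open>Compares nonzero elements of the same real line.\<close>

definition orientation_ratio :: "'n::{finite,linorder} multivector \<Rightarrow> 'n multivector \<Rightarrow> real" where
  "orientation_ratio a b = (if \<exists>c>0. a = c *\<^sub>R b then 1 else -1)"

definition top_degree :: "(real^'n::{finite,linorder}) set \<Rightarrow> 'n multivector \<Rightarrow> 'n multivector" where
  "top_degree N a = (\<chi> I. if card I = dim N then a $ I else 0)"

definition Os :: "(real^'n::{finite,linorder}) set \<Rightarrow> 'n rmatrix \<Rightarrow> 'n multivector \<Rightarrow> real" where
  "Os N Y \<omega> = orientation_ratio (top_degree N (spin_exp (cmat Y))) \<omega>"


section \<open>Spinors\<close>

text \<open>The spinor space is realized as a left ideal of the complexified Clifford algebra of complex
  dimension \<open>2 ^ (dim N / 2)\<close>. All such ideals are isomorphic as modules (the complexified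
  Clifford algebra is a full matrix algebra), so traces do not depend on the choice.\<close>

definition spinors :: "(real^'n::{finite,linorder}) set \<Rightarrow> 'n multivector set" where
  "spinors N = (SOME S. vec.subspace S \<and> S \<subseteq> clifford N \<and>
     (\<forall>a\<in>clifford N. \<forall>s\<in>S. cl_mult a s \<in> S) \<and> vec.dim S = 2 ^ (dim N div 2))"

text \<open>An orientation \<open>e\<^sub>1 \<and> \<dots> \<and> e\<^sub>m\<close> is, as a multivector, the Clifford product
  \<open>e\<^sub>1 \<dots> e\<^sub>m\<close>. The factor \<open>i ^ (m/2)\<close> makes it an involution, and is the choice for which
  \<open>Str (exp X) = (\<Prod>j. exp (- i \<phi>\<^sub>j / 2) - exp (i \<phi>\<^sub>j / 2))\<close>.\<close>

definition chirality :: "(real^'n::{finite,linorder}) set \<Rightarrow> 'n multivector \<Rightarrow> 'n multivector" where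
  "chirality N \<omega> = (\<i> ^ (dim N div 2)) *s \<omega>"

definition spinors_plus :: "(real^'n::{finite,linorder}) set \<Rightarrow> 'n multivector \<Rightarrow> 'n multivector set" where
  "spinors_plus N \<omega> = {s \<in> spinors N. cl_mult (chirality N \<omega>) s = s}"

definition spinors_minus :: "(real^'n::{finite,linorder}) set \<Rightarrow> 'n multivector \<Rightarrow> 'n multivector set" where
  "spinors_minus N \<omega> = {s \<in> spinors N. cl_mult (chirality N \<omega>) s = - s}"

definition spin_Tr :: "(real^'n::{finite,linorder}) set \<Rightarrow> 'n multivector \<Rightarrow> complex" where
  "spin_Tr N g = trace_on (spinors N) (cl_mult g)"

definition spin_Str :: "(real^'n::{finite,linorder}) set \<Rightarrow> 'n multivector \<Rightarrow> 'n multivector \<Rightarrow> complex" where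
  "spin_Str N \<omega> g = trace_on (spinors_plus N \<omega>) (cl_mult g) - trace_on (spinors_minus N \<omega>) (cl_mult g)"


section \<open>Witten traces\<close>

definition qpow :: "complex \<Rightarrow> real \<Rightarrow> complex" where
  "qpow \<tau> s = exp (2 * \<i> * of_real pi * of_real s * \<tau>)"

text \<open>The products over \<open>n \<ge> 1\<close> are indexed by \<open>n + 1\<close> with \<open>n \<ge> 0\<close>.\<close>

definition W1 :: "complex \<Rightarrow> (real^'n) set \<Rightarrow> 'n cmatrix \<Rightarrow> complex" where
  "W1 \<tau> N g = prodinf (\<lambda>n. det_on N (mat 1 + mscale (qpow \<tau> (real (n + 1) - 1/2)) g)
                          / det_on N (mat 1 - mscale (qpow \<tau> (real (n + 1))) g))"

definition W2 :: "complex \<Rightarrow> (real^'n) set \<Rightarrow> 'n cmatrix \<Rightarrow> complex" where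
  "W2 \<tau> N g = prodinf (\<lambda>n. det_on N (mat 1 - mscale (qpow \<tau> (real (n + 1) - 1/2)) g)
                          / det_on N (mat 1 + mscale (qpow \<tau> (real (n + 1))) g))"

definition W3 :: "complex \<Rightarrow> (real^'n) set \<Rightarrow> 'n cmatrix \<Rightarrow> complex" where
  "W3 \<tau> N g = prodinf (\<lambda>n. det_on N (mat 1 + mscale (qpow \<tau> (real (n + 1))) g)
                          / det_on N (mat 1 - mscale (qpow \<tau> (real (n + 1) - 1/2)) g))"

definition W4 :: "complex \<Rightarrow> (real^'n) set \<Rightarrow> 'n cmatrix \<Rightarrow> complex" where
  "W4 \<tau> N g = prodinf (\<lambda>n. det_on N (mat 1 - mscale (qpow \<tau> (real (n + 1))) g)
                          / det_on N (mat 1 + mscale (qpow \<tau> (real (n + 1) - 1/2)) g))"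

definition W1_defined :: "complex \<Rightarrow> (real^'n) set \<Rightarrow> 'n cmatrix \<Rightarrow> bool" where
  "W1_defined \<tau> N g \<longleftrightarrow> (\<forall>n::nat. det_on N (mat 1 - mscale (qpow \<tau> (real (n + 1))) g) \<noteq> 0)"


section \<open>The functions \<open>Z\<close>\<close>

definition Z :: "complex \<Rightarrow> (real^'n::{finite,linorder}) set \<Rightarrow> 'n multivector \<Rightarrow> 'n cmatrix \<Rightarrow> complex" where
  "Z \<tau> N \<omega> R = W1 \<tau> N (mat_exp R) / spin_Str N \<omega> (spin_exp R)"

definition Z_defined ::
  "complex \<Rightarrow> (real^'n::{finite,linorder}) set \<Rightarrow> 'n multivector \<Rightarrow> 'n cmatrix \<Rightarrow> bool" where
  "Z_defined \<tau> N \<omega> R \<longleftrightarrow> W1_defined \<tau> N (mat_exp R) \<and> spin_Str N \<omega> (spin_exp R) \<noteq> 0"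

text \<open>The supertrace below is entire in \<open>\<gamma>\<close>, so it is the required holomorphic extension
  from real \<open>\<gamma>\<close>.\<close>

definition Zg :: "complex \<Rightarrow> 'n rmatrix \<Rightarrow> complex \<Rightarrow> (real^'n::{finite,linorder}) set \<Rightarrow>
    'n multivector \<Rightarrow> 'n cmatrix \<Rightarrow> complex" where
  "Zg \<gamma> J \<tau> N \<omega> R =
     W1 \<tau> N (mat_exp (mscale \<gamma> (cmat J)) ** mat_exp R)
     / spin_Str N \<omega> (cl_mult (spin_exp (mscale \<gamma> (cmat J))) (spin_exp R))"

definition Zg_defined :: "complex \<Rightarrow> 'n rmatrix \<Rightarrow> complex \<Rightarrow> (real^'n::{finite,linorder}) set \<Rightarrow>
    'n multivector \<Rightarrow> 'n cmatrix \<Rightarrow> bool" where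
  "Zg_defined \<gamma> J \<tau> N \<omega> R \<longleftrightarrow>
     W1_defined \<tau> N (mat_exp (mscale \<gamma> (cmat J)) ** mat_exp R) \<and>
     spin_Str N \<omega> (cl_mult (spin_exp (mscale \<gamma> (cmat J))) (spin_exp R)) \<noteq> 0"


section \<open>The sign of an integral infinitesimal rotation\<close>

definition weight_space :: "(real^'n) set \<Rightarrow> 'n rmatrix \<Rightarrow> int \<Rightarrow> (complex^'n) set" where
  "weight_space N J a =
     {v \<in> complexification N. cmat J *v v = (2 * \<i> * of_real pi * of_int a) *s v}"

text \<open>\<open>D\<close> plays the role of \<open>\<Delta>\<^sub>+\<close>, so \<open>\<Delta>\<close> is \<open>D + image_mset uminus D\<close>.\<close>

definition half_weights :: "(real^'n) set \<Rightarrow> 'n rmatrix \<Rightarrow> int multiset \<Rightarrow> bool" where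
  "half_weights N J D \<longleftrightarrow> (\<forall>a. count (D + image_mset uminus D) a = vec.dim (weight_space N J a))"

definition eps_sign :: "'n rmatrix \<Rightarrow> (real^'n) set \<Rightarrow> real" where
  "eps_sign J N = (-1) powi (\<Sum>\<^sub># (SOME D. half_weights N J D))"


section \<open>Points of the elliptic curve\<close>

definition lattice :: "complex \<Rightarrow> complex set" where
  "lattice \<tau> = {of_int a + of_int b * \<tau> | a b. True}"

definition has_order :: "complex \<Rightarrow> complex \<Rightarrow> nat \<Rightarrow> bool" where
  "has_order \<tau> \<gamma> k \<longleftrightarrow> k > 0 \<and> of_nat k * \<gamma> \<in> lattice \<tau> \<and>
     (\<forall>j::nat. 0 < j \<and> j < k \<longrightarrow> of_nat j * \<gamma> \<notin> lattice \<tau>)"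


section \<open>The functions \<open>EM\<close>\<close>

text \<open>In the functions below \<open>k\<close> is the order of \<open>\<gamma>\<close> and \<open>k * \<gamma> = \<alpha> + \<beta> * \<tau>\<close>.
  The exponents of \<open>-1\<close> are integers because \<open>\<alpha> + \<beta> - 1\<close>, respectively \<open>\<alpha> + \<beta>\<close>, and
  \<open>dim N\<close> are even. The case of \<open>\<alpha>\<close>, \<open>\<beta>\<close> both even does not occur for even \<open>k\<close>.\<close>

definition EM_eps :: "int \<Rightarrow> int \<Rightarrow> complex \<Rightarrow> (real^'n::{finite,linorder}) set \<Rightarrow> 'n multivector \<Rightarrow>
    'n cmatrix \<Rightarrow> complex" where
  "EM_eps \<alpha> \<beta> \<tau> N \<omega> R =
    (if odd \<alpha> \<and> even \<beta> then
       \<i> ^ (dim N div 2) * (-1) powi ((\<alpha> + \<beta> - 1) div 2 * int (dim N div 2))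
         * (1 / spin_Tr N (spin_exp R)) * W2 \<tau> N (mat_exp R)
     else if even \<alpha> \<and> odd \<beta> then
       qpow \<tau> (real (dim N) / 8) * (-1) powi ((\<alpha> + \<beta> - 1) div 2 * int (dim N div 2))
         * spin_Tr N (spin_exp R) * W3 \<tau> N (mat_exp R)
     else if odd \<alpha> \<and> odd \<beta> then
       \<i> ^ (dim N div 2) * qpow \<tau> (real (dim N) / 8)
         * (-1) powi ((\<alpha> + \<beta>) div 2 * int (dim N div 2))
         * spin_Str N \<omega> (spin_exp R) * W4 \<tau> N (mat_exp R)
     else undefined)"

definition eigenspace_on :: "(real^'n) set \<Rightarrow> 'n rmatrix \<Rightarrow> complex \<Rightarrow> (complex^'n) set" where
  "eigenspace_on N g u = {v \<in> complexification N. cmat g *v v = u *s v}"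

definition adapted :: "nat \<Rightarrow> (real^'n) set \<Rightarrow> 'n rmatrix \<Rightarrow> 'n rmatrix \<Rightarrow> bool" where
  "adapted k N \<zeta> K \<longleftrightarrow> K \<in> so N \<and>
     (\<exists>Fp (a :: complex \<Rightarrow> int).
        Fp \<union> cnj ` Fp = {u. eigenspace_on N \<zeta> u \<noteq> {0}} \<and> Fp \<inter> cnj ` Fp = {} \<and>
        (\<forall>u\<in>Fp. u = exp (2 * \<i> * of_real pi * of_int (a u) / of_nat k) \<and>
           (\<forall>v\<in>eigenspace_on N \<zeta> u. cmat K *v v = (2 * \<i> * of_real pi * of_int (a u)) *s v)))"

text \<open>The case in which both \<open>1 - \<zeta>\<close> and \<open>1 + \<zeta>\<close> are invertible on \<open>N\<close>.\<close>

definition EM_reg :: "nat \<Rightarrow> int \<Rightarrow> int \<Rightarrow> complex \<Rightarrow> 'n rmatrix \<Rightarrow> complex \<Rightarrow>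
    (real^'n::{finite,linorder}) set \<Rightarrow> 'n multivector \<Rightarrow> 'n cmatrix \<Rightarrow> complex" where
  "EM_reg k \<alpha> \<beta> \<gamma> \<zeta> \<tau> N \<omega> R =
    (let K = (SOME K. adapted k N \<zeta> K)
     in of_real (Os N ((1 / real k) *\<^sub>R K) \<omega>) powi (\<alpha> + \<beta>) * Zg \<gamma> K \<tau> N \<omega> R)"

text \<open>The general case, in which \<open>1 - \<zeta>\<close> is invertible on \<open>N\<close>. On the zero space the first
  branch yields the sign \<open>\<omega>\<close> to the power \<open>\<alpha> + \<beta> + 1\<close>.\<close>

definition EM :: "nat \<Rightarrow> int \<Rightarrow> int \<Rightarrow> complex \<Rightarrow> 'n rmatrix \<Rightarrow> complex \<Rightarrow>
    (real^'n::{finite,linorder}) set \<Rightarrow> 'n multivector \<Rightarrow> 'n cmatrix \<Rightarrow> complex" where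
  "EM k \<alpha> \<beta> \<gamma> \<zeta> \<tau> N \<omega> R =
    (if invertible_on N (mat 1 + \<zeta>) then EM_reg k \<alpha> \<beta> \<gamma> \<zeta> \<tau> N \<omega> R
     else
       (let NB = {v \<in> N. \<zeta> *v v = - v};
            NG = {v \<in> N. \<forall>w\<in>NB. v \<bullet> w = 0};
            (oB, oG) = (SOME (oB, oG). is_orientation NB oB \<and> is_orientation NG oG \<and> ext_mult oB oG = \<omega>)
        in EM_eps \<alpha> \<beta> \<tau> NB oB (restr NB R) * EM_reg k \<alpha> \<beta> \<gamma> \<zeta> \<tau> NG oG (restr NG R)))"

end

theory Submission
  imports Defs
begin

text \<open>
  For a real \<open>R\<close> commuting with \<open>J\<close>, the space splits into oriented planes rotated by both \<open>J\<close> and \<open>R\<close>,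
  with \<open>J\<close> acting through \<open>2 * pi * n\<close> for a nonzero integer \<open>n\<close> and \<open>\<zeta>\<close> rotating by \<open>2 * pi * n / k\<close>.
  Both sides become products over the planes of one theta quotient \<open>Zblock\<close>, which changes sign under
  translation of the angle by \<open>2 * pi\<close> and by \<open>2 * pi * \<tau>\<close>. Since \<open>k * \<gamma> = \<alpha> + \<beta> * \<tau>\<close>, a plane with \<open>k\<close> dividing
  \<open>n\<close> contributes the sign in \<open>eps_sign\<close>; replacing \<open>n\<close> by an adapted integer congruent to it modulo \<open>k\<close>
  changes \<open>Zblock\<close> and \<open>Os\<close> by the same sign; and half periods turn \<open>Zblock\<close> into the three functions
  \<open>EM_eps\<close>.

  On the spinor side, no classification of Clifford modules is needed: conjugation by a basis vector kills
  the trace of every nonscalar product of plane bivectors, on any left ideal of the right dimension.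
\<close>

section \<open>Theta quotients\<close>

text \<open>The definitions choose a spinor ideal, bases for traces, half of the weights, an adapted
  \<open>K\<close> and a factorisation of an orientation, and nothing says at the outset that these
  choices are immaterial. Each is removed by evaluating the quantity through rotation angles: the
  choice then disappears or changes an integer by a multiple of \<open>k\<close>. The frame of
  planes is chosen after \<open>R\<close>. A complex \<open>y\<close> merely makes the angles
  complex, and the plane formulas hold for complex angles, so no analytic continuation enters. The
  sign of an orientation enters \<open>EM\<close> with exponent
  \<open>\<alpha> + \<beta> + 1\<close>: \<open>\<alpha> + \<beta>\<close> times through
  \<open>Os\<close> and once through the supertrace. By parity the three functions
  \<open>EM_eps\<close> obey the same rule, so the planes where \<zeta> is minus the identity fit
  into the same product, and the convention for the zero space is its empty case.\<close>

definition qpoch :: "complex \<Rightarrow> complex \<Rightarrow> complex" where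
  "qpoch q a = (\<Prod>n. 1 - a * q ^ n)"

text \<open>The product form of a Jacobi theta function in the multiplicative variable
  \<open>a\<close>, without its constant factor \<open>qpoch q q\<close>. For
  \<open>0 < norm q < 1\<close> its zeros are the integer powers of \<open>q\<close>.\<close>

definition theta :: "complex \<Rightarrow> complex \<Rightarrow> complex" where
  "theta q a = qpoch q a * qpoch q (q / a)"

definition cexpi :: "complex \<Rightarrow> complex" where
  "cexpi x = exp (\<i> * x)"

lemma cexpi_add: "cexpi (x + y) = cexpi x * cexpi y"
  by (simp add: cexpi_def distrib_left exp_add)

lemma cexpi_0 [simp]: "cexpi 0 = 1"
  by (simp add: cexpi_def)

lemma cexpi_nonzero [simp]: "cexpi x \<noteq> 0"
  by (simp add: cexpi_def)

lemma cexpi_minus: "cexpi (- x) = inverse (cexpi x)"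
  by (simp add: cexpi_def exp_minus)

lemma cexpi_pi: "cexpi (of_real pi) = - 1"
  by (simp add: cexpi_def)

lemma cexpi_half_pi: "cexpi (of_real pi / 2) = \<i>"
  using cis_conv_exp[of "pi / 2"] by (simp add: cexpi_def)

lemma cexpi_half_square: "cexpi (x / 2) * cexpi (x / 2) = cexpi x"
  by (simp add: cexpi_add [symmetric])

lemma convergent_qpoch:
  fixes a q :: complex
  assumes "norm q < 1"
  shows "convergent_prod (\<lambda>n. 1 - a * q ^ n)"
proof -
  have "summable (\<lambda>n. norm a * norm q ^ n)"
    using assms by (intro summable_mult summable_geometric) simp
  then have "summable (\<lambda>n. norm ((1 - a * q ^ n) - 1))"
    by (simp add: norm_mult norm_power)
  then show ?thesis
    by (intro abs_convergent_prod_imp_convergent_prod summable_imp_abs_convergent_prod)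
qed

lemma qpoch_split:
  assumes "norm q < 1"
  shows "qpoch q a = (1 - a) * qpoch q (a * q)"
proof -
  have "(\<lambda>n. 1 - a * q ^ n) has_prod ((\<Prod>k<1. 1 - a * q ^ k) * (\<Prod>k. 1 - a * q ^ (k + 1)))"
    by (rule has_prod_ignore_initial_segment'[OF convergent_qpoch[OF assms]])
  then show ?thesis
    unfolding qpoch_def by (simp add: has_prod_iff algebra_simps)
qed

text \<open>Convergence in the sense of \<open>convergent_prod\<close> tolerates finitely many zero
  factors, so the quotient can be split without excluding poles.\<close>

lemma prodinf_quotient_qpoch:
  fixes A B :: "'i \<Rightarrow> complex"
  assumes "norm q < 1"
  shows "(\<Prod>n. (\<Prod>i\<in>I. 1 - A i * q ^ n) / (\<Prod>i\<in>I. 1 - B i * q ^ n))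
    = (\<Prod>i\<in>I. qpoch q (A i) / qpoch q (B i))"
proof -
  have "(\<Prod>n. (\<Prod>i\<in>I. 1 - A i * q ^ n) / (\<Prod>i\<in>I. 1 - B i * q ^ n))
      = (\<Prod>n. \<Prod>i\<in>I. 1 - A i * q ^ n) / (\<Prod>n. \<Prod>i\<in>I. 1 - B i * q ^ n)"
    by (intro prodinf_divide[symmetric] convergent_prod_prod convergent_qpoch assms)
  also have "\<dots> = (\<Prod>i\<in>I. qpoch q (A i)) / (\<Prod>i\<in>I. qpoch q (B i))"
    unfolding qpoch_def by (subst (1 2) prodinf_prod) (auto intro: convergent_qpoch assms)
  finally show ?thesis
    by (simp add: prod_dividef)
qed

text \<open>The shift removes the factor \<open>1 - a\<close> from one product and adds
  \<open>1 - 1 / a\<close> to the other; the quotient of the two is \<open>- 1 / a\<close>.\<close>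

lemma theta_shift:
  assumes "norm q < 1" "q \<noteq> 0" "a \<noteq> 0"
  shows "theta q (q * a) = - theta q a / a"
proof -
  have "theta q (q * a) = qpoch q (a * q) * qpoch q (1 / a)"
    using assms by (simp add: theta_def mult.commute)
  also have "qpoch q (1 / a) = (1 - 1 / a) * qpoch q (q / a)"
    using qpoch_split[OF assms(1), of "1 / a"] by simp
  also have "qpoch q (a * q) * ((1 - 1 / a) * qpoch q (q / a))
      = - ((1 - a) * qpoch q (a * q)) * qpoch q (q / a) / a"
    using assms by (simp add: field_simps)
  finally show ?thesis
    by (simp add: theta_def qpoch_split[OF assms(1), of a])
qed

text \<open>The two eigenvalues of a rotated plane give the two factors above and below;
  \<open>A\<close> and \<open>B\<close> select one of the four Witten traces.\<close>

definition wblock :: "complex \<Rightarrow> complex \<Rightarrow> complex \<Rightarrow> complex \<Rightarrow> complex" where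
  "wblock q A B x = qpoch q (A * cexpi x) * qpoch q (A * cexpi (- x))
     / (qpoch q (B * cexpi x) * qpoch q (B * cexpi (- x)))"

text \<open>The function \<open>Z\<close> of an oriented plane at a rotation of angle \<open>x\<close>, rewritten as a theta quotient
  to make its quasi-periodicity in \<open>x\<close> visible. Where the denominators vanish they do so on both sides
  of the identities below, which then read \<open>0 = 0\<close>.\<close>

definition Zblock :: "complex \<Rightarrow> complex \<Rightarrow> complex" where
  "Zblock \<tau> x = cexpi (x / 2) * theta (qpow \<tau> 1) (- qpow \<tau> (1/2) * cexpi x)
     / theta (qpow \<tau> 1) (cexpi x)"

section \<open>Powers of the nome as exponentials\<close>

lemma qpow_cexpi: "qpow \<tau> s = cexpi (2 * of_real pi * of_real s * \<tau>)"
  by (simp add: qpow_def cexpi_def mult_ac)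

lemma qpow_add: "qpow \<tau> (s + t) = qpow \<tau> s * qpow \<tau> t"
  by (simp add: qpow_cexpi cexpi_add [symmetric] algebra_simps)

lemma qpow_nonzero [simp]: "qpow \<tau> s \<noteq> 0"
  by (simp add: qpow_cexpi)

lemma qpow_power: "qpow \<tau> s ^ n = qpow \<tau> (real n * s)"
  by (induction n) (simp_all add: qpow_add [symmetric] algebra_simps qpow_cexpi[of _ 0])

lemma norm_qpow_less_1: "Im \<tau> > 0 \<Longrightarrow> norm (qpow \<tau> 1) < 1"
  by (simp add: qpow_def)

lemma qpow_Suc: "qpow \<tau> (real (n + 1)) = qpow \<tau> 1 * qpow \<tau> 1 ^ n"
  by (simp add: qpow_power qpow_add [symmetric])

lemma qpow_Suc_half: "qpow \<tau> (real (n + 1) - 1/2) = qpow \<tau> (1/2) * qpow \<tau> 1 ^ n"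
  by (simp add: qpow_power qpow_add [symmetric] field_simps)

lemma qpow_half_square: "qpow \<tau> (1/2) * qpow \<tau> (1/2) = qpow \<tau> 1"
  by (simp add: qpow_add [symmetric])

lemma qpow_half_square_mult: "qpow \<tau> (1/2) * (qpow \<tau> (1/2) * a) = qpow \<tau> 1 * a"
  by (simp add: qpow_half_square [symmetric] mult.assoc)

text \<open>The factor split off here turns into a spinor trace or supertrace by
  \<open>cexpi_half_combination\<close>; the rest is a determinant with integral powers of
  \<open>q\<close>.\<close>

lemma theta_minus_cexpi:
  assumes "Im \<tau> > 0"
  shows "theta (qpow \<tau> 1) (c * cexpi x) = (1 - c * cexpi x)
     * (qpoch (qpow \<tau> 1) (qpow \<tau> 1 * c * cexpi x) * qpoch (qpow \<tau> 1) (qpow \<tau> 1 / c * cexpi (- x)))"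
  by (simp add: theta_def qpoch_split[OF norm_qpow_less_1[OF assms], of "c * cexpi x"] cexpi_minus
      divide_inverse mult_ac)

text \<open>Half of the shift is the centre of the reflection from \<open>a\<close> to
  \<open>q / a\<close>, which therefore only replaces \<open>x\<close> by \<open>- x\<close>. This
  yields the determinants with half-integral powers of \<open>q\<close>.\<close>

lemma theta_half_cexpi:
  assumes "c * c = 1"
  shows "theta (qpow \<tau> 1) (c * qpow \<tau> (1/2) * cexpi x) =
     qpoch (qpow \<tau> 1) (c * qpow \<tau> (1/2) * cexpi x) * qpoch (qpow \<tau> 1) (c * qpow \<tau> (1/2) * cexpi (- x))"
proof -
  let ?h = "qpow \<tau> (1/2)"
  have "c \<noteq> 0"
    using assms by auto
  have "c * ?h * cexpi (- x) * (c * ?h * cexpi x) = (c * c) * (?h * ?h) * (cexpi (- x) * cexpi x)"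
    by (simp only: mult_ac)
  also have "\<dots> = qpow \<tau> 1"
    using assms by (simp add: qpow_half_square cexpi_minus)
  finally have "qpow \<tau> 1 / (c * ?h * cexpi x) = c * ?h * cexpi (- x)"
    using \<open>c \<noteq> 0\<close> by (simp add: nonzero_divide_eq_eq)
  then show ?thesis
    by (simp add: theta_def)
qed

lemma cexpi_half_combination: "cexpi (- x / 2) + c * cexpi (x / 2) = (1 + c * cexpi x) / cexpi (x / 2)"
proof -
  define z where "z = cexpi (x / 2)"
  have "cexpi (- x / 2) = inverse z" "cexpi x = z * z" "z \<noteq> 0"
    using cexpi_minus[of "x / 2"] by (simp_all add: z_def cexpi_half_square)
  then show ?thesis
    unfolding z_def[symmetric] by (simp add: field_simps)
qed

lemma Zblock_eq:
  assumes "Im \<tau> > 0"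
  shows "Zblock \<tau> x = wblock (qpow \<tau> 1) (- qpow \<tau> (1/2)) (qpow \<tau> 1) x
           / (cexpi (- x / 2) - cexpi (x / 2))"
proof -
  let ?q = "qpow \<tau> 1" and ?h = "qpow \<tau> (1/2)" and ?z = "cexpi (x / 2)"
  have "theta ?q (cexpi x) = (1 - cexpi x) * (qpoch ?q (?q * cexpi x) * qpoch ?q (?q * cexpi (- x)))"
    using theta_minus_cexpi[OF assms, of 1 x] by simp
  moreover have "theta ?q (- ?h * cexpi x) = qpoch ?q (- ?h * cexpi x) * qpoch ?q (- ?h * cexpi (- x))"
    using theta_half_cexpi[of "- 1" \<tau> x] by simp
  moreover have "cexpi (- x / 2) - ?z = (1 - cexpi x) / ?z"
    using cexpi_half_combination[of x "- 1"] by simp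
  ultimately show ?thesis
    by (simp add: Zblock_def wblock_def mult_ac)
qed

text \<open>The theta functions do not see a full turn; the sign comes from the half angle in the
  prefactor, that is, from the spin cover.\<close>

lemma Zblock_shift_1: "Zblock \<tau> (x + 2 * of_real pi) = - Zblock \<tau> x"
proof -
  have "cexpi (2 * of_real pi) = 1"
    using cexpi_add[of "of_real pi" "of_real pi"] by (simp add: cexpi_pi mult_2 [symmetric])
  then have "cexpi (x + 2 * of_real pi) = cexpi x"
    by (simp add: cexpi_add)
  moreover have "cexpi ((x + 2 * of_real pi) / 2) = - cexpi (x / 2)"
    by (simp add: add_divide_distrib cexpi_add cexpi_pi)
  ultimately show ?thesis
    by (simp add: Zblock_def)
qed

text \<open>In the quotient of the two factors from \<open>theta_shift\<close> the exponential
  \<open>cexpi x\<close> cancels and \<open>- 1 / qpow \<tau> (1/2)\<close> remains; the half-angle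
  prefactor contributes \<open>qpow \<tau> (1/2)\<close>, which leaves the sign.\<close>

lemma Zblock_shift_tau:
  assumes "Im \<tau> > 0"
  shows "Zblock \<tau> (x + 2 * of_real pi * \<tau>) = - Zblock \<tau> x"
proof -
  let ?q = "qpow \<tau> 1" and ?h = "qpow \<tau> (1/2)"
  have q: "cexpi (2 * of_real pi * \<tau>) = ?q" "cexpi (of_real pi * \<tau>) = ?h"
    by (simp_all add: qpow_cexpi)
  have "theta ?q (?q * cexpi x) = - theta ?q (cexpi x) / cexpi x"
    using norm_qpow_less_1[OF assms] by (simp add: theta_shift)
  moreover have "theta ?q (?q * (- ?h * cexpi x)) = - theta ?q (- ?h * cexpi x) / (- ?h * cexpi x)"
    by (rule theta_shift) (use norm_qpow_less_1[OF assms] in simp_all)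
  moreover have "cexpi (x + 2 * of_real pi * \<tau>) = ?q * cexpi x"
    "cexpi ((x + 2 * of_real pi * \<tau>) / 2) = ?h * cexpi (x / 2)"
    by (simp_all add: cexpi_add q add_divide_distrib)
  ultimately show ?thesis
    unfolding Zblock_def by (simp add: mult.left_commute[of ?h ?q])
qed

lemma uminus_one_powi_add_one: "(- 1 :: complex) powi (l + 1) = - ((- 1) powi l)"
  by (simp add: power_int_add)

lemma antiperiodic_int:
  fixes f :: "complex \<Rightarrow> complex"
  assumes "\<And>x. f (x + w) = - f x"
  shows "f (x + of_int l * w) = (- 1) powi l * f x"
proof (induction l rule: int_induct[where k = 0])
  case base
  show ?case by simp
next
  case (step1 i)
  have "f (x + of_int (i + 1) * w) = f ((x + of_int i * w) + w)"
    by (simp add: algebra_simps)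
  also have "\<dots> = - ((- 1) powi i * f x)"
    using step1 assms by simp
  finally show ?case
    by (simp add: uminus_one_powi_add_one)
next
  case (step2 i)
  have "f (x + of_int i * w) = f ((x + of_int (i - 1) * w) + w)"
    by (simp add: algebra_simps)
  also have "\<dots> = - f (x + of_int (i - 1) * w)"
    using assms by simp
  finally have "f (x + of_int (i - 1) * w) = - ((- 1) powi i * f x)"
    using step2 by simp
  also have "(- 1 :: complex) powi i = - ((- 1) powi (i - 1))"
    using uminus_one_powi_add_one[of "i - 1"] by simp
  finally show ?case by simp
qed

lemma Zblock_shift:
  assumes "Im \<tau> > 0"
  shows "Zblock \<tau> (x + 2 * of_real pi * (of_int l + of_int m * \<tau>)) = (- 1) powi (l + m) * Zblock \<tau> x"
proof -
  have "Zblock \<tau> (x + 2 * of_real pi * (of_int l + of_int m * \<tau>))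
     = Zblock \<tau> ((x + of_int m * (2 * of_real pi * \<tau>)) + of_int l * (2 * of_real pi))"
    by (simp add: algebra_simps)
  also have "\<dots> = (- 1) powi l * ((- 1) powi m * Zblock \<tau> x)"
    using antiperiodic_int[of "Zblock \<tau>" "2 * of_real pi"]
      antiperiodic_int[of "Zblock \<tau>" "2 * of_real pi * \<tau>"]
    by (simp add: Zblock_shift_1 Zblock_shift_tau[OF assms])
  finally show ?thesis
    by (simp add: power_int_add)
qed

section \<open>Values at the three half periods\<close>

lemma Zblock_half_1:
  assumes "Im \<tau> > 0"
  shows "Zblock \<tau> (x + of_real pi) = \<i> / (cexpi (- x / 2) + cexpi (x / 2))
     * wblock (qpow \<tau> 1) (qpow \<tau> (1/2)) (- qpow \<tau> 1) x"
proof -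
  let ?q = "qpow \<tau> 1" and ?h = "qpow \<tau> (1/2)" and ?z = "cexpi (x / 2)"
  have "theta ?q (- cexpi x) = (1 + cexpi x) * (qpoch ?q (- ?q * cexpi x) * qpoch ?q (- ?q * cexpi (- x)))"
    using theta_minus_cexpi[OF assms, of "- 1" x] by simp
  moreover have "theta ?q (?h * cexpi x) = qpoch ?q (?h * cexpi x) * qpoch ?q (?h * cexpi (- x))"
    using theta_half_cexpi[of 1 \<tau> x] by simp
  moreover have "cexpi (- x / 2) + ?z = (1 + cexpi x) / ?z"
    using cexpi_half_combination[of x 1] by simp
  moreover have "cexpi ((x + of_real pi) / 2) = \<i> * ?z" "cexpi (x + of_real pi) = - cexpi x"
    by (simp_all add: add_divide_distrib cexpi_add cexpi_half_pi cexpi_pi)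
  ultimately show ?thesis
    by (simp add: Zblock_def wblock_def)
qed

text \<open>This half period exchanges the two kinds of theta factor, so the spinor factor moves
  from the denominator to the numerator. One \<open>qpow \<tau> (1/4)\<close> per plane accounts for
  the exponent \<open>dim N / 8\<close> in \<open>EM_eps\<close>.\<close>

lemma Zblock_half_tau:
  assumes "Im \<tau> > 0"
  shows "Zblock \<tau> (x + of_real pi * \<tau>) = qpow \<tau> (1/4) * (cexpi (- x / 2) + cexpi (x / 2))
     * wblock (qpow \<tau> 1) (- qpow \<tau> 1) (qpow \<tau> (1/2)) x"
proof -
  let ?q = "qpow \<tau> 1" and ?h = "qpow \<tau> (1/2)" and ?z = "cexpi (x / 2)"
  have "theta ?q (?q * (- cexpi x)) = - theta ?q (- cexpi x) / (- cexpi x)"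
    by (rule theta_shift) (use norm_qpow_less_1[OF assms] in simp_all)
  moreover have "theta ?q (- cexpi x) = (1 + cexpi x) * (qpoch ?q (- ?q * cexpi x) * qpoch ?q (- ?q * cexpi (- x)))"
    using theta_minus_cexpi[OF assms, of "- 1" x] by simp
  moreover have "theta ?q (?h * cexpi x) = qpoch ?q (?h * cexpi x) * qpoch ?q (?h * cexpi (- x))"
    using theta_half_cexpi[of 1 \<tau> x] by simp
  moreover have "cexpi (- x / 2) + ?z = ?z * (1 + cexpi x) / cexpi x"
    using cexpi_half_combination[of x "1"] by (simp add: cexpi_half_square [of x, symmetric])
  moreover have "cexpi ((x + of_real pi * \<tau>) / 2) = qpow \<tau> (1/4) * ?z"
    by (simp add: add_divide_distrib cexpi_add qpow_cexpi)
  moreover have "cexpi (x + of_real pi * \<tau>) = ?h * cexpi x"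
    by (simp add: cexpi_add qpow_cexpi)
  ultimately show ?thesis
    by (simp add: Zblock_def wblock_def qpow_half_square_mult)
qed

text \<open>The constant \<open>- \<i>\<close> against the \<open>\<i>\<close> of
  \<open>EM_eps\<close> is absorbed by the sign there: for \<open>\<alpha> = 2 * a + 1\<close> and
  \<open>\<beta> = 2 * b + 1\<close> the full periods give \<open>(- 1) powi (a + b)\<close>, while
  \<open>(\<alpha> + \<beta>) div 2\<close> is \<open>a + b + 1\<close>.\<close>

lemma Zblock_half_1_tau:
  assumes "Im \<tau> > 0"
  shows "Zblock \<tau> (x + of_real pi * (1 + \<tau>)) = - \<i> * qpow \<tau> (1/4) * (cexpi (- x / 2) - cexpi (x / 2))
     * wblock (qpow \<tau> 1) (qpow \<tau> 1) (- qpow \<tau> (1/2)) x"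
proof -
  let ?q = "qpow \<tau> 1" and ?h = "qpow \<tau> (1/2)" and ?z = "cexpi (x / 2)"
  have "theta ?q (?q * cexpi x) = - theta ?q (cexpi x) / cexpi x"
    by (rule theta_shift) (use norm_qpow_less_1[OF assms] in simp_all)
  moreover have "theta ?q (cexpi x) = (1 - cexpi x) * (qpoch ?q (?q * cexpi x) * qpoch ?q (?q * cexpi (- x)))"
    using theta_minus_cexpi[OF assms, of 1 x] by simp
  moreover have "theta ?q (- ?h * cexpi x) = qpoch ?q (- ?h * cexpi x) * qpoch ?q (- ?h * cexpi (- x))"
    using theta_half_cexpi[of "- 1" \<tau> x] by simp
  moreover have "cexpi (- x / 2) - ?z = ?z * (1 - cexpi x) / cexpi x"
    using cexpi_half_combination[of x "- 1"] by (simp add: cexpi_half_square [of x, symmetric])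
  moreover have "cexpi ((x + of_real pi * (1 + \<tau>)) / 2) = \<i> * qpow \<tau> (1/4) * ?z"
    by (simp add: add_divide_distrib cexpi_add qpow_cexpi cexpi_half_pi distrib_left)
  moreover have "cexpi (x + of_real pi * (1 + \<tau>)) = - ?h * cexpi x"
    by (simp add: cexpi_add qpow_cexpi cexpi_pi distrib_left)
  ultimately show ?thesis
    by (simp add: Zblock_def wblock_def qpow_half_square_mult)
qed

section \<open>Spectral calculus of rotations\<close>

text \<open>Bilinear rather than Hermitian: the basis dual to complex eigenvectors is expressed by
  it without conjugation.\<close>

definition cdot :: "complex^'n::finite \<Rightarrow> complex^'n \<Rightarrow> complex" where
  "cdot w u = (\<Sum>i\<in>UNIV. w $ i * u $ i)"

definition outer :: "complex^'n::finite \<Rightarrow> complex^'n \<Rightarrow> 'n cmatrix" where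
  "outer u w = (\<chi> i j. u $ i * w $ j)"

definition diag_sum :: "'i set \<Rightarrow> ('i \<Rightarrow> complex^'n::finite) \<Rightarrow> ('i \<Rightarrow> complex^'n) \<Rightarrow> ('i \<Rightarrow> complex) \<Rightarrow> 'n cmatrix" where
  "diag_sum I u w c = (\<Sum>i\<in>I. mscale (c i) (outer (u i) (w i)))"

text \<open>For a biorthogonal system this has eigenvalue \<open>c i\<close> on \<open>u i\<close>
  and fixes the common kernel of the \<open>w i\<close>, in accordance with the encoding of
  \<open>SO(N)\<close> by ambient matrices.\<close>

definition diag_id :: "'i set \<Rightarrow> ('i \<Rightarrow> complex^'n::finite) \<Rightarrow> ('i \<Rightarrow> complex^'n) \<Rightarrow> ('i \<Rightarrow> complex) \<Rightarrow> 'n cmatrix" where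
  "diag_id I u w c = mat 1 + diag_sum I u w (\<lambda>i. c i - 1)"

definition biorth :: "'i set \<Rightarrow> ('i \<Rightarrow> complex^'n::finite) \<Rightarrow> ('i \<Rightarrow> complex^'n) \<Rightarrow> bool" where
  "biorth I u w \<longleftrightarrow> finite I \<and> (\<forall>i\<in>I. \<forall>j\<in>I. cdot (w i) (u j) = (if i = j then 1 else 0))"

section \<open>Matrices diagonal in a biorthogonal system\<close>

lemma mscale_component [simp]: "mscale c A $ i $ j = c * A $ i $ j"
  by (simp add: mscale_def map_matrix_def)

lemma cmat_component [simp]: "cmat A $ i $ j = complex_of_real (A $ i $ j)"
  by (simp add: cmat_def map_matrix_def)

lemma cvec_component [simp]: "cvec v $ i = complex_of_real (v $ i)"
  by (simp add: cvec_def)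

lemma outer_component [simp]: "outer u w $ i $ j = u $ i * w $ j"
  by (simp add: outer_def)

lemma mat_1_component: "(mat 1 :: 'a::semiring_1^'n^'n) $ i $ j = (if i = j then 1 else 0)"
  by (simp add: mat_def)

lemma cdot_add_right: "cdot w (x + y) = cdot w x + cdot w y"
  by (simp add: cdot_def distrib_left sum.distrib)

lemma cdot_diff_right: "cdot w (x - y) = cdot w x - cdot w y"
  by (simp add: cdot_def right_diff_distrib sum_subtractf)

lemma cdot_scale_right: "cdot w (c *s x) = c * cdot w x"
  by (simp add: cdot_def sum_distrib_left mult_ac)

lemma cdot_commute: "cdot w x = cdot x w"
  by (simp add: cdot_def mult.commute)

lemma cdot_add_left: "cdot (x + y) w = cdot x w + cdot y w"
  by (simp add: cdot_commute[of _ w] cdot_add_right)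

lemma cdot_scale_left: "cdot (c *s x) w = c * cdot x w"
  by (simp add: cdot_commute[of _ w] cdot_scale_right)

lemma cdot_sum_right: "cdot w (sum f A) = (\<Sum>a\<in>A. cdot w (f a))"
  by (induction A rule: infinite_finite_induct) (simp_all add: cdot_add_right, simp_all add: cdot_def)

lemma cdot_cvec: "cdot (cvec v) (cvec w) = complex_of_real (v \<bullet> w)"
  by (simp add: cdot_def inner_vec_def)

lemma diag_sum_component: "diag_sum I u w c $ a $ b = (\<Sum>i\<in>I. c i * (u i $ a * w i $ b))"
  by (simp add: diag_sum_def sum_component)

lemma diag_sum_vector: "diag_sum I u w c *v x = (\<Sum>i\<in>I. (c i * cdot (w i) x) *s u i)"
proof -
  have "(diag_sum I u w c *v x) $ a = (\<Sum>i\<in>I. (c i * cdot (w i) x) *s u i) $ a" for a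
  proof -
    have "(diag_sum I u w c *v x) $ a = (\<Sum>b\<in>UNIV. \<Sum>i\<in>I. c i * (u i $ a * w i $ b) * x $ b)"
      by (simp add: matrix_vector_mult_def diag_sum_component sum_distrib_right)
    also have "\<dots> = (\<Sum>i\<in>I. \<Sum>b\<in>UNIV. c i * (u i $ a * w i $ b) * x $ b)"
      by (rule sum.swap)
    finally show ?thesis
      by (simp add: sum_component cdot_def sum_distrib_left sum_distrib_right mult_ac)
  qed
  then show ?thesis
    by (simp add: vec_eq_iff)
qed

lemma diag_sum_eigen:
  assumes "biorth I u w" "j \<in> I"
  shows "diag_sum I u w c *v u j = c j *s u j"
proof -
  have "diag_sum I u w c *v u j = (\<Sum>i\<in>I. if i = j then c j *s u j else 0)"
    unfolding diag_sum_vector using assms by (intro sum.cong) (auto simp: biorth_def)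
  then show ?thesis
    using assms by (simp add: biorth_def)
qed

lemma cdot_diag_sum:
  assumes "biorth I u w" "j \<in> I"
  shows "cdot (w j) (diag_sum I u w c *v x) = c j * cdot (w j) x"
proof -
  have "cdot (w j) (diag_sum I u w c *v x) = (\<Sum>i\<in>I. if i = j then c j * cdot (w j) x else 0)"
    unfolding diag_sum_vector cdot_sum_right
    using assms by (intro sum.cong) (auto simp: biorth_def cdot_scale_right)
  then show ?thesis
    using assms by (simp add: biorth_def)
qed

lemma matrix_mult_distribs:
  fixes A :: "'a::comm_ring_1^'n^'m"
  shows "(A + B) ** C = A ** C + B ** C" "(A - B) ** C = A ** C - B ** C" "A ** (C - D) = A ** C - A ** D"
  by (simp_all add: vec_eq_iff matrix_matrix_mult_def sum.distrib sum_subtractf algebra_simps)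

lemma matrix_eqI_vector: "(\<And>x. A *v x = B *v x) \<Longrightarrow> A = B"
  for A B :: "'a::comm_ring_1^'n^'m"
  by (metis matrix_eq)

lemma diag_sum_mult:
  assumes "biorth I u w"
  shows "diag_sum I u w c ** diag_sum I u w d = diag_sum I u w (\<lambda>i. c i * d i)"
proof (rule matrix_eqI_vector)
  fix x
  have "(diag_sum I u w c ** diag_sum I u w d) *v x = diag_sum I u w c *v (diag_sum I u w d *v x)"
    by (simp add: matrix_vector_mul_assoc)
  also have "\<dots> = diag_sum I u w (\<lambda>i. c i * d i) *v x"
    by (subst (1 3) diag_sum_vector, rule sum.cong) (use assms in \<open>simp_all add: cdot_diag_sum mult_ac\<close>)
  finally show "(diag_sum I u w c ** diag_sum I u w d) *v x = diag_sum I u w (\<lambda>i. c i * d i) *v x" .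
qed

lemma diag_sum_add: "diag_sum I u w c + diag_sum I u w d = diag_sum I u w (\<lambda>i. c i + d i)"
  by (simp add: vec_eq_iff diag_sum_component sum.distrib distrib_right)

lemma mscale_diag_sum: "mscale a (diag_sum I u w c) = diag_sum I u w (\<lambda>i. a * c i)"
  by (simp add: vec_eq_iff diag_sum_component sum_distrib_left mult_ac)

lemma diag_sum_cong: "(\<And>i. i \<in> I \<Longrightarrow> c i = d i) \<Longrightarrow> diag_sum I u w c = diag_sum I u w d"
  by (simp add: diag_sum_def)

text \<open>Padding with zero coefficients lets a sum over a subsystem be multiplied with one over
  the larger system.\<close>

lemma diag_sum_mono_neutral:
  assumes "finite J" "I \<subseteq> J"
  shows "diag_sum I u w c = diag_sum J u w (\<lambda>i. if i \<in> I then c i else 0)"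
  unfolding diag_sum_def using assms
  by (intro sum.mono_neutral_cong_left) (auto simp: vec_eq_iff)

lemma diag_id_mult:
  assumes "biorth I u w"
  shows "diag_id I u w c ** diag_id I u w d = diag_id I u w (\<lambda>i. c i * d i)"
proof -
  have "diag_id I u w c ** diag_id I u w d = mat 1 + (diag_sum I u w (\<lambda>i. c i - 1)
      + (diag_sum I u w (\<lambda>i. d i - 1) + diag_sum I u w (\<lambda>i. (c i - 1) * (d i - 1))))"
    unfolding diag_id_def
    by (simp add: matrix_add_ldistrib matrix_mult_distribs diag_sum_mult[OF assms])
  then show ?thesis
    by (simp add: diag_sum_add diag_id_def) (rule diag_sum_cong, simp add: algebra_simps)
qed

lemma diag_id_vector: "diag_id I u w c *v x = x + diag_sum I u w (\<lambda>i. c i - 1) *v x"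
  by (simp add: diag_id_def matrix_vector_mult_add_rdistrib)

lemma diag_id_eigen:
  assumes "biorth I u w" "j \<in> I"
  shows "diag_id I u w c *v u j = c j *s u j"
  using assms by (simp add: diag_id_vector diag_sum_eigen vec.scale_left_diff_distrib)

lemma cdot_diag_id:
  assumes "biorth I u w" "j \<in> I"
  shows "cdot (w j) (diag_id I u w c *v x) = c j * cdot (w j) x"
  using assms by (simp add: diag_id_vector cdot_add_right cdot_diag_sum algebra_simps)

text \<open>The matrix determinant lemma. If \<open>w $ k\<close> is nonzero, conjugation by the identity matrix with
  row \<open>k\<close> replaced by \<open>w\<close> reduces to the case \<open>w = axis k 1\<close>, which is Cramer's rule.\<close>

lemma det_mat_1_outer: "det (mat 1 + outer u w) = 1 + cdot w u"
proof (cases "w = 0")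
  case True
  then have "mat 1 + outer u w = mat 1"
    by (simp add: vec_eq_iff)
  then show ?thesis
    using True by (simp add: cdot_def)
next
  case False
  then obtain k where k: "w $ k \<noteq> 0"
    by (auto simp: vec_eq_iff)
  have axis_case: "det (mat 1 + outer v (axis k 1)) = 1 + v $ k" for v :: "complex^'a"
  proof -
    have "(\<chi> i j. if j = k then (mat 1 *v (axis k 1 + v)) $ i else mat 1 $ i $ j) = mat 1 + outer v (axis k 1)"
      by (auto simp: vec_eq_iff mat_1_component axis_def)
    with cramer_lemma[of k "mat 1" "axis k 1 + v"] show ?thesis
      by simp
  qed
  define S :: "'a cmatrix" where "S = mat 1 + outer (axis k 1) (w - axis k 1)"
  have Sv: "S *v x = x + (cdot w x - x $ k) *s axis k 1" for x
  proof -
    have "(S *v x) $ i = (x + (cdot w x - x $ k) *s axis k 1) $ i" for i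
      by (cases "i = k")
        (simp_all add: S_def matrix_vector_mult_def mat_1_component axis_def cdot_def
          distrib_right left_diff_distrib sum.distrib sum_subtractf if_distrib[where f = "\<lambda>x. x * _"] cong: if_cong)
    then show ?thesis
      by (simp add: vec_eq_iff)
  qed
  have transpose_eq: "transpose S = mat 1 + outer (w - axis k 1) (axis k 1)"
    by (auto simp: S_def transpose_def vec_eq_iff mat_1_component)
  have "det S = w $ k"
    using axis_case[of "w - axis k 1"] by (subst det_transpose[symmetric]) (simp add: transpose_eq axis_def)
  have "S ** (mat 1 + outer u w) = (mat 1 + outer (S *v u) (axis k 1)) ** S"
  proof (rule matrix_eqI_vector)
    fix x
    have outer_vector: "outer a b *v x = cdot b x *s a" for a b x :: "complex^'a"
      by (simp add: vec_eq_iff matrix_vector_mult_def cdot_def sum_distrib_left mult_ac)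
    have "cdot (axis k 1) (S *v x) = cdot w x"
      by (simp add: Sv cdot_add_right cdot_scale_right)
        (simp add: cdot_def axis_def if_distrib[where f = "\<lambda>x. x * _"] cong: if_cong)
    then show "(S ** (mat 1 + outer u w)) *v x = ((mat 1 + outer (S *v u) (axis k 1)) ** S) *v x"
      by (simp add: matrix_vector_mul_assoc[symmetric] matrix_vector_mult_add_rdistrib
          matrix_vector_right_distrib outer_vector vector_scalar_commute)
  qed
  then have "det S * det (mat 1 + outer u w) = (1 + (S *v u) $ k) * det S"
    using axis_case[of "S *v u"] by (metis det_mul)
  then have "det (mat 1 + outer u w) = 1 + (S *v u) $ k"
    using \<open>det S = w $ k\<close> k by simp
  then show ?thesis
    by (simp add: Sv axis_def)
qed

text \<open>Rank-one factors are peeled off one at a time; the cross terms vanish because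
  \<open>w k\<close> annihilates the remaining \<open>u i\<close>.\<close>

lemma det_diag_id:
  assumes "biorth I u w"
  shows "det (diag_id I u w c) = (\<Prod>i\<in>I. c i)"
proof -
  have "finite I"
    using assms by (simp add: biorth_def)
  then show ?thesis
    using assms
  proof (induction I)
    case empty
    then show ?case
      by (simp add: diag_id_def diag_sum_def)
  next
    case (insert k I)
    then have bo: "biorth I u w"
      by (auto simp: biorth_def)
    have "diag_id (insert k I) u w c = diag_id {k} u w c ** diag_id I u w c"
    proof (rule matrix_eqI_vector)
      fix x
      have "cdot (w k) (\<Sum>i\<in>I. ((c i - 1) * cdot (w i) x) *s u i) = 0"
        unfolding cdot_sum_right using insert
        by (intro sum.neutral) (auto simp: cdot_scale_right biorth_def)
      then show "diag_id (insert k I) u w c *v x = (diag_id {k} u w c ** diag_id I u w c) *v x"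
        using insert.hyps
        by (simp add: matrix_vector_mul_assoc[symmetric] diag_id_vector diag_sum_vector cdot_add_right)
    qed
    moreover have "det (diag_id {k} u w c) = c k"
    proof -
      have "diag_id {k} u w c = mat 1 + outer ((c k - 1) *s u k) (w k)"
        by (simp add: diag_id_def diag_sum_def vec_eq_iff algebra_simps)
      moreover have "cdot (w k) (u k) = 1"
        using insert.prems by (simp add: biorth_def)
      ultimately show ?thesis
        by (simp add: det_mat_1_outer cdot_scale_right cdot_diff_right algebra_simps)
    qed
    ultimately show ?case
      using insert.hyps insert.IH[OF bo] by (simp add: det_mul)
  qed
qed

section \<open>Exponentials of diagonalised matrices\<close>

lemma mat_power_0: "mat_power A 0 = mat 1"
  by (simp add: mat_power_def)

lemma mat_power_Suc: "mat_power A (Suc m) = A ** mat_power A m"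
  by (simp add: mat_power_def)

text \<open>The zeroth power is the full identity and not the projection onto the span, hence the
  extra term at \<open>m = 0\<close>. In the exponential series it becomes the identity off the
  span.\<close>

lemma mat_power_diag_sum:
  assumes "biorth I u w"
  shows "mat_power (diag_sum I u w c) m
    = (if m = 0 then mat 1 - diag_sum I u w (\<lambda>_. 1) else 0) + diag_sum I u w (\<lambda>i. c i ^ m)"
proof (induction m)
  case 0
  then show ?case by (simp add: mat_power_0)
next
  case (Suc m)
  have "diag_sum I u w c ** (mat 1 - diag_sum I u w (\<lambda>_. 1)) = 0"
    using diag_sum_mult[OF assms, of c "\<lambda>_. 1"] by (simp add: matrix_mult_distribs)
  then show ?case
    by (simp add: mat_power_Suc Suc.IH matrix_add_ldistrib diag_sum_mult[OF assms])
qed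

lemma diag_sum_sums:
  assumes "\<And>i. i \<in> I \<Longrightarrow> (\<lambda>m. f m i) sums s i"
  shows "(\<lambda>m. diag_sum I u w (f m)) sums diag_sum I u w s"
  unfolding diag_sum_def
proof (rule sums_sum)
  fix i assume "i \<in> I"
  have "linear (\<lambda>c. mscale c (outer (u i) (w i)))"
    by (rule linearI) (simp_all add: vec_eq_iff algebra_simps)
  then have "bounded_linear (\<lambda>c. mscale c (outer (u i) (w i)))"
    by (rule linear_conv_bounded_linear[THEN iffD1])
  then show "(\<lambda>m. mscale (f m i) (outer (u i) (w i))) sums mscale (s i) (outer (u i) (w i))"
    by (rule bounded_linear.sums) (rule assms[OF \<open>i \<in> I\<close>])
qed

text \<open>Kept as a statement of convergence: the exponential of a real matrix is obtained through
  \<open>cmat_mat_exp\<close>, which starts from a convergent complex series.\<close>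

lemma mat_exp_sums_diag_sum:
  assumes "biorth I u w"
  shows "(\<lambda>m. (1 / fact m) *\<^sub>R mat_power (diag_sum I u w c) m) sums diag_id I u w (\<lambda>i. exp (c i))"
proof -
  have scaleR: "r *\<^sub>R diag_sum I u w d = diag_sum I u w (\<lambda>i. of_real r * d i)" for r :: real and d
    by (simp add: vec_eq_iff diag_sum_component) (simp add: scaleR_conv_of_real sum_distrib_left mult_ac)
  have *: "(1 / fact m) *\<^sub>R mat_power (diag_sum I u w c) m
      = (if m = 0 then mat 1 - diag_sum I u w (\<lambda>_. 1) else 0) + diag_sum I u w (\<lambda>i. c i ^ m /\<^sub>R fact m)" for m
    by (simp add: mat_power_diag_sum[OF assms] scaleR_add_right scaleR)
      (auto intro!: diag_sum_cong simp: scaleR_conv_of_real divide_inverse)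
  have "(\<lambda>m. (if m = 0 then mat 1 - diag_sum I u w (\<lambda>_. 1) else 0) + diag_sum I u w (\<lambda>i. c i ^ m /\<^sub>R fact m))
      sums ((mat 1 - diag_sum I u w (\<lambda>_. 1)) + diag_sum I u w (\<lambda>i. exp (c i)))"
    by (intro sums_add diag_sum_sums exp_converges)
      (use sums_single[of 0 "\<lambda>_. mat 1 - diag_sum I u w (\<lambda>_. 1)"] in simp)
  moreover have "(mat 1 - diag_sum I u w (\<lambda>_. 1)) + diag_sum I u w (\<lambda>i. exp (c i)) = diag_id I u w (\<lambda>i. exp (c i))"
    by (simp add: diag_id_def vec_eq_iff diag_sum_component left_diff_distrib sum_subtractf)
  ultimately show ?thesis
    by (simp add: *)
qed

lemma mat_exp_diag_sum:
  assumes "biorth I u w"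
  shows "mat_exp (diag_sum I u w c) = diag_id I u w (\<lambda>i. exp (c i))"
  unfolding mat_exp_def using mat_exp_sums_diag_sum[OF assms] by (rule sums_unique[symmetric])

section \<open>Complexification of real matrices and vectors\<close>

lemma cmat_mult: "cmat (A ** B) = cmat A ** cmat B"
  by (simp add: vec_eq_iff matrix_matrix_mult_def)

lemma cmat_scaleR: "cmat (r *\<^sub>R A) = r *\<^sub>R cmat A"
  by (simp add: vec_eq_iff) (simp add: scaleR_conv_of_real)

lemma cmat_mat_1: "cmat (mat 1) = mat 1"
  by (simp add: vec_eq_iff mat_1_component)

lemma cmat_power: "cmat (mat_power A m) = mat_power (cmat A) m"
  by (induction m) (simp_all add: mat_power_0 mat_power_Suc cmat_mult cmat_mat_1)

lemma cmat_eq_iff: "cmat A = cmat B \<longleftrightarrow> A = B"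
  by (simp add: vec_eq_iff)

lemma cvec_eq_iff: "cvec v = cvec w \<longleftrightarrow> v = w"
  by (simp add: vec_eq_iff)

lemma cmat_cvec: "cmat A *v cvec v = cvec (A *v v)"
  by (simp add: vec_eq_iff matrix_vector_mult_def)

lemma cvec_simps: "cvec (v + w) = cvec v + cvec w" "cvec (- v) = - cvec v" "cvec (v - w) = cvec v - cvec w"
  "cvec (r *\<^sub>R v) = of_real r *s cvec v" "cvec 0 = 0"
  by (simp_all add: vec_eq_iff)

text \<open>The entrywise real part is a continuous left inverse of \<open>cmat\<close>, so the
  complex series converges to the complexification of its own real part.\<close>

lemma cmat_mat_exp:
  fixes A :: "'n::finite rmatrix"
  assumes "(\<lambda>m. (1 / fact m) *\<^sub>R mat_power (cmat A) m) sums L"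
  shows "cmat (mat_exp A) = L"
proof -
  let ?Re = "map_matrix Re :: 'n cmatrix \<Rightarrow> 'n rmatrix"
  have lin: "bounded_linear ?Re" "bounded_linear (cmat :: 'n rmatrix \<Rightarrow> _)"
    by (rule linear_conv_bounded_linear[THEN iffD1], rule linearI;
      simp add: vec_eq_iff map_matrix_def scaleR_conv_of_real[where 'a = complex])+
  have "(\<lambda>m. ?Re ((1 / fact m) *\<^sub>R mat_power (cmat A) m)) sums ?Re L"
    by (rule bounded_linear.sums[OF lin(1) assms])
  moreover have "?Re ((1 / fact m) *\<^sub>R mat_power (cmat A) m) = (1 / fact m) *\<^sub>R mat_power A m" for m
    unfolding cmat_power[symmetric] by (simp add: vec_eq_iff map_matrix_def)
  ultimately have real: "(\<lambda>m. (1 / fact m) *\<^sub>R mat_power A m) sums ?Re L"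
    by simp
  then have "mat_exp A = ?Re L"
    unfolding mat_exp_def by (rule sums_unique[symmetric])
  moreover have "(\<lambda>m. cmat ((1 / fact m) *\<^sub>R mat_power A m)) sums cmat (?Re L)"
    by (rule bounded_linear.sums[OF lin(2) real])
  then have "(\<lambda>m. (1 / fact m) *\<^sub>R mat_power (cmat A) m) sums cmat (?Re L)"
    by (simp only: cmat_scaleR cmat_power)
  ultimately show ?thesis
    by (metis sums_unique2[OF assms])
qed

text \<open>A pair \<open>(e, f)\<close> stands for the oriented plane with orthonormal basis \<open>e, f\<close>.\<close>

type_synonym 'n plane = "(real^'n) \<times> (real^'n)"

definition frame :: "'n::finite plane set \<Rightarrow> bool" where
  "frame B \<longleftrightarrow> finite B \<and> (\<forall>p\<in>B. \<forall>q\<in>B. fst p \<bullet> fst q = (if p = q then 1 else 0) \<and>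
     snd p \<bullet> snd q = (if p = q then 1 else 0) \<and> fst p \<bullet> snd q = 0)"

definition frame_space :: "'n::finite plane set \<Rightarrow> (real^'n) set" where
  "frame_space B = span (fst ` B \<union> snd ` B)"

definition plane_rot :: "'n::finite plane \<Rightarrow> 'n rmatrix" where
  "plane_rot p = (\<chi> i j. snd p $ i * fst p $ j - fst p $ i * snd p $ j)"

definition rskew :: "'n::finite plane set \<Rightarrow> ('n plane \<Rightarrow> real) \<Rightarrow> 'n rmatrix" where
  "rskew B a = (\<Sum>p\<in>B. a p *\<^sub>R plane_rot p)"

definition skew :: "'n::finite plane set \<Rightarrow> ('n plane \<Rightarrow> complex) \<Rightarrow> 'n cmatrix" where
  "skew B \<theta> = (\<Sum>p\<in>B. mscale (\<theta> p) (cmat (plane_rot p)))"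

definition bsign :: "bool \<Rightarrow> complex" where
  "bsign s = (if s then 1 else - 1)"

text \<open>Eigenvectors of \<open>plane_rot p\<close> for the eigenvalues \<open>\<plusminus> \<i>\<close>, and the dual basis.\<close>

definition plane_u :: "'n::finite plane \<times> bool \<Rightarrow> complex^'n" where
  "plane_u = (\<lambda>(p, s). cvec (fst p) - (bsign s * \<i>) *s cvec (snd p))"

definition plane_w :: "'n::finite plane \<times> bool \<Rightarrow> complex^'n" where
  "plane_w = (\<lambda>(p, s). (1 / 2) *s (cvec (fst p) + (bsign s * \<i>) *s cvec (snd p)))"

abbreviation plane_diag :: "'n::finite plane set \<Rightarrow> ('n plane \<times> bool \<Rightarrow> complex) \<Rightarrow> 'n cmatrix" where
  "plane_diag B c \<equiv> diag_sum (B \<times> UNIV) plane_u plane_w c"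

definition rotation :: "'n::finite plane set \<Rightarrow> ('n plane \<Rightarrow> complex) \<Rightarrow> 'n cmatrix" where
  "rotation B \<theta> = diag_id (B \<times> UNIV) plane_u plane_w (\<lambda>(p, s). cexpi (bsign s * \<theta> p))"

section \<open>Eigenvectors attached to a frame of planes\<close>

lemma frame_subset: "frame K \<Longrightarrow> B \<subseteq> K \<Longrightarrow> frame B"
  unfolding frame_def by (meson finite_subset subsetD)

lemma frame_finite: "frame B \<Longrightarrow> finite B"
  by (simp add: frame_def)

lemma frame_inner:
  assumes "frame B" "p \<in> B" "q \<in> B"
  shows "fst p \<bullet> fst q = (if p = q then 1 else 0)" "snd p \<bullet> snd q = (if p = q then 1 else 0)"
    "fst p \<bullet> snd q = 0" "snd q \<bullet> fst p = 0"
  using assms by (auto simp: frame_def inner_commute)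

lemma biorth_plane:
  assumes "frame B"
  shows "biorth (B \<times> UNIV) plane_u plane_w"
  unfolding biorth_def
proof (intro conjI ballI)
  show "finite (B \<times> (UNIV :: bool set))"
    using frame_finite[OF assms] by simp
  fix i j assume "i \<in> B \<times> (UNIV :: bool set)" "j \<in> B \<times> (UNIV :: bool set)"
  then show "cdot (plane_w i) (plane_u j) = (if i = j then 1 else 0)"
    using frame_inner[OF assms, of "fst i" "fst j"] frame_inner[OF assms, of "fst j" "fst i"]
    by (cases i; cases j)
      (auto simp: plane_u_def plane_w_def bsign_def cdot_scale_left cdot_scale_right cdot_add_left
        cdot_diff_right cdot_cvec)
qed

lemma sum_plane_diag:
  "(\<Sum>i\<in>B \<times> (UNIV :: bool set). g i) = (\<Sum>p\<in>B. g (p, True) + g (p, False))"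
  using sum.cartesian_product[of "\<lambda>p s. g (p, s)" UNIV B] by (simp add: UNIV_bool add.commute)

lemma prod_plane_diag:
  "(\<Prod>i\<in>B \<times> (UNIV :: bool set). g i) = (\<Prod>p\<in>B. g (p, True) * g (p, False))"
  using prod.cartesian_product[of "\<lambda>p s. g (p, s)" UNIV B] by (simp add: UNIV_bool mult.commute)

lemma diag_sum_diff: "diag_sum I u w c - diag_sum I u w d = diag_sum I u w (\<lambda>i. c i - d i)"
  by (simp add: vec_eq_iff diag_sum_component sum_subtractf left_diff_distrib)

lemma skew_plane_diag: "skew B \<theta> = plane_diag B (\<lambda>(p, s). \<i> * (bsign s * \<theta> p))"
  by (simp add: vec_eq_iff diag_sum_component sum_plane_diag skew_def sum_component)
    (auto intro!: sum.cong simp: plane_rot_def plane_u_def plane_w_def bsign_def algebra_simps)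

lemma cmat_rskew: "cmat (rskew B a) = skew B (\<lambda>p. complex_of_real (a p))"
  by (simp add: vec_eq_iff rskew_def skew_def sum_component)

lemma skew_add: "skew B \<theta> + skew B \<phi> = skew B (\<lambda>p. \<theta> p + \<phi> p)"
  by (simp add: skew_def sum.distrib[symmetric] vec_eq_iff sum_component algebra_simps)

lemma mscale_skew: "mscale y (skew B \<theta>) = skew B (\<lambda>p. y * \<theta> p)"
  by (simp add: skew_def vec_eq_iff sum_component sum_distrib_left mult_ac)

lemma mat_exp_skew:
  assumes "frame B"
  shows "mat_exp (skew B \<theta>) = rotation B \<theta>"
  unfolding skew_plane_diag mat_exp_diag_sum[OF biorth_plane[OF assms]] rotation_def
  by (simp add: cexpi_def case_prod_unfold)

lemma cmat_mat_exp_rskew: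
  assumes "frame B"
  shows "cmat (mat_exp (rskew B a)) = rotation B (\<lambda>p. complex_of_real (a p))"
  using cmat_mat_exp[of "rskew B a"] mat_exp_sums_diag_sum[OF biorth_plane[OF assms]]
  unfolding cmat_rskew skew_plane_diag rotation_def by (simp add: cexpi_def case_prod_unfold)

lemma rotation_mult:
  assumes "frame B"
  shows "rotation B \<theta> ** rotation B \<phi> = rotation B (\<lambda>p. \<theta> p + \<phi> p)"
  unfolding rotation_def diag_id_mult[OF biorth_plane[OF assms]]
  by (simp add: case_prod_unfold distrib_left cexpi_add)

section \<open>The space spanned by a frame and its orthogonal projection\<close>

lemma subspace_frame_space: "subspace (frame_space B)"
  by (simp add: frame_space_def)

lemma frame_space_mem: "p \<in> B \<Longrightarrow> fst p \<in> frame_space B" "p \<in> B \<Longrightarrow> snd p \<in> frame_space B"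
  unfolding frame_space_def by (auto intro!: span_base)

lemma frame_space_mono: "A \<subseteq> B \<Longrightarrow> frame_space A \<subseteq> frame_space B"
  unfolding frame_space_def by (intro span_mono) auto

lemma frame_space_subset:
  assumes "subspace N" "\<And>p. p \<in> B \<Longrightarrow> fst p \<in> N \<and> snd p \<in> N"
  shows "frame_space B \<subseteq> N"
  unfolding frame_space_def using assms by (intro span_minimal) auto

definition frame_proj :: "'n::finite plane set \<Rightarrow> real^'n \<Rightarrow> real^'n" where
  "frame_proj B v = (\<Sum>p\<in>B. (v \<bullet> fst p) *\<^sub>R fst p + (v \<bullet> snd p) *\<^sub>R snd p)"

lemma frame_proj_mem: "frame_proj B v \<in> frame_space B"
  unfolding frame_proj_def
  by (intro subspace_sum[OF subspace_frame_space] subspace_add[OF subspace_frame_space]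
      subspace_mul[OF subspace_frame_space] frame_space_mem)

lemma frame_proj_inner:
  assumes "frame B" "q \<in> B"
  shows "frame_proj B v \<bullet> fst q = v \<bullet> fst q" "frame_proj B v \<bullet> snd q = v \<bullet> snd q"
proof -
  have "frame_proj B v \<bullet> fst q = (\<Sum>p\<in>B. if p = q then v \<bullet> fst q else 0)"
    unfolding frame_proj_def inner_sum_left
    by (rule sum.cong) (use assms in \<open>auto simp: inner_add_left frame_inner\<close>)
  then show "frame_proj B v \<bullet> fst q = v \<bullet> fst q"
    using assms(2) frame_finite[OF assms(1)] by simp
  have "frame_proj B v \<bullet> snd q = (\<Sum>p\<in>B. if p = q then v \<bullet> snd q else 0)"
    unfolding frame_proj_def inner_sum_left
    by (rule sum.cong) (use assms in \<open>auto simp: inner_add_left frame_inner\<close>)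
  then show "frame_proj B v \<bullet> snd q = v \<bullet> snd q"
    using assms(2) frame_finite[OF assms(1)] by simp
qed

lemma frame_space_orthogonal:
  assumes "\<And>p. p \<in> B \<Longrightarrow> v \<bullet> fst p = 0 \<and> v \<bullet> snd p = 0" "w \<in> frame_space B"
  shows "v \<bullet> w = 0"
proof -
  have "frame_space B \<subseteq> {w. v \<bullet> w = 0}"
    by (rule frame_space_subset) (use assms in \<open>auto simp: subspace_def inner_add_right\<close>)
  then show ?thesis
    using assms by auto
qed

lemma frame_proj_orthogonal:
  assumes "frame B" "w \<in> frame_space B"
  shows "(v - frame_proj B v) \<bullet> w = 0"
  by (rule frame_space_orthogonal[OF _ assms(2)]) (simp add: inner_diff_left frame_proj_inner assms)

text \<open>The difference of two candidates lies in the space and is orthogonal to itself. This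
  evaluates the definite description in \<open>orth_proj\<close>.\<close>

lemma frame_proj_unique:
  assumes "frame B" "u \<in> frame_space B" "\<And>w. w \<in> frame_space B \<Longrightarrow> (v - u) \<bullet> w = 0"
  shows "u = frame_proj B v"
proof -
  let ?d = "u - frame_proj B v"
  have d: "?d \<in> frame_space B"
    by (intro subspace_diff[OF subspace_frame_space] assms frame_proj_mem)
  have "?d \<bullet> ?d = (v - frame_proj B v) \<bullet> ?d - (v - u) \<bullet> ?d"
    by (simp add: inner_diff_left)
  then show ?thesis
    using frame_proj_orthogonal[OF assms(1) d] assms(3)[OF d] by simp
qed

lemma frame_proj_id: "frame B \<Longrightarrow> v \<in> frame_space B \<Longrightarrow> frame_proj B v = v"
  using frame_proj_unique[of B v v] by simp

lemma frame_proj_matrix: "frame_proj B v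
  = (\<chi> i j. \<Sum>p\<in>B. fst p $ i * fst p $ j + snd p $ i * snd p $ j) *v v"
proof -
  have "frame_proj B v $ i = (\<Sum>p\<in>B. \<Sum>j\<in>UNIV. (fst p $ i * fst p $ j + snd p $ i * snd p $ j) * v $ j)" for i
    by (simp add: frame_proj_def sum_component inner_vec_def sum_distrib_left sum_distrib_right sum.distrib[symmetric] algebra_simps)
  then show ?thesis
    by (simp add: vec_eq_iff matrix_vector_mult_def sum_distrib_right sum.swap[of _ B])
qed

lemma orth_proj_frame:
  assumes "frame B"
  shows "orth_proj (frame_space B) = (\<chi> i j. \<Sum>p\<in>B. fst p $ i * fst p $ j + snd p $ i * snd p $ j)"
proof -
  have "(THE u. u \<in> frame_space B \<and> (\<forall>w\<in>frame_space B. (v - u) \<bullet> w = 0)) = frame_proj B v" for v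
    by (rule the_equality) (use assms frame_proj_mem frame_proj_orthogonal frame_proj_unique in blast)+
  then show ?thesis
    by (simp add: orth_proj_def frame_proj_matrix matrix_of_matrix_vector_mul)
qed

lemma cmat_orth_proj:
  assumes "frame B"
  shows "cmat (orth_proj (frame_space B)) = plane_diag B (\<lambda>_. 1)"
  by (simp add: vec_eq_iff diag_sum_component sum_plane_diag orth_proj_frame[OF assms])
    (auto intro!: sum.cong simp: plane_u_def plane_w_def bsign_def algebra_simps)

lemma plane_diag_mult_subframe:
  assumes "frame K" "B \<subseteq> K"
  shows "plane_diag B c ** plane_diag K d ** plane_diag B c = plane_diag B (\<lambda>i. c i * d i * c i)"
proof -
  have fin: "finite (K \<times> (UNIV :: bool set))" and sub: "B \<times> (UNIV :: bool set) \<subseteq> K \<times> UNIV"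
    using frame_finite[OF assms(1)] assms(2) by auto
  show ?thesis
    unfolding diag_sum_mono_neutral[OF fin sub] diag_sum_mult[OF biorth_plane[OF assms(1)]]
    by (rule diag_sum_cong) auto
qed

lemma restr_skew:
  assumes "frame K" "B \<subseteq> K"
  shows "restr (frame_space B) (skew K \<theta>) = skew B \<theta>"
  unfolding restr_def cmat_orth_proj[OF frame_subset[OF assms]] skew_plane_diag
  using plane_diag_mult_subframe[OF assms, of "\<lambda>_. 1"] by simp

lemma cmat_rrestr: "cmat (rrestr N A) = restr N (cmat A)"
  by (simp add: rrestr_def restr_def cmat_mult)

lemma rrestr_rskew:
  assumes "frame K" "B \<subseteq> K"
  shows "rrestr (frame_space B) (rskew K a) = rskew B a"
  using restr_skew[OF assms] by (simp add: cmat_eq_iff[symmetric] cmat_rrestr cmat_rskew)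

text \<open>The complementary projection added in \<open>det_on\<close> keeps the eigenvalue 1 off
  the frame, so only the two eigenvalues of each plane contribute.\<close>

lemma det_on_diag:
  assumes "frame B"
  shows "det_on (frame_space B) (mat 1 + mscale c (rotation B \<theta>))
    = (\<Prod>p\<in>B. (1 + c * cexpi (\<theta> p)) * (1 + c * cexpi (- \<theta> p)))"
proof -
  let ?d = "\<lambda>(p, s). cexpi (bsign s * \<theta> p)" and ?I = "B \<times> (UNIV :: bool set)"
  note bi = biorth_plane[OF assms]
  have "(mat 1 + mscale c (rotation B \<theta>)) ** plane_diag B (\<lambda>_. 1)
      = plane_diag B (\<lambda>_. 1) + mscale c (plane_diag B (\<lambda>_. 1) + plane_diag B (\<lambda>i. ?d i - 1) ** plane_diag B (\<lambda>_. 1))"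
    by (simp add: rotation_def diag_id_def matrix_mult_distribs)
      (simp add: vec_eq_iff matrix_matrix_mult_def sum_distrib_left distrib_left sum.distrib distrib_right
        mat_1_component if_distrib[where f = "\<lambda>x. x * _"] if_distrib[where f = "\<lambda>x. _ * x"] mult.assoc cong: if_cong)
  then have "(mat 1 + mscale c (rotation B \<theta>)) ** cmat (orth_proj (frame_space B)) + (mat 1 - cmat (orth_proj (frame_space B)))
      = diag_id ?I plane_u plane_w (\<lambda>i. 1 + c * ?d i)"
    unfolding cmat_orth_proj[OF assms]
    by (simp add: diag_id_def diag_sum_mult[OF bi] diag_sum_add diag_sum_diff mscale_diag_sum)
  then show ?thesis
    unfolding det_on_def by (simp add: det_diag_id[OF bi] prod_plane_diag bsign_def)
qed

lemma prod_wblock_quotient: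
  assumes "Im \<tau> > 0"
  shows "(\<Prod>n. (\<Prod>p\<in>B. (1 - A * qpow \<tau> 1 ^ n * cexpi (\<theta> p)) * (1 - A * qpow \<tau> 1 ^ n * cexpi (- \<theta> p)))
      / (\<Prod>p\<in>B. (1 - C * qpow \<tau> 1 ^ n * cexpi (\<theta> p)) * (1 - C * qpow \<tau> 1 ^ n * cexpi (- \<theta> p))))
    = (\<Prod>p\<in>B. wblock (qpow \<tau> 1) A C (\<theta> p))"
proof -
  define d where "d = (\<lambda>(p, s). cexpi (bsign s * \<theta> p))"
  have "(\<Prod>n. (\<Prod>i\<in>B \<times> (UNIV :: bool set). 1 - A * d i * qpow \<tau> 1 ^ n) / (\<Prod>i\<in>B \<times> (UNIV :: bool set). 1 - C * d i * qpow \<tau> 1 ^ n))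
    = (\<Prod>i\<in>B \<times> UNIV. qpoch (qpow \<tau> 1) (A * d i) / qpoch (qpow \<tau> 1) (C * d i))"
    by (rule prodinf_quotient_qpoch[OF norm_qpow_less_1[OF assms]])
  then show ?thesis
    by (simp add: prod_plane_diag d_def bsign_def wblock_def mult_ac)
qed

lemma W_rotation:
  assumes "Im \<tau> > 0" "frame B"
  shows "W1 \<tau> (frame_space B) (rotation B \<theta>) = (\<Prod>p\<in>B. wblock (qpow \<tau> 1) (- qpow \<tau> (1/2)) (qpow \<tau> 1) (\<theta> p))"
    "W2 \<tau> (frame_space B) (rotation B \<theta>) = (\<Prod>p\<in>B. wblock (qpow \<tau> 1) (qpow \<tau> (1/2)) (- qpow \<tau> 1) (\<theta> p))"
    "W3 \<tau> (frame_space B) (rotation B \<theta>) = (\<Prod>p\<in>B. wblock (qpow \<tau> 1) (- qpow \<tau> 1) (qpow \<tau> (1/2)) (\<theta> p))"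
    "W4 \<tau> (frame_space B) (rotation B \<theta>) = (\<Prod>p\<in>B. wblock (qpow \<tau> 1) (qpow \<tau> 1) (- qpow \<tau> (1/2)) (\<theta> p))"
proof -
  have minus: "mat 1 - mscale c g = mat 1 + mscale (- c) g" for c and g :: "'a cmatrix"
    by (simp add: vec_eq_iff)
  note rules = minus det_on_diag[OF assms(2)] qpow_Suc qpow_Suc_half prod_wblock_quotient[OF assms(1), symmetric]
  show "W1 \<tau> (frame_space B) (rotation B \<theta>) = (\<Prod>p\<in>B. wblock (qpow \<tau> 1) (- qpow \<tau> (1/2)) (qpow \<tau> 1) (\<theta> p))"
    unfolding W1_def rules by simp
  show "W2 \<tau> (frame_space B) (rotation B \<theta>) = (\<Prod>p\<in>B. wblock (qpow \<tau> 1) (qpow \<tau> (1/2)) (- qpow \<tau> 1) (\<theta> p))"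
    unfolding W2_def rules by simp
  show "W3 \<tau> (frame_space B) (rotation B \<theta>) = (\<Prod>p\<in>B. wblock (qpow \<tau> 1) (- qpow \<tau> 1) (qpow \<tau> (1/2)) (\<theta> p))"
    unfolding W3_def rules by simp
  show "W4 \<tau> (frame_space B) (rotation B \<theta>) = (\<Prod>p\<in>B. wblock (qpow \<tau> 1) (qpow \<tau> 1) (- qpow \<tau> (1/2)) (\<theta> p))"
    unfolding W4_def rules by simp
qed

section \<open>The Clifford and exterior products\<close>

text \<open>The diagonal case carries the contraction sign of
  \<open>e\<^sub>i * e\<^sub>i = -1\<close>. With it included, the product of these signs over pairs
  of indices is multiplicative in both index sets.\<close>

definition order_sign :: "'n::{finite,linorder} \<Rightarrow> 'n \<Rightarrow> complex" where
  "order_sign i j = (if j \<le> i then - 1 else 1)"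

definition cl_sign :: "'n::{finite,linorder} set \<Rightarrow> 'n set \<Rightarrow> complex" where
  "cl_sign I J = (\<Prod>i\<in>I. \<Prod>j\<in>J. order_sign i j)"

definition ext_sign :: "'n::{finite,linorder} set \<Rightarrow> 'n set \<Rightarrow> complex" where
  "ext_sign I J = (if I \<inter> J = {} then cl_sign I J else 0)"

text \<open>A twisted group algebra of the subsets under symmetric difference. Both products have
  this form; for the exterior one the twist vanishes on overlapping sets.\<close>

definition twist_mult :: "('n set \<Rightarrow> 'n set \<Rightarrow> complex) \<Rightarrow>
    'n::{finite,linorder} multivector \<Rightarrow> 'n multivector \<Rightarrow> 'n multivector" where
  "twist_mult c a b = (\<chi> K. \<Sum>I\<in>UNIV. c I (sym_diff I K) * a $ I * b $ (sym_diff I K))"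

notation cl_mult (infixl "\<odot>" 70)

text \<open>Indices common to both sets contribute a square, which is 1.\<close>

lemma prod_sym_diff:
  fixes f :: "'a \<Rightarrow> complex"
  assumes "finite I" "finite J" "\<And>x. f x * f x = 1"
  shows "prod f (sym_diff I J) = prod f I * prod f J"
proof -
  have "prod f (I \<inter> J) * prod f (I \<inter> J) = 1"
    by (simp add: prod.distrib[symmetric] assms)
  moreover have "prod f I = prod f (I \<inter> J) * prod f (I - J)" "prod f J = prod f (I \<inter> J) * prod f (J - I)"
    using prod.Int_Diff[OF assms(1), of f J] prod.Int_Diff[OF assms(2), of f I] by (simp_all add: Int_commute)
  moreover have "prod f (sym_diff I J) = prod f (I - J) * prod f (J - I)"
    by (rule prod.union_disjoint) (use assms in auto)
  ultimately show ?thesis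
    by (simp add: mult_ac)
qed

lemma prod_square_one:
  fixes f :: "'a \<Rightarrow> complex"
  assumes "\<And>x. f x * f x = 1"
  shows "prod f A * prod f A = 1"
  by (simp add: prod.distrib[symmetric] assms)

lemma order_sign_square: "order_sign i j * order_sign i j = 1"
  by (simp add: order_sign_def)

text \<open>A sign multiplicative in each argument is automatically a cocycle, which is all that
  associativity needs.\<close>

lemma cl_sign_sym_diff_left: "cl_sign (sym_diff I J) K = cl_sign I K * cl_sign J K"
  unfolding cl_sign_def by (rule prod_sym_diff) (simp_all add: prod_square_one order_sign_square)

lemma cl_sign_sym_diff_right: "cl_sign I (sym_diff J K) = cl_sign I J * cl_sign I K"
  unfolding cl_sign_def prod.distrib[symmetric]
  by (rule prod.cong[OF refl], rule prod_sym_diff) (simp_all add: order_sign_square)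

lemma cl_sign_empty [simp]: "cl_sign {} J = 1" "cl_sign I {} = 1"
  by (simp_all add: cl_sign_def)

lemma cl_sign_square: "cl_sign I J * cl_sign I J = 1"
  unfolding cl_sign_def by (intro prod_square_one order_sign_square)

lemma prod_if_card:
  assumes "finite A"
  shows "(\<Prod>x\<in>A. if P x then c else (1::complex)) = c ^ card {x \<in> A. P x}"
  using assms by (simp add: prod.inter_filter[symmetric])

lemma reorder_sign_prod: "reorder_sign I J = (\<Prod>i\<in>I. \<Prod>j\<in>J. if j < i then - 1 else 1)"
proof -
  have "(\<Prod>i\<in>I. \<Prod>j\<in>J. if j < i then - 1 else (1::complex)) = (\<Prod>x\<in>I \<times> J. if snd x < fst x then - 1 else 1)"
    by (simp add: prod.cartesian_product case_prod_unfold)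
  also have "\<dots> = (- 1) ^ card {x \<in> I \<times> J. snd x < fst x}"
    by (simp add: prod_if_card)
  also have "{x \<in> I \<times> J. snd x < fst x} = {(i, j). i \<in> I \<and> j \<in> J \<and> j < i}"
    by auto
  finally show ?thesis
    by (simp add: reorder_sign_def)
qed

lemma cl_sign_reorder: "reorder_sign I J * (- 1) ^ card (I \<inter> J) = cl_sign I J"
proof -
  have "(\<Prod>j\<in>J. if i = j then - 1 else (1::complex)) = (if i \<in> J then - 1 else 1)" for i
    by (simp add: prod.delta)
  then have "(\<Prod>i\<in>I. \<Prod>j\<in>J. if i = j then - 1 else (1::complex)) = (- 1) ^ card (I \<inter> J)"
    by (simp add: prod_if_card Int_def)
  then have "reorder_sign I J * (- 1) ^ card (I \<inter> J)
      = (\<Prod>i\<in>I. \<Prod>j\<in>J. (if j < i then - 1 else 1) * (if i = j then - 1 else (1::complex)))"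
    by (simp add: reorder_sign_prod prod.distrib)
  also have "\<dots> = cl_sign I J"
    unfolding cl_sign_def by (intro prod.cong refl) (auto simp: order_sign_def)
  finally show ?thesis .
qed

lemma cl_mult_twist: "a \<odot> b = twist_mult cl_sign a b"
  by (simp add: cl_mult_def twist_mult_def cl_sign_reorder)

lemma ext_mult_twist: "ext_mult a b = twist_mult ext_sign a b"
proof -
  have "ext_mult a b $ K = twist_mult ext_sign a b $ K" for K
  proof -
    have "reorder_sign I (K - I) * a $ I * b $ (K - I)
        = ext_sign I (sym_diff I K) * a $ I * b $ (sym_diff I K)" if "I \<subseteq> K" for I
    proof -
      have "sym_diff I K = K - I" "I \<inter> (K - I) = {}"
        using that by auto
      then show ?thesis
        using cl_sign_reorder[of I "K - I"] by (simp add: ext_sign_def)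
    qed
    moreover have "ext_sign I (sym_diff I K) = 0" if "\<not> I \<subseteq> K" for I
      using that by (auto simp: ext_sign_def)
    ultimately show ?thesis
      by (simp add: ext_mult_def twist_mult_def) (rule sum.mono_neutral_cong_left, auto)
  qed
  then show ?thesis
    by (simp add: vec_eq_iff)
qed

lemma twist_mult_assoc:
  assumes cocycle: "\<And>I J K. c I J * c (sym_diff I J) K = c I (sym_diff J K) * c J K"
  shows "twist_mult c (twist_mult c x y) z = twist_mult c x (twist_mult c y z)"
proof -
  have "twist_mult c (twist_mult c x y) z $ K = twist_mult c x (twist_mult c y z) $ K" for K
  proof -
    \<comment> \<open>The substitution \<open>L = sym_diff I M\<close> makes \<open>M\<close> the
      index of the product of the first two factors, as in the other bracketing.\<close>
    have inner: "(\<Sum>L\<in>UNIV. c L (sym_diff L (sym_diff I K)) * y $ L * z $ (sym_diff L (sym_diff I K)))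
        = (\<Sum>M\<in>UNIV. c (sym_diff I M) (sym_diff M K) * y $ (sym_diff I M) * z $ (sym_diff M K))" for I
    proof (rule sum.reindex_bij_witness[of _ "\<lambda>M. sym_diff I M" "\<lambda>M. sym_diff I M"])
      fix L
      show "sym_diff I (sym_diff I L) = L" "sym_diff I (sym_diff I L) = L"
        by auto
      have "sym_diff (sym_diff I L) K = sym_diff L (sym_diff I K)" "sym_diff I (sym_diff I L) = L"
        by auto
      then show "c (sym_diff I (sym_diff I L)) (sym_diff (sym_diff I L) K) * y $ (sym_diff I (sym_diff I L)) * z $ (sym_diff (sym_diff I L) K)
        = c L (sym_diff L (sym_diff I K)) * y $ L * z $ (sym_diff L (sym_diff I K))"
        by simp
    qed auto
    have "c I (sym_diff I M) * c M (sym_diff M K) = c I (sym_diff I K) * c (sym_diff I M) (sym_diff M K)" for I M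
    proof -
      have "sym_diff I (sym_diff I M) = M" "sym_diff (sym_diff I M) (sym_diff M K) = sym_diff I K"
        by auto
      then show ?thesis
        using cocycle[of I "sym_diff I M" "sym_diff M K"] by simp
    qed
    note co = this
    have "twist_mult c (twist_mult c x y) z $ K
        = (\<Sum>M\<in>UNIV. \<Sum>I\<in>UNIV. (c I (sym_diff I M) * c M (sym_diff M K)) * x $ I * y $ (sym_diff I M) * z $ (sym_diff M K))"
      by (simp add: twist_mult_def sum_distrib_left sum_distrib_right mult_ac)
    also have "\<dots> = (\<Sum>I\<in>UNIV. \<Sum>M\<in>UNIV. (c I (sym_diff I K) * c (sym_diff I M) (sym_diff M K)) * x $ I * y $ (sym_diff I M) * z $ (sym_diff M K))"
      by (subst sum.swap) (simp only: co)
    also have "\<dots> = twist_mult c x (twist_mult c y z) $ K"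
      unfolding twist_mult_def vec_lambda_beta unfolding inner
      unfolding sum_distrib_left by (simp only: mult_ac)
    finally show ?thesis .
  qed
  then show ?thesis
    by (simp add: vec_eq_iff)
qed

lemma cl_assoc: "x \<odot> y \<odot> z = x \<odot> (y \<odot> z)"
  unfolding cl_mult_twist
  by (rule twist_mult_assoc) (simp only: cl_sign_sym_diff_left cl_sign_sym_diff_right mult_ac)

text \<open>If two of the three index sets meet, both sides vanish; on pairwise disjoint sets the
  exterior sign is the Clifford sign.\<close>

lemma ext_assoc: "ext_mult (ext_mult x y) z = ext_mult x (ext_mult y z)"
  unfolding ext_mult_twist
proof (rule twist_mult_assoc)
  fix I J K :: "'a set"
  show "ext_sign I J * ext_sign (sym_diff I J) K = ext_sign I (sym_diff J K) * ext_sign J K"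
  proof (cases "I \<inter> J = {} \<and> I \<inter> K = {} \<and> J \<inter> K = {}")
    case True
    then have "I \<inter> J = {}" "J \<inter> K = {}" "sym_diff I J \<inter> K = {}" "I \<inter> sym_diff J K = {}"
      by blast+
    then show ?thesis
      unfolding ext_sign_def by (simp only: simp_thms if_True cl_sign_sym_diff_left cl_sign_sym_diff_right mult_ac)
  next
    case False
    then have "(I \<inter> J \<noteq> {} \<or> sym_diff I J \<inter> K \<noteq> {}) \<and> (I \<inter> sym_diff J K \<noteq> {} \<or> J \<inter> K \<noteq> {})"
      by blast
    then show ?thesis
      unfolding ext_sign_def by auto
  qed
qed

section \<open>Bilinearity of the Clifford product and products with vectors\<close>

lemma cl_add_left: "(x + y) \<odot> z = x \<odot> z + y \<odot> z"
  by (simp add: cl_mult_twist twist_mult_def vec_eq_iff sum.distrib distrib_left distrib_right)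

lemma cl_add_right: "z \<odot> (x + y) = z \<odot> x + z \<odot> y"
  by (simp add: cl_mult_twist twist_mult_def vec_eq_iff sum.distrib distrib_left)

lemma cl_scale_left: "(c *s x) \<odot> y = c *s (x \<odot> y)"
  by (simp add: cl_mult_twist twist_mult_def vec_eq_iff sum_distrib_left mult_ac)

lemma cl_scale_right: "x \<odot> (c *s y) = c *s (x \<odot> y)"
  by (simp add: cl_mult_twist twist_mult_def vec_eq_iff sum_distrib_left mult_ac)

lemma cl_zero [simp]: "0 \<odot> x = 0" "x \<odot> 0 = 0"
  by (simp_all add: cl_mult_twist twist_mult_def vec_eq_iff)

lemma cl_minus_left: "(- x) \<odot> y = - (x \<odot> y)"
  by (simp add: cl_mult_twist twist_mult_def vec_eq_iff sum_negf)

lemma cl_minus_right: "x \<odot> (- y) = - (x \<odot> y)"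
  by (simp add: cl_mult_twist twist_mult_def vec_eq_iff sum_negf)

lemma cl_diff_left: "(x - y) \<odot> z = x \<odot> z - y \<odot> z"
  using cl_add_left[of x "- y" z] by (simp add: cl_minus_left)

lemma cl_diff_right: "z \<odot> (x - y) = z \<odot> x - z \<odot> y"
  using cl_add_right[of z x "- y"] by (simp add: cl_minus_right)

lemma cl_sum_left: "sum f A \<odot> x = (\<Sum>a\<in>A. f a \<odot> x)"
  by (induction A rule: infinite_finite_induct) (simp_all add: cl_add_left)

lemma cl_sum_right: "x \<odot> sum f A = (\<Sum>a\<in>A. x \<odot> f a)"
  by (induction A rule: infinite_finite_induct) (simp_all add: cl_add_right)

lemma sum_singleton_support:
  fixes f :: "'a::finite \<Rightarrow> complex"
  assumes "\<And>x. x \<noteq> k \<Longrightarrow> f x = 0"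
  shows "sum f UNIV = f k"
  using assms sum.mono_neutral_right[of UNIV "{k}" f] by auto

lemma twist_axis_left: "twist_mult c (axis I r) b $ K = c I (sym_diff I K) * r * b $ (sym_diff I K)"
  unfolding twist_mult_def
  by (simp, subst sum_singleton_support[of I]) (simp_all add: axis_def)

lemma twist_axis_right: "twist_mult c a (axis J r) $ K = c (sym_diff J K) J * a $ (sym_diff J K) * r"
proof -
  have J: "sym_diff (sym_diff J K) K = J"
    by auto
  have "sym_diff I K = J \<longleftrightarrow> I = sym_diff J K" for I
    by auto
  then have "twist_mult c a (axis J r) $ K
      = c (sym_diff J K) (sym_diff (sym_diff J K) K) * a $ (sym_diff J K) * axis J r $ (sym_diff (sym_diff J K) K)"
    unfolding twist_mult_def vec_lambda_beta by (intro sum_singleton_support) (simp add: axis_def)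
  then show ?thesis
    unfolding J by (simp add: axis_def)
qed

lemma cl_one [simp]: "mv_one \<odot> x = x" "x \<odot> mv_one = x"
  by (simp_all add: cl_mult_twist mv_one_def vec_eq_iff twist_axis_left twist_axis_right)

lemma ext_one [simp]: "ext_mult mv_one x = x"
  by (simp add: ext_mult_twist mv_one_def vec_eq_iff twist_axis_left ext_sign_def)

lemma cl_axis_axis: "axis I r \<odot> axis J t = axis (sym_diff I J) (cl_sign I J * r * t)"
proof -
  have "(axis I r \<odot> axis J t) $ K = axis (sym_diff I J) (cl_sign I J * r * t) $ K" for K
  proof (cases "K = sym_diff I J")
    case True
    then have "sym_diff I K = J"
      by auto
    then show ?thesis
      unfolding cl_mult_twist twist_axis_left True by (simp add: axis_def)
  next
    case False
    then have "sym_diff I K \<noteq> J"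
      by blast
    then show ?thesis
      unfolding cl_mult_twist twist_axis_left using False by (simp add: axis_def)
  qed
  then show ?thesis
    by (simp add: vec_eq_iff)
qed

lemma order_sign_swap: "order_sign i j * order_sign j i = (if i = j then 1 else - 1)"
  by (auto simp: order_sign_def)

lemma mv_vec_anticommute: "mv_vec v \<odot> mv_vec w + mv_vec w \<odot> mv_vec v = (- 2 * cdot v w) *s mv_one"
proof -
  have pair: "axis {i} r \<odot> axis {j} t + axis {j} t \<odot> axis {i} r
      = (if i = j then (- 2 * (r * t)) *s mv_one else 0)" for i j :: 'a and r t
  proof (cases "i = j")
    case True
    show ?thesis
      unfolding True cl_axis_axis
      by (simp add: cl_sign_def order_sign_def mv_one_def vec_eq_iff axis_def)
  next
    case False
    then have "sym_diff {i} {j} = sym_diff {j} {i}" "order_sign i j = - order_sign j i"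
      by (auto simp: order_sign_def)
    then show ?thesis
      using False unfolding cl_axis_axis by (simp add: cl_sign_def vec_eq_iff axis_def)
  qed
  have "mv_vec v \<odot> mv_vec w + mv_vec w \<odot> mv_vec v
      = (\<Sum>i\<in>UNIV. \<Sum>j\<in>UNIV. axis {i} (v $ i) \<odot> axis {j} (w $ j))
        + (\<Sum>i\<in>UNIV. \<Sum>j\<in>UNIV. axis {j} (w $ j) \<odot> axis {i} (v $ i))"
    unfolding mv_vec_def cl_sum_left cl_sum_right by (subst (3) sum.swap) (rule refl)
  also have "\<dots> = (\<Sum>i\<in>UNIV. (- 2 * (v $ i * w $ i)) *s mv_one)"
    unfolding sum.distrib[symmetric] pair by simp
  also have "\<dots> = (- 2 * cdot v w) *s mv_one"
    by (simp add: cdot_def sum_distrib_left vec.scale_sum_left)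
  finally show ?thesis .
qed

definition grade_inv :: "'n::{finite,linorder} multivector \<Rightarrow> 'n multivector" where
  "grade_inv a = (\<chi> I. (- 1) ^ card I * a $ I)"

lemma twist_sum_left: "twist_mult c (sum f A) a = (\<Sum>i\<in>A. twist_mult c (f i) a)"
proof -
  have "twist_mult c 0 a = 0" "twist_mult c (x + y) a = twist_mult c x a + twist_mult c y a" for x y
    by (simp_all add: twist_mult_def vec_eq_iff sum.distrib distrib_left distrib_right)
  then show ?thesis
    by (induction A rule: infinite_finite_induct) simp_all
qed

lemma twist_sum_right: "twist_mult c a (sum f A) = (\<Sum>i\<in>A. twist_mult c a (f i))"
proof -
  have "twist_mult c a 0 = 0" "twist_mult c a (x + y) = twist_mult c a x + twist_mult c a y" for x y
    by (simp_all add: twist_mult_def vec_eq_iff sum.distrib distrib_left)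
  then show ?thesis
    by (induction A rule: infinite_finite_induct) simp_all
qed

lemma twist_vec_left: "twist_mult c (mv_vec v) a $ K
    = (\<Sum>i\<in>UNIV. c {i} (sym_diff {i} K) * v $ i * a $ (sym_diff {i} K))"
  unfolding mv_vec_def twist_sum_left sum_component twist_axis_left ..

lemma twist_vec_right: "twist_mult c a (mv_vec v) $ K
    = (\<Sum>i\<in>UNIV. c (sym_diff {i} K) {i} * a $ (sym_diff {i} K) * v $ i)"
  unfolding mv_vec_def twist_sum_right sum_component twist_axis_right ..

lemma card_sym_diff_singleton:
  fixes K :: "'n::finite set"
  shows "(- 1 :: complex) ^ card (sym_diff {i} K) = - ((- 1) ^ card K)"
proof (cases "i \<in> K")
  case True
  then have eqs: "sym_diff {i} K = K - {i}" "card K = Suc (card (K - {i}))"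
    by (blast, intro card.remove) simp_all
  show ?thesis
    unfolding eqs by simp
next
  case False
  then have "sym_diff {i} K = insert i K"
    by auto
  then show ?thesis
    using False by simp
qed

text \<open>Moving one basis vector past the product over \<open>L\<close> costs a sign for each
  index of \<open>L\<close> different from its own.\<close>

lemma cl_sign_swap_singleton:
  "cl_sign L {i} * (- 1) ^ card L = (if i \<in> L then - 1 else 1) * cl_sign {i} L"
proof -
  have "cl_sign {i} L * cl_sign L {i} = (\<Prod>j\<in>L. if i = j then 1 else - 1)"
    by (simp add: cl_sign_def prod.distrib[symmetric] order_sign_swap)
  also have "\<dots> = (\<Prod>j\<in>L. (- 1) * (if j = i then - 1 else 1))"
    by (rule prod.cong) auto
  also have "\<dots> = (- 1) ^ card L * (if i \<in> L then - 1 else 1)"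
    by (subst prod.distrib) (simp add: prod.delta)
  finally have *: "cl_sign {i} L * cl_sign L {i} = (- 1) ^ card L * (if i \<in> L then - 1 else 1)" .
  have "cl_sign L {i} = cl_sign {i} L * (cl_sign {i} L * cl_sign L {i})"
    by (simp add: mult.assoc[symmetric] cl_sign_square)
  also have "\<dots> = cl_sign {i} L * (- 1) ^ card L * (if i \<in> L then - 1 else 1)"
    unfolding * by (simp only: mult_ac)
  finally have "cl_sign L {i} * (- 1) ^ card L
      = (if i \<in> L then - 1 else 1) * cl_sign {i} L * ((- 1) ^ card L * (- 1) ^ card L)"
    by (simp only: mult_ac)
  then show ?thesis
    by (simp flip: power_mult_distrib)
qed

text \<open>Clifford multiplication by \<open>v\<close> on either side is exterior multiplication plus or minus
  contraction; the contraction cancels here.\<close>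

lemma ext_mult_vec: "ext_mult (mv_vec v) a = (1 / 2) *s (mv_vec v \<odot> a + grade_inv a \<odot> mv_vec v)"
proof -
  have "2 * (ext_sign {i} (sym_diff {i} K) * v $ i * a $ (sym_diff {i} K))
      = cl_sign {i} (sym_diff {i} K) * v $ i * a $ (sym_diff {i} K)
        + cl_sign (sym_diff {i} K) {i} * ((- 1) ^ card (sym_diff {i} K) * a $ (sym_diff {i} K)) * v $ i" for i K
  proof -
    have *: "cl_sign (sym_diff {i} K) {i} * (- 1) ^ card (sym_diff {i} K)
        = (if i \<in> K then 1 else - 1) * cl_sign {i} (sym_diff {i} K)"
      by (subst cl_sign_swap_singleton) auto
    have "ext_sign {i} (sym_diff {i} K) = (if i \<in> K then cl_sign {i} (sym_diff {i} K) else 0)"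
      by (auto simp: ext_sign_def)
    then show ?thesis
      unfolding mult.assoc[symmetric] * by auto
  qed
  then have "2 * ext_mult (mv_vec v) a $ K = (mv_vec v \<odot> a + grade_inv a \<odot> mv_vec v) $ K" for K
    unfolding ext_mult_twist cl_mult_twist vector_add_component twist_vec_left twist_vec_right sum.distrib[symmetric] sum_distrib_left
    by (simp add: grade_inv_def)
  then show ?thesis
    by (simp add: vec_eq_iff field_simps)
qed

lemma grade_inv_vec_mult: "grade_inv (mv_vec v \<odot> a) = - (mv_vec v \<odot> grade_inv a)"
  by (simp add: vec_eq_iff cl_mult_twist grade_inv_def twist_vec_left card_sym_diff_singleton
      sum_negf[symmetric] sum_distrib_left mult_ac)

section \<open>Real vectors in the Clifford algebra\<close>

definition cv :: "real^'n::{finite,linorder} \<Rightarrow> 'n multivector" where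
  "cv v = mv_vec (cvec v)"

lemma cv_add: "cv (v + w) = cv v + cv w"
  by (simp add: cv_def mv_vec_def cvec_simps vec_eq_iff sum_component sum.distrib[symmetric] axis_def, intro allI sum.cong, auto)

lemma cv_scale: "cv (r *\<^sub>R v) = of_real r *s cv v"
  by (simp add: cv_def mv_vec_def cvec_simps vec_eq_iff sum_component sum_distrib_left axis_def, intro allI sum.cong, auto)

lemma cv_diff: "cv (v - w) = cv v - cv w"
  using cv_add[of "v - w" w] by simp

lemma cv_0 [simp]: "cv 0 = 0"
  using cv_scale[of 0 0] by simp

lemma cv_swap: "cv v \<odot> cv w = - (cv w \<odot> cv v) - of_real (2 * (v \<bullet> w)) *s mv_one"
proof -
  have "cv v \<odot> cv w + cv w \<odot> cv v = - (of_real (2 * (v \<bullet> w)) *s mv_one)"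
    using mv_vec_anticommute[of "cvec v" "cvec w"] by (simp add: cv_def cdot_cvec)
  then show ?thesis
    by (rule add_implies_diff[THEN trans]) simp
qed

lemma cv_anticommute: "v \<bullet> w = 0 \<Longrightarrow> cv v \<odot> cv w = - (cv w \<odot> cv v)"
  by (subst cv_swap) simp

lemma cv_square: "cv v \<odot> cv v = - (of_real (v \<bullet> v) *s mv_one)"
proof -
  have "cv v \<odot> cv v + cv v \<odot> cv v = (- 2 * of_real (v \<bullet> v)) *s mv_one"
    unfolding cv_def by (subst mv_vec_anticommute) (simp only: cdot_cvec)
  then have "(cv v \<odot> cv v) $ K + (cv v \<odot> cv v) $ K = - 2 * of_real (v \<bullet> v) * mv_one $ K" for K
    by (metis vector_add_component vector_smult_component)
  then have "(cv v \<odot> cv v) $ K = (- (of_real (v \<bullet> v) *s mv_one)) $ K" for K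
    unfolding mult_2[symmetric] by (metis (no_types) mult_minus_left mult_cancel_left mult.assoc
        vector_smult_component vector_uminus_component zero_neq_numeral mult_minus_right)
  then show ?thesis
    unfolding vec_eq_iff by blast
qed

lemma cv_unit_cancel: "v \<bullet> v = 1 \<Longrightarrow> cv v \<odot> (cv v \<odot> a) = - a"
  by (simp add: cl_assoc[symmetric] cv_square cl_minus_left)

section \<open>Orthonormal lists, orientations and rotors\<close>

lemmas cl_linear = cl_add_left cl_add_right cl_scale_left cl_scale_right cl_minus_left cl_minus_right
  cl_diff_left cl_diff_right

fun orthonormal :: "(real^'n) list \<Rightarrow> bool" where
  "orthonormal [] \<longleftrightarrow> True"
| "orthonormal (b # bs) \<longleftrightarrow> b \<bullet> b = 1 \<and> (\<forall>x\<in>set bs. b \<bullet> x = 0) \<and> orthonormal bs"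

definition cprod :: "(real^'n::{finite,linorder}) list \<Rightarrow> 'n multivector" where
  "cprod bs = foldr cl_mult (map cv bs) mv_one"

lemma cprod_simps [simp]: "cprod [] = mv_one" "cprod (b # bs) = cv b \<odot> cprod bs"
  by (simp_all add: cprod_def)

lemma wedge_list_simps [simp]: "wedge_list [] = mv_one" "wedge_list (b # bs) = ext_mult (cv b) (wedge_list bs)"
  by (simp_all add: wedge_list_def cv_def)

lemma wedge_list_append: "wedge_list (xs @ ys) = ext_mult (wedge_list xs) (wedge_list ys)"
  by (induction xs) (simp_all add: ext_assoc)

lemma cv_cprod_orthogonal:
  assumes "\<And>x. x \<in> set bs \<Longrightarrow> v \<bullet> x = 0"
  shows "cprod bs \<odot> cv v = (- 1) ^ length bs *s (cv v \<odot> cprod bs)"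
  using assms
proof (induction bs)
  case Nil
  then show ?case by simp
next
  case (Cons b bs)
  then have IH: "cprod bs \<odot> cv v = (- 1) ^ length bs *s (cv v \<odot> cprod bs)"
    and anti: "cv b \<odot> cv v = - (cv v \<odot> cv b)"
    by (auto intro!: cv_anticommute simp: inner_commute)
  have "cprod (b # bs) \<odot> cv v = (- 1) ^ length bs *s (cv b \<odot> cv v \<odot> cprod bs)"
    by (simp add: cl_assoc IH cl_scale_right)
  then show ?case
    by (simp add: anti cl_minus_left cl_assoc)
qed

lemma grade_inv_cprod: "grade_inv (cprod bs) = (- 1) ^ length bs *s cprod bs"
proof (induction bs)
  case Nil
  show ?case
    by (simp add: grade_inv_def mv_one_def vec_eq_iff axis_def)
next
  case (Cons b bs)
  then show ?case
    by (simp add: cv_def grade_inv_vec_mult cl_scale_right)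
qed

lemma half_double: "(1 / 2) *s (x + x) = (x :: complex^'n)"
  by (simp add: vec_eq_iff)

text \<open>Left and right multiplication of the tail by the orthogonal vector \<open>b\<close>
  differ by \<open>(- 1) ^ length bs\<close>, and the grading involution in
  \<open>ext_mult_vec\<close> undoes exactly this sign. Orientations thereby become Clifford volume
  elements.\<close>

lemma wedge_list_cprod: "orthonormal bs \<Longrightarrow> wedge_list bs = cprod bs"
proof (induction bs)
  case Nil
  show ?case by simp
next
  case (Cons b bs)
  then have "wedge_list (b # bs) = (1 / 2) *s (cv b \<odot> cprod bs + grade_inv (cprod bs) \<odot> cv b)"
    by (simp add: cv_def ext_mult_vec)
  also have "grade_inv (cprod bs) \<odot> cv b = cv b \<odot> cprod bs"
    using Cons.prems cv_cprod_orthogonal[of bs b]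
    by (simp add: grade_inv_cprod cl_scale_left)
  finally show ?case
    by (simp only: half_double cprod_simps)
qed

text \<open>One sign fewer than for an orthogonal vector, because \<open>v\<close> commutes with its
  own occurrence in the product.\<close>

lemma cv_cprod_mem:
  assumes "orthonormal bs" "v \<in> set bs"
  shows "cv v \<odot> cprod bs = (- 1) ^ (length bs + 1) *s (cprod bs \<odot> cv v)"
  using assms
proof (induction bs)
  case Nil
  then show ?case by simp
next
  case (Cons b bs)
  show ?case
  proof (cases "v = b")
    case True
    have "cprod bs \<odot> cv b = (- 1) ^ length bs *s (cv b \<odot> cprod bs)"
      using Cons.prems by (intro cv_cprod_orthogonal) auto
    then show ?thesis
      using Cons.prems True
      by (simp add: cl_assoc cl_scale_right cv_unit_cancel)
  next
    case False
    then have v: "v \<in> set bs" "cv v \<odot> cv b = - (cv b \<odot> cv v)"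
      using Cons.prems by (auto intro!: cv_anticommute simp: inner_commute)
    then have "cv v \<odot> cprod (b # bs) = - (cv b \<odot> (cv v \<odot> cprod bs))"
      by (simp flip: cl_assoc add: cl_minus_left)
    then show ?thesis
      using Cons v by (simp add: cl_scale_right cl_minus_right cl_assoc)
  qed
qed

lemma cv_cprod_span:
  assumes "orthonormal bs" "v \<in> span (set bs)"
  shows "cv v \<odot> cprod bs = (- 1) ^ (length bs + 1) *s (cprod bs \<odot> cv v)"
  using assms(2)
proof (induction rule: span_induct)
  case base
  show ?case
    by (auto simp: subspace_def cv_add cv_scale cl_linear vec.scale_right_distrib mult.commute
        simp del: power_Suc power_add)
next
  case (step x)
  then show ?case
    using cv_cprod_mem[OF assms(1)] by simp
qed

lemma orthogonal_to_span_set: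
  assumes "\<And>x. x \<in> S \<Longrightarrow> b \<bullet> x = 0" "y \<in> span S"
  shows "b \<bullet> y = 0"
proof -
  have "span S \<subseteq> {y. b \<bullet> y = 0}"
    by (rule span_minimal) (use assms in \<open>auto simp: subspace_def inner_add_right\<close>)
  then show ?thesis
    using assms by auto
qed

text \<open>Both tails span the orthogonal complement of \<open>b\<close> in the common
  space.\<close>

lemma orthonormal_span_tail:
  assumes "orthonormal (b # bs)" "orthonormal (b # cs)" "span (set (b # bs)) = span (set (b # cs))"
  shows "span (set bs) \<subseteq> span (set cs)"
proof (rule span_minimal)
  show "set bs \<subseteq> span (set cs)"
  proof
    fix x assume x: "x \<in> set bs"
    then have "x \<in> span (set (b # bs))"
      by (intro span_base) simp
    then have "x \<in> span (insert b (set cs))"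
      unfolding assms(3) by simp
    then have "\<exists>k. x - k *\<^sub>R b \<in> span (set cs)"
      by (rule span_breakdown_eq[THEN iffD1])
    then obtain k where k: "x - k *\<^sub>R b \<in> span (set cs)" ..
    then have "b \<bullet> (x - k *\<^sub>R b) = 0"
      by (rule orthogonal_to_span_set[rotated]) (use assms(2) in auto)
    then have "k = 0"
      using assms(1) x by (simp add: inner_diff_right)
    then show "x \<in> span (set cs)"
      using k by simp
  qed
qed simp

section \<open>Reflections, and uniqueness of the volume element up to sign\<close>

definition reflect :: "real^'n \<Rightarrow> real^'n \<Rightarrow> real^'n" where
  "reflect u x = x - (2 * (x \<bullet> u) / (u \<bullet> u)) *\<^sub>R u"

lemma reflect_inner: "u \<noteq> 0 \<Longrightarrow> reflect u x \<bullet> reflect u y = x \<bullet> y"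
  by (simp add: reflect_def inner_diff_left inner_diff_right inner_commute field_simps)

lemma reflect_reflect: "u \<noteq> 0 \<Longrightarrow> reflect u (reflect u x) = x"
proof -
  assume "u \<noteq> 0"
  then have "reflect u x \<bullet> u = - (x \<bullet> u)"
    by (simp add: reflect_def inner_diff_left)
  then show ?thesis
    unfolding reflect_def[of u "reflect u x"] by (simp add: reflect_def)
qed

lemma linear_reflect: "linear (reflect u)"
  by (rule linearI) (simp_all add: reflect_def inner_add_left add_divide_distrib scaleR_left_distrib
      distrib_left scaleR_right_diff_distrib)

lemma reflect_unit:
  assumes "b \<bullet> b = 1" "c \<bullet> c = 1" "b \<noteq> c"
  shows "reflect (b - c) b = c"
proof -
  have "2 * (b \<bullet> (b - c)) = (b - c) \<bullet> (b - c)"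
    using assms by (simp add: inner_diff_left inner_diff_right inner_commute)
  then show ?thesis
    using assms by (simp add: reflect_def)
qed

lemma orthonormal_map_reflect: "u \<noteq> 0 \<Longrightarrow> orthonormal bs \<Longrightarrow> orthonormal (map (reflect u) bs)"
  by (induction bs) (auto simp: reflect_inner)

lemma span_map_reflect:
  assumes "u \<noteq> 0" "u \<in> span (set bs)"
  shows "span (set (map (reflect u) bs)) = span (set bs)"
proof -
  have sub: "reflect u x \<in> span (set bs)" if "x \<in> span (set bs)" for x
    unfolding reflect_def using that assms(2) by (intro span_diff span_scale)
  then have "reflect u ` span (set bs) = span (set bs)"
    by (auto simp: image_iff) (metis sub reflect_reflect assms(1))
  then show ?thesis
    by (simp add: span_linear_image[OF linear_reflect])
qed

text \<open>Up to sign a reflection is conjugation by \<open>cv u\<close>; this form avoids the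
  inverse of \<open>cv u\<close>.\<close>

lemma cv_reflect:
  assumes "u \<noteq> 0"
  shows "cv (reflect u x) \<odot> cv u = - (cv u \<odot> cv x)"
proof -
  have "cv (reflect u x) \<odot> cv u = cv x \<odot> cv u - of_real (2 * (x \<bullet> u) / (u \<bullet> u)) *s (cv u \<odot> cv u)"
    by (simp only: reflect_def cv_diff cv_scale cl_diff_left cl_scale_left)
  also have "\<dots> = cv x \<odot> cv u + of_real (2 * (x \<bullet> u)) *s mv_one"
    using assms by (simp add: cv_square)
  finally show ?thesis
    by (simp add: cv_swap[of x u])
qed

lemma cprod_reflect:
  assumes "u \<noteq> 0"
  shows "cprod (map (reflect u) bs) \<odot> cv u = (- 1) ^ length bs *s (cv u \<odot> cprod bs)"
proof (induction bs)
  case Nil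
  show ?case by simp
next
  case (Cons b bs)
  have "cprod (map (reflect u) (b # bs)) \<odot> cv u = (- 1) ^ length bs *s (cv (reflect u b) \<odot> cv u \<odot> cprod bs)"
    by (simp add: cl_assoc Cons.IH cl_scale_right)
  then show ?case
    by (simp add: cv_reflect[OF assms] cl_minus_left cl_assoc)
qed

text \<open>Passing \<open>u\<close> through the product costs \<open>(- 1) ^ length bs\<close> by
  \<open>cprod_reflect\<close> and \<open>(- 1) ^ (length bs + 1)\<close> by
  \<open>cv_cprod_span\<close>. The net sign is the determinant of a reflection.\<close>

lemma cprod_map_reflect:
  assumes "u \<noteq> 0" "orthonormal bs" "u \<in> span (set bs)"
  shows "cprod (map (reflect u) bs) = - cprod bs"
proof -
  let ?X = "cprod (map (reflect u) bs)"
  have "?X \<odot> cv u = - (cprod bs \<odot> cv u)"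
    using cprod_reflect[OF assms(1), of bs] cv_cprod_span[OF assms(2,3)] by simp
  then have "?X \<odot> cv u \<odot> cv u = - (cprod bs \<odot> cv u \<odot> cv u)"
    by (simp add: cl_minus_left)
  then have "of_real (u \<bullet> u) *s (- ?X) = of_real (u \<bullet> u) *s cprod bs"
    by (simp add: cl_assoc cv_square cl_minus_right cl_scale_right)
  then show ?thesis
    using assms(1) by (metis inner_eq_zero_iff of_real_eq_0_iff vec.scale_left_imp_eq minus_minus)
qed

text \<open>Two orthonormal bases of the same space are related by reflections in vectors of that
  space, each of which changes the sign of the Clifford volume element.\<close>

lemma cprod_unique:
  assumes "orthonormal bs" "orthonormal cs" "span (set bs) = span (set cs)"
  shows "cprod bs = cprod cs \<or> cprod bs = - cprod cs"
  using assms
proof (induction "length bs" arbitrary: bs cs)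
  case 0
  have "cs = []"
  proof (cases cs)
    case (Cons c cs')
    then have "c \<in> span (set bs)"
      using 0 span_base[of c "set cs"] by (metis list.set_intros(1))
    then have "c = 0"
      using 0(1) by simp
    then show ?thesis
      using 0 Cons by simp
  qed simp
  then show ?case
    using 0 by simp
next
  case (Suc n)
  then obtain b bs' where bs: "bs = b # bs'"
    by (cases bs) auto
  have "cs \<noteq> []"
    using Suc.prems span_base[of b "set bs"] by (auto simp: bs)
  then obtain c cs' where cs: "cs = c # cs'"
    by (cases cs) auto
  have step: "cprod (c # ds) = cprod cs \<or> cprod (c # ds) = - cprod cs"
    if "length ds = n" "orthonormal (c # ds)" "span (set (c # ds)) = span (set cs)" for ds
  proof -
    have "span (set ds) = span (set cs')"
      using orthonormal_span_tail[of c ds cs'] orthonormal_span_tail[of c cs' ds] that Suc.prems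
      by (simp add: cs subset_antisym)
    then have "cprod ds = cprod cs' \<or> cprod ds = - cprod cs'"
      using Suc.hyps(1)[of ds cs'] that Suc.prems by (simp add: cs)
    then show ?thesis
      by (auto simp: cs cl_minus_right)
  qed
  show ?case
  proof (cases "b = c")
    case True
    then show ?thesis
      using step[of bs'] Suc.hyps(2) Suc.prems by (simp add: bs)
  next
    case False
    \<comment> \<open>The reflection in \<open>b - c\<close> carries the unit vector
      \<open>b\<close> to \<open>c\<close>, so the heads agree and the induction applies to the
      tails.\<close>
    define u where "u = b - c"
    have u: "u \<noteq> 0" "u \<in> span (set bs)"
      using False Suc.prems(3) span_base[of b "set bs"] span_base[of c "set cs"]
      by (auto simp: u_def bs cs intro!: span_diff)
    have "reflect u b = c"
      using False Suc.prems by (simp add: u_def bs cs reflect_unit)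
    then have map_eq: "map (reflect u) bs = c # map (reflect u) bs'"
      by (simp add: bs)
    have "cprod (map (reflect u) bs) = cprod cs \<or> cprod (map (reflect u) bs) = - cprod cs"
      unfolding map_eq
      using Suc.hyps(2) Suc.prems orthonormal_map_reflect[OF u(1), of bs] span_map_reflect[OF u]
      by (intro step) (simp_all add: bs map_eq[unfolded bs] del: list.map)
    then show ?thesis
      unfolding cprod_map_reflect[OF u(1) Suc.prems(1) u(2)] by (metis minus_minus)
  qed
qed

section \<open>Orthonormal lists as bases of subspaces\<close>

lemma orthonormal_nth:
  assumes "\<forall>i<length bs. \<forall>j<length bs. bs ! i \<bullet> bs ! j = (if i = j then 1 else 0)"
  shows "orthonormal bs"
  using assms
proof (induction bs)
  case Nil
  show ?case by simp
next
  case (Cons b bs)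
  have "b \<bullet> b = 1"
    using Cons.prems by (metis length_greater_0_conv list.distinct(1) nth_Cons_0)
  moreover have "b \<bullet> x = 0" if x: "x \<in> set bs" for x
  proof -
    obtain i where "i < length bs" "x = bs ! i"
      using x by (auto simp: in_set_conv_nth)
    then show ?thesis
      using Cons.prems[rule_format, of 0 "Suc i"] by simp
  qed
  moreover have "bs ! i \<bullet> bs ! j = (if i = j then 1 else 0)" if "i < length bs" "j < length bs" for i j
    using Cons.prems[rule_format, of "Suc i" "Suc j"] that by simp
  ultimately show ?case
    using Cons.IH by simp
qed

lemma orthonormal_nth_iff:
  "orthonormal bs \<longleftrightarrow> (\<forall>i<length bs. \<forall>j<length bs. bs ! i \<bullet> bs ! j = (if i = j then 1 else 0))"
proof
  show "\<forall>i<length bs. \<forall>j<length bs. bs ! i \<bullet> bs ! j = (if i = j then 1 else 0)" if "orthonormal bs"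
    using that
  proof (induction bs)
    case (Cons b bs)
    show ?case
    proof (intro allI impI)
      fix i j assume "i < length (b # bs)" "j < length (b # bs)"
      then show "(b # bs) ! i \<bullet> (b # bs) ! j = (if i = j then 1 else 0)"
        using Cons by (cases i; cases j) (auto simp: inner_commute)
    qed
  qed simp
qed (rule orthonormal_nth)

lemma orthonormal_independent:
  assumes "orthonormal bs"
  shows "independent (set bs)" "distinct bs"
proof -
  have "distinct bs"
    using assms by (induction bs) auto
  moreover have "pairwise orthogonal (set bs)" "0 \<notin> set bs"
    using assms by (induction bs) (auto simp: pairwise_insert orthogonal_def inner_commute)
  ultimately show "independent (set bs)" "distinct bs"
    using pairwise_orthogonal_independent by blast+
qed

lemma orthonormal_basis_iff:
  assumes "subspace N"
  shows "orthonormal_basis N bs \<longleftrightarrow> orthonormal bs \<and> span (set bs) = N"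
proof
  assume bs: "orthonormal_basis N bs"
  then have on: "orthonormal bs" and sub: "set bs \<subseteq> N" "length bs = dim N"
    by (auto simp: orthonormal_basis_def intro: orthonormal_nth)
  have "N \<subseteq> span (set bs)"
    using orthonormal_independent[OF on] sub by (intro card_ge_dim_independent) (auto simp: distinct_card)
  then show "orthonormal bs \<and> span (set bs) = N"
    using on sub assms by (simp add: span_minimal subset_antisym)
next
  assume bs: "orthonormal bs \<and> span (set bs) = N"
  then have "dim N = length bs"
    using orthonormal_independent[of bs] by (metis dim_eq_card_independent dim_span distinct_card)
  then show "orthonormal_basis N bs"
    using bs orthonormal_nth_iff[of bs] span_superset[of "set bs"] by (auto simp: orthonormal_basis_def)
qed

lemma cprod_nonzero: "orthonormal bs \<Longrightarrow> cprod bs \<noteq> 0"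
proof (induction bs)
  case Nil
  show ?case by (simp add: mv_one_def axis_eq_0_iff)
next
  case (Cons b bs)
  then show ?case
    using cv_unit_cancel[of b "cprod bs"] by auto
qed

section \<open>Degrees of multivectors\<close>

lemma wedge_list_degree: "wedge_list bs $ I \<noteq> 0 \<Longrightarrow> card I = length bs"
proof (induction bs arbitrary: I)
  case Nil
  then show ?case by (auto simp: mv_one_def axis_def split: if_splits)
next
  case (Cons b bs)
  then have "(\<Sum>i\<in>UNIV. ext_sign {i} (sym_diff {i} I) * cvec b $ i * wedge_list bs $ (sym_diff {i} I)) \<noteq> 0"
    by (simp add: cv_def ext_mult_twist twist_vec_left)
  then obtain i where i: "ext_sign {i} (sym_diff {i} I) * cvec b $ i * wedge_list bs $ (sym_diff {i} I) \<noteq> 0"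
    by (meson sum.neutral)
  then have "{i} \<inter> sym_diff {i} I = {}" "card (sym_diff {i} I) = length bs"
    using Cons.IH[of "sym_diff {i} I"] by (auto simp: ext_sign_def split: if_splits)
  then have "I = insert i (sym_diff {i} I)" "i \<notin> sym_diff {i} I"
    by auto
  then have "card I = Suc (card (sym_diff {i} I))"
    by (metis card_insert_disjoint finite)
  then show ?case
    using \<open>card (sym_diff {i} I) = length bs\<close> by simp
qed

text \<open>Clifford multiplication respects only the filtration by degree and not the grading, so
  lower terms are controlled by a bound.\<close>

definition deg_less :: "'n::{finite,linorder} multivector \<Rightarrow> nat \<Rightarrow> bool" where
  "deg_less a d \<longleftrightarrow> (\<forall>I. a $ I \<noteq> 0 \<longrightarrow> card I < d)"

lemma deg_less_cv:
  assumes "deg_less a d"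
  shows "deg_less (cv v \<odot> a) (Suc d)"
  unfolding deg_less_def
proof (intro allI impI)
  fix I assume "(cv v \<odot> a) $ I \<noteq> 0"
  then have "(\<Sum>i\<in>UNIV. cl_sign {i} (sym_diff {i} I) * cvec v $ i * a $ (sym_diff {i} I)) \<noteq> 0"
    by (simp add: cv_def cl_mult_twist twist_vec_left)
  then obtain i where "cl_sign {i} (sym_diff {i} I) * cvec v $ i * a $ (sym_diff {i} I) \<noteq> 0"
    by (meson sum.neutral)
  then have "card (sym_diff {i} I) < d"
    using assms by (auto simp: deg_less_def)
  moreover have "I \<subseteq> insert i (sym_diff {i} I)"
    by auto
  then have "card I \<le> card (insert i (sym_diff {i} I))"
    by (intro card_mono) simp_all
  moreover have "card (insert i S) \<le> Suc (card S)" for S :: "'a set"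
    by (simp add: card_insert_if)
  note this[of "sym_diff {i} I"]
  ultimately show "card I < Suc d"
    by simp
qed

lemma deg_less_add: "deg_less a d \<Longrightarrow> deg_less b d \<Longrightarrow> deg_less (a + b) d"
  unfolding deg_less_def by (metis add.right_neutral vector_add_component)

lemma deg_less_scale: "deg_less a d \<Longrightarrow> deg_less (c *s a) d"
  unfolding deg_less_def by auto

lemma deg_less_mono: "deg_less a d \<Longrightarrow> d \<le> e \<Longrightarrow> deg_less a e"
  unfolding deg_less_def by (meson less_le_trans)

section \<open>Bivectors of planes and rotors\<close>

definition bivec :: "'n::{finite,linorder} plane \<Rightarrow> 'n multivector" where
  "bivec p = cv (fst p) \<odot> cv (snd p)"

text \<open>The two vectors of each plane stay adjacent, so the volume element is the product of the
  plane bivectors.\<close>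

definition flat :: "'n plane list \<Rightarrow> (real^'n) list" where
  "flat l = concat (map (\<lambda>p. [fst p, snd p]) l)"

lemma flat_simps [simp]: "flat [] = []" "flat (p # l) = fst p # snd p # flat l"
  "flat (l @ m) = flat l @ flat m"
  by (simp_all add: flat_def)

lemma set_flat: "set (flat l) = fst ` set l \<union> snd ` set l"
  by (induction l) auto

lemma length_flat [simp]: "length (flat l) = 2 * length l"
  by (induction l) auto

lemma cprod_flat_Cons: "cprod (flat (p # l)) = bivec p \<odot> cprod (flat l)"
  by (simp add: bivec_def cl_assoc)

lemma span_flat: "span (set (flat l)) = frame_space (set l)"
  by (simp add: set_flat frame_space_def)

lemma orthonormal_flat:
  assumes "frame (set l)" "distinct l"
  shows "orthonormal (flat l)"
  using assms
proof (induction l)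
  case (Cons p l)
  have sub: "frame (set l)"
    using Cons.prems frame_subset by (metis set_subset_Cons)
  have "fst p \<bullet> x = 0 \<and> snd p \<bullet> x = 0" if "x \<in> set (flat l)" for x
    using that Cons.prems frame_inner[OF Cons.prems(1), of p] frame_inner[OF Cons.prems(1), of _ p]
    by (fastforce simp: set_flat)
  then show ?case
    using Cons sub frame_inner[OF Cons.prems(1), of p p] by auto
qed simp

lemma dim_frame_space:
  assumes "frame (set l)" "distinct l"
  shows "dim (frame_space (set l)) = 2 * length l"
  using orthonormal_basis_iff[of "frame_space (set l)" "flat l"] orthonormal_flat[OF assms]
  by (simp add: span_flat subspace_frame_space orthonormal_basis_def)

lemma is_orientation_frame:
  assumes "frame (set l)" "distinct l"
  shows "is_orientation (frame_space (set l)) \<omega> \<longleftrightarrow> (\<omega> = cprod (flat l) \<or> \<omega> = - cprod (flat l))"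
proof -
  note on = orthonormal_flat[OF assms]
  note basis_iff = orthonormal_basis_iff[OF subspace_frame_space, of "set l"]
  show ?thesis
  proof
    assume "is_orientation (frame_space (set l)) \<omega>"
    then obtain bs where bs: "orthonormal bs" "span (set bs) = span (set (flat l))"
      and \<omega>: "\<omega> = wedge_list bs \<or> \<omega> = - wedge_list bs"
      by (auto simp: is_orientation_def basis_iff span_flat)
    then show "\<omega> = cprod (flat l) \<or> \<omega> = - cprod (flat l)"
      using cprod_unique[OF bs(1) on bs(2)] by (auto simp: wedge_list_cprod)
  next
    assume "\<omega> = cprod (flat l) \<or> \<omega> = - cprod (flat l)"
    then show "is_orientation (frame_space (set l)) \<omega>"
      unfolding is_orientation_def basis_iff using on span_flat[of l] wedge_list_cprod[OF on] by metis
  qed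
qed

text \<open>A vector of another plane anticommutes with both factors of the bivector, a vector of
  the same plane with exactly one. The bivectors of a frame thus behave like commuting imaginary
  units.\<close>

lemma frame_bivec:
  assumes "frame K" "p \<in> K" "q \<in> K"
  shows "bivec p \<odot> cv (fst q) = (if p = q then - 1 else 1) *s (cv (fst q) \<odot> bivec p)"
    "bivec p \<odot> cv (snd q) = (if p = q then - 1 else 1) *s (cv (snd q) \<odot> bivec p)"
    "bivec p \<odot> bivec q = bivec q \<odot> bivec p"
    "bivec p \<odot> bivec p = - mv_one"
proof -
  note inn = frame_inner[OF assms] frame_inner[OF assms(1) assms(3) assms(2)] frame_inner[OF assms(1) assms(2) assms(2)]
  have anti: "cv (fst p) \<odot> (cv (snd p) \<odot> x) = - (cv (snd p) \<odot> (cv (fst p) \<odot> x))" for x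
  proof -
    have "cv (fst p) \<odot> cv (snd p) = - (cv (snd p) \<odot> cv (fst p))"
      by (rule cv_anticommute) (simp add: inn)
    then show ?thesis
      by (metis cl_assoc cl_minus_left)
  qed
  have commute: "bivec p \<odot> cv v = cv v \<odot> bivec p" if "fst p \<bullet> v = 0" "snd p \<bullet> v = 0" for v
  proof -
    have "bivec p \<odot> cv v = - (cv (fst p) \<odot> cv v \<odot> cv (snd p))"
      unfolding bivec_def cl_assoc cv_anticommute[OF that(2)] cl_minus_right ..
    also have "\<dots> = cv v \<odot> bivec p"
      unfolding cv_anticommute[OF that(1)] cl_minus_left bivec_def cl_assoc by simp
    finally show ?thesis .
  qed
  have self: "bivec p \<odot> cv (fst p) = - (cv (fst p) \<odot> bivec p)" "bivec p \<odot> cv (snd p) = - (cv (snd p) \<odot> bivec p)"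
  proof -
    have "cv (snd p) \<odot> cv (fst p) = - (cv (fst p) \<odot> cv (snd p))"
      by (rule cv_anticommute) (simp add: inn)
    then show "bivec p \<odot> cv (fst p) = - (cv (fst p) \<odot> bivec p)"
      unfolding bivec_def cl_assoc by (metis cl_minus_right)
    show "bivec p \<odot> cv (snd p) = - (cv (snd p) \<odot> bivec p)"
      unfolding bivec_def cl_assoc by (rule anti)
  qed
  show fst: "bivec p \<odot> cv (fst q) = (if p = q then - 1 else 1) *s (cv (fst q) \<odot> bivec p)"
  proof (cases "p = q")
    case False
    then show ?thesis
      using commute[of "fst q"] by (simp add: inn)
  qed (use self in simp)
  show snd: "bivec p \<odot> cv (snd q) = (if p = q then - 1 else 1) *s (cv (snd q) \<odot> bivec p)"
  proof (cases "p = q")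
    case False
    then show ?thesis
      using commute[of "snd q"] by (simp add: inn)
  qed (use self in simp)
  show "bivec p \<odot> bivec q = bivec q \<odot> bivec p"
  proof (cases "p = q")
    case False
    then have "bivec p \<odot> cv (fst q) = cv (fst q) \<odot> bivec p" "bivec p \<odot> cv (snd q) = cv (snd q) \<odot> bivec p"
      using fst snd by simp_all
    then show ?thesis
      unfolding bivec_def[of q] by (metis cl_assoc)
  qed simp
  show "bivec p \<odot> bivec p = - mv_one"
    unfolding bivec_def cl_assoc anti[of "cv (fst p) \<odot> cv (snd p)"]
    by (simp add: inn cv_unit_cancel cv_square cl_minus_right)
qed

text \<open>The ordered product of the factors \<open>c p + s p * bivec p\<close>. Leaving
  \<open>c\<close> and \<open>s\<close> unrelated to an angle also covers scalars, the volume
  element and its products with spin elements.\<close>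

definition rotor :: "'n::{finite,linorder} plane list \<Rightarrow> ('n plane \<Rightarrow> complex) \<Rightarrow> ('n plane \<Rightarrow> complex) \<Rightarrow> 'n multivector" where
  "rotor l c s = foldr (\<lambda>p x. c p *s x + s p *s (bivec p \<odot> x)) l mv_one"

lemma rotor_simps [simp]: "rotor [] c s = mv_one"
  "rotor (p # l) c s = c p *s rotor l c s + s p *s (bivec p \<odot> rotor l c s)"
  by (simp_all add: rotor_def)

lemma rotor_commute:
  assumes "\<And>p. p \<in> set l \<Longrightarrow> x \<odot> bivec p = bivec p \<odot> x"
  shows "x \<odot> rotor l c s = rotor l c s \<odot> x"
  using assms
proof (induction l)
  case (Cons p l)
  have "x \<odot> (bivec p \<odot> rotor l c s) = bivec p \<odot> rotor l c s \<odot> x"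
    using Cons.IH Cons.prems by (metis cl_assoc list.set_intros)
  then show ?case
    using Cons by (simp add: cl_linear)
qed simp

lemma bivec_square_cancel:
  assumes "bivec p \<odot> bivec p = - mv_one"
  shows "bivec p \<odot> (bivec p \<odot> x) = - x"
  using assms by (metis cl_assoc cl_minus_left cl_one(1))

text \<open>The bivectors are commuting square roots of \<open>- 1\<close>, so in each plane this is
  multiplication of complex numbers.\<close>

lemma rotor_mult:
  assumes "frame (set l)" "distinct l"
  shows "rotor l c s \<odot> rotor l c' s'
    = rotor l (\<lambda>p. c p * c' p - s p * s' p) (\<lambda>p. c p * s' p + s p * c' p)"
  using assms
proof (induction l)
  case (Cons p l)
  let ?A = "rotor l c s" and ?B = "rotor l c' s'" and ?b = "bivec p"
  have fr: "frame (set l)"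
    using Cons.prems frame_subset by (metis set_subset_Cons)
  have comm: "?A \<odot> (?b \<odot> x) = ?b \<odot> (?A \<odot> x)" for x
  proof -
    have "?b \<odot> ?A = ?A \<odot> ?b"
      by (rule rotor_commute) (use frame_bivec(3)[OF Cons.prems(1), of p] in simp)
    then show ?thesis
      by (metis cl_assoc)
  qed
  have sq: "?b \<odot> (?b \<odot> x) = - x" for x
    using frame_bivec(4)[OF Cons.prems(1), of p p] by (intro bivec_square_cancel) simp
  show ?case
    using Cons fr
    by (simp add: cl_linear cl_assoc comm sq vec.scale_right_distrib vec.scale_left_distrib
        vec.scale_left_diff_distrib vec.scale_minus_right Cons.IH[OF fr, symmetric] algebra_simps)
qed simp

text \<open>Taking the scalar in any one factor costs two degrees, so only the product of all
  bivectors reaches the top.\<close>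

lemma rotor_top:
  assumes "frame (set l)" "distinct l"
  shows "\<exists>x. rotor l c s = prod_list (map s l) *s cprod (flat l) + x \<and> deg_less x (2 * length l)"
  using assms
proof (induction l)
  case Nil
  then show ?case
    by (intro exI[of _ 0]) (simp add: deg_less_def)
next
  case (Cons p l)
  have fr: "frame (set l)"
    using Cons.prems frame_subset by (metis set_subset_Cons)
  then obtain x where x: "rotor l c s = prod_list (map s l) *s cprod (flat l) + x" "deg_less x (2 * length l)"
    using Cons by auto
  have "deg_less (cprod (flat l)) (2 * length l + 1)"
    using wedge_list_degree[of "flat l"] wedge_list_cprod[OF orthonormal_flat[OF fr]] Cons.prems
    by (auto simp: deg_less_def)
  then have "deg_less (rotor l c s) (2 * length (p # l))"
    unfolding x(1) by (intro deg_less_add deg_less_scale) (use x(2) deg_less_mono in \<open>fastforce+\<close>)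
  moreover have "deg_less (bivec p \<odot> x) (2 * length (p # l))"
    using deg_less_cv[OF deg_less_cv[OF x(2)]] by (simp add: bivec_def cl_assoc)
  ultimately have "deg_less (c p *s rotor l c s + s p *s (bivec p \<odot> x)) (2 * length (p # l))"
    by (intro deg_less_add deg_less_scale)
  moreover have "rotor (p # l) c s = prod_list (map s (p # l)) *s cprod (flat (p # l))
      + (c p *s rotor l c s + s p *s (bivec p \<odot> x))"
    unfolding cprod_flat_Cons rotor_simps
    by (subst (2) x(1)) (simp add: cl_linear vec.scale_right_distrib)
  ultimately show ?case
    by blast
qed

lemma top_degree_rotor:
  assumes "frame (set l)" "distinct l"
  shows "top_degree (frame_space (set l)) (rotor l c s) = prod_list (map s l) *s cprod (flat l)"
proof -
  obtain x where x: "rotor l c s = prod_list (map s l) *s cprod (flat l) + x" "deg_less x (2 * length l)"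
    using rotor_top[OF assms] by blast
  have "cprod (flat l) $ I = 0" if "card I \<noteq> 2 * length l" for I
    using that wedge_list_degree[of "flat l" I] wedge_list_cprod[OF orthonormal_flat[OF assms]] by auto
  moreover have "x $ I = 0" if "card I = 2 * length l" for I
    using x(2) that by (auto simp: deg_less_def)
  ultimately show ?thesis
    unfolding x(1) by (auto simp: top_degree_def dim_frame_space[OF assms] vec_eq_iff)
qed

section \<open>Exponentials in the Clifford algebra\<close>

text \<open>Multivectors carry no Banach algebra structure here, so exponentials are computed on
  eigenvectors of left multiplication.\<close>

inductive cl_spectral :: "'n::{finite,linorder} multivector \<Rightarrow> 'n multivector \<Rightarrow> 'n multivector \<Rightarrow> bool"
  for a where
  zero: "cl_spectral a 0 0"
| add: "a \<odot> x = \<mu> *s x \<Longrightarrow> cl_spectral a s g \<Longrightarrow> cl_spectral a (x + s) (exp \<mu> *s x + g)"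

lemma exp_scale_sums: "(\<lambda>m. (1 / fact m) *\<^sub>R (\<mu> ^ m *s x)) sums (exp \<mu> *s (x :: complex^'n))"
proof -
  have "linear (\<lambda>c. c *s x)"
    by (rule linearI) (simp_all add: vec_eq_iff algebra_simps)
  then have "bounded_linear (\<lambda>c. c *s x)"
    by (rule linear_conv_bounded_linear[THEN iffD1])
  then have "(\<lambda>m. (\<mu> ^ m /\<^sub>R fact m) *s x) sums (exp \<mu> *s x)"
    by (rule bounded_linear.sums) (rule exp_converges)
  moreover have "(\<mu> ^ m /\<^sub>R fact m) *s x = (1 / fact m) *\<^sub>R (\<mu> ^ m *s x)" for m
    by (simp add: vec_eq_iff divide_inverse)
  ultimately show ?thesis
    by simp
qed

lemma cl_spectral_sums:
  assumes "cl_spectral a s g"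
  shows "(\<lambda>m. (1 / fact m) *\<^sub>R ((cl_mult a ^^ m) s)) sums g"
  using assms
proof induction
  case zero
  have "(cl_mult a ^^ m) 0 = 0" for m
    by (induction m) simp_all
  then show ?case by simp
next
  case (add x \<mu> s g)
  have "(cl_mult a ^^ m) (x + s) = \<mu> ^ m *s x + (cl_mult a ^^ m) s" for m
    by (induction m) (simp_all add: cl_add_right cl_scale_right add.hyps(1) mult.commute)
  then show ?case
    using sums_add[OF exp_scale_sums[of \<mu> x] add.IH] by (simp add: scaleR_add_right)
qed

lemma cl_exp_spectral: "cl_spectral a mv_one g \<Longrightarrow> cl_exp a = g"
  unfolding cl_exp_def by (rule sums_unique[symmetric]) (rule cl_spectral_sums)

text \<open>As \<open>b\<close> commutes with \<open>a\<close> and squares to \<open>- 1\<close>,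
  every eigenvector of \<open>a\<close> splits into eigenvectors of \<open>b\<close> for
  \<open>\<plusminus> \<i>\<close>, and on these \<open>a + t *s b\<close> acts by scalars.\<close>

lemma cl_spectral_step:
  assumes "cl_spectral a s g" "b \<odot> a = a \<odot> b" "b \<odot> b = - mv_one"
  shows "cl_spectral (a + t *s b) s (cos t *s g + sin t *s (b \<odot> g))"
  using assms(1)
proof induction
  case zero
  then show ?case
    by (simp add: cl_spectral.zero)
next
  case (add x \<mu> s g)
  have bb: "b \<odot> (b \<odot> x) = - x"
    using assms(3) by (metis cl_assoc cl_minus_left cl_one(1))
  have ab: "a \<odot> (b \<odot> x) = \<mu> *s (b \<odot> x)"
    using add.hyps(1) assms(2) by (metis cl_assoc cl_scale_right)
  define x1 where "x1 = (1 / 2) *s (x - \<i> *s (b \<odot> x))"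
  define x2 where "x2 = (1 / 2) *s (x + \<i> *s (b \<odot> x))"
  have "(a + t *s b) \<odot> x1 = (\<mu> + \<i> * t) *s x1"
    unfolding x1_def by (simp add: cl_linear bb ab add.hyps(1)) (simp add: vec_eq_iff field_simps)
  moreover have "(a + t *s b) \<odot> x2 = (\<mu> - \<i> * t) *s x2"
    unfolding x2_def by (simp add: cl_linear bb ab add.hyps(1)) (simp add: vec_eq_iff field_simps)
  ultimately have "cl_spectral (a + t *s b) (x1 + (x2 + s))
      (exp (\<mu> + \<i> * t) *s x1 + (exp (\<mu> - \<i> * t) *s x2 + (cos t *s g + sin t *s (b \<odot> g))))"
    by (intro cl_spectral.add add.IH)
  moreover have "x1 + (x2 + s) = x + s"
    by (simp add: x1_def x2_def vec_eq_iff field_simps)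
  moreover have "exp (\<mu> + \<i> * t) *s x1 + (exp (\<mu> - \<i> * t) *s x2 + (cos t *s g + sin t *s (b \<odot> g)))
      = cos t *s (exp \<mu> *s x + g) + sin t *s (b \<odot> (exp \<mu> *s x + g))"
  proof -
    have "exp (\<mu> + \<i> * t) = exp \<mu> * (cos t + \<i> * sin t)" "exp (\<mu> - \<i> * t) = exp \<mu> * (cos t - \<i> * sin t)"
      using exp_Euler[of t] exp_Euler[of "- t"] exp_add[of \<mu> "\<i> * t"] exp_add[of \<mu> "- (\<i> * t)"]
      by simp_all
    then show ?thesis
      by (simp add: x1_def x2_def cl_linear) (simp add: vec_eq_iff field_simps)
  qed
  ultimately show ?case by simp
qed

lemma cl_spectral_rotor:
  assumes "frame (set l)" "distinct l"
  shows "cl_spectral (\<Sum>p\<in>set l. \<theta> p *s bivec p) mv_one (rotor l (\<lambda>p. cos (\<theta> p)) (\<lambda>p. sin (\<theta> p)))"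
  using assms
proof (induction l)
  case Nil
  show ?case
    using cl_spectral.add[of 0 mv_one 0 0 0] cl_spectral.zero[of 0] by simp
next
  case (Cons p l)
  have fr: "frame (set l)"
    using Cons.prems frame_subset by (metis set_subset_Cons)
  have comm: "bivec p \<odot> bivec q = bivec q \<odot> bivec p" if "q \<in> set l" for q
    using frame_bivec(3)[OF Cons.prems(1), of p q] that by simp
  have "bivec p \<odot> (\<Sum>q\<in>set l. \<theta> q *s bivec q) = (\<Sum>q\<in>set l. \<theta> q *s bivec q) \<odot> bivec p"
    unfolding cl_sum_left cl_sum_right by (rule sum.cong) (simp_all add: cl_scale_left cl_scale_right comm)
  then have "cl_spectral ((\<Sum>q\<in>set l. \<theta> q *s bivec q) + \<theta> p *s bivec p) mv_one
      (rotor (p # l) (\<lambda>p. cos (\<theta> p)) (\<lambda>p. sin (\<theta> p)))"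
    unfolding rotor_simps using Cons fr frame_bivec(4)[OF Cons.prems(1), of p p]
    by (intro cl_spectral_step) simp_all
  then show ?case
    using Cons.prems by (simp add: add.commute)
qed

section \<open>The spin lift of an infinitesimal rotation\<close>

lemma mv_vec_add: "mv_vec (v + w) = mv_vec v + mv_vec w"
  by (simp add: mv_vec_def vec_eq_iff sum_component sum.distrib[symmetric] axis_def)
    (intro allI sum.cong, auto)

lemma mv_vec_scale: "mv_vec (c *s v) = c *s mv_vec v"
  by (simp add: mv_vec_def vec_eq_iff sum_component sum_distrib_left axis_def)
    (intro allI sum.cong, auto)

lemma mv_vec_sum: "mv_vec (sum f A) = (\<Sum>a\<in>A. mv_vec (f a))"
proof -
  have "mv_vec 0 = 0"
    using mv_vec_scale[of 0 0] by simp
  then show ?thesis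
    by (induction A rule: infinite_finite_induct) (simp_all add: mv_vec_add)
qed

lemma mv_vec_axis_expand: "(\<Sum>i\<in>UNIV. c $ i *s mv_vec (axis i 1)) = mv_vec c"
proof -
  have "(\<Sum>i\<in>UNIV. c $ i *s axis i 1) = c"
    by (rule basis_expansion)
  then show ?thesis
    by (metis (no_types, lifting) mv_vec_scale mv_vec_sum sum.cong)
qed

text \<open>The sum over the standard basis is the commutator of the two vectors, which is twice the
  bivector. With the factor 1/4 this is the origin of the half angles in
  \<open>spin_rotor\<close>.\<close>

lemma spin_lift_plane_rot:
  assumes "fst p \<bullet> snd p = 0"
  shows "spin_lift (cmat (plane_rot p)) = (1 / 2) *s bivec p"
proof -
  let ?e = "cvec (fst p)" and ?f = "cvec (snd p)"
  have col: "cmat (plane_rot p) *v axis i 1 = ?e $ i *s ?f - ?f $ i *s ?e" for i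
    by (simp add: vec_eq_iff matrix_vector_mult_def plane_rot_def axis_def
        if_distrib[where f = "\<lambda>x. _ * x"] cong: if_cong)
  have "(\<Sum>i\<in>UNIV. mv_vec (axis i 1) \<odot> mv_vec (cmat (plane_rot p) *v axis i 1))
      = (\<Sum>i\<in>UNIV. ?e $ i *s mv_vec (axis i 1)) \<odot> cv (snd p) - (\<Sum>i\<in>UNIV. ?f $ i *s mv_vec (axis i 1)) \<odot> cv (fst p)"
  proof -
    have "mv_vec (axis i 1) \<odot> mv_vec (cmat (plane_rot p) *v axis i 1)
      = (?e $ i *s mv_vec (axis i 1)) \<odot> cv (snd p) - (?f $ i *s mv_vec (axis i 1)) \<odot> cv (fst p)" for i
      unfolding col diff_conv_add_uminus vec.scale_minus_left[symmetric] mv_vec_add mv_vec_scale cv_def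
      by (simp add: cl_linear)
    then show ?thesis
      by (simp add: cl_sum_left sum_subtractf)
  qed
  also have "\<dots> = cv (fst p) \<odot> cv (snd p) - cv (snd p) \<odot> cv (fst p)"
    unfolding mv_vec_axis_expand cv_def ..
  also have "cv (snd p) \<odot> cv (fst p) = - bivec p"
    unfolding bivec_def by (rule cv_anticommute) (use assms in \<open>simp add: inner_commute\<close>)
  finally show ?thesis
    by (simp add: spin_lift_def bivec_def[symmetric]) (simp add: vec_eq_iff)
qed

lemma spin_lift_skew:
  assumes "frame B"
  shows "spin_lift (skew B \<theta>) = (\<Sum>p\<in>B. (\<theta> p / 2) *s bivec p)"
proof -
  have add: "spin_lift (X + Y) = spin_lift X + spin_lift Y" for X Y :: "'a cmatrix"
    by (simp add: spin_lift_def matrix_vector_mult_add_rdistrib mv_vec_add cl_add_right sum.distrib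
        vec.scale_right_distrib)
  have scale: "spin_lift (mscale c X) = c *s spin_lift X" for c and X :: "'a cmatrix"
  proof -
    have "mscale c X *v x = c *s (X *v x)" for x
      by (simp add: vec_eq_iff matrix_vector_mult_def sum_distrib_left mult_ac)
    then show ?thesis
      by (simp add: spin_lift_def mv_vec_scale cl_scale_right mult.commute flip: vec.scale_sum_right)
  qed
  have "spin_lift (0 :: 'a cmatrix) = 0"
  proof -
    have "mscale 0 0 = (0 :: 'a cmatrix)"
      by (simp add: vec_eq_iff)
    then show ?thesis
      using scale[of 0 0] by simp
  qed
  then have "spin_lift (\<Sum>p\<in>B. f p) = (\<Sum>p\<in>B. spin_lift (f p))" for f :: "'a plane \<Rightarrow> 'a cmatrix"
    by (induction B rule: infinite_finite_induct) (simp_all add: add)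
  then have "spin_lift (skew B \<theta>) = (\<Sum>p\<in>B. \<theta> p *s spin_lift (cmat (plane_rot p)))"
    by (simp add: skew_def scale)
  also have "\<dots> = (\<Sum>p\<in>B. (\<theta> p / 2) *s bivec p)"
    by (rule sum.cong) (simp_all add: spin_lift_plane_rot frame_inner[OF assms])
  finally show ?thesis .
qed

definition spin_rotor :: "'n::{finite,linorder} plane list \<Rightarrow> ('n plane \<Rightarrow> complex) \<Rightarrow> 'n multivector" where
  "spin_rotor l \<theta> = rotor l (\<lambda>p. cos (\<theta> p / 2)) (\<lambda>p. sin (\<theta> p / 2))"

lemma spin_exp_skew:
  assumes "frame (set l)" "distinct l"
  shows "spin_exp (skew (set l) \<theta>) = spin_rotor l \<theta>"
  unfolding spin_exp_def spin_rotor_def spin_lift_skew[OF assms(1)]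
  by (rule cl_exp_spectral[OF cl_spectral_rotor[OF assms]])

lemma spin_rotor_mult:
  assumes "frame (set l)" "distinct l"
  shows "spin_rotor l \<theta> \<odot> spin_rotor l \<phi> = spin_rotor l (\<lambda>p. \<theta> p + \<phi> p)"
  unfolding spin_rotor_def rotor_mult[OF assms] add_divide_distrib cos_add sin_add by (simp add: add.commute)

section \<open>Traces\<close>

definition clin :: "(complex^'m \<Rightarrow> complex^'k) \<Rightarrow> bool" where
  "clin f \<longleftrightarrow> (\<forall>x y. f (x + y) = f x + f y) \<and> (\<forall>c x. f (c *s x) = c *s f x)"

lemma clin_sum: "clin f \<Longrightarrow> f (\<Sum>a\<in>A. c a *s g a) = (\<Sum>a\<in>A. c a *s f (g a))"
proof -
  assume f: "clin f"
  then have "f 0 = 0"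
    unfolding clin_def by (metis vec.scale_zero_left)
  with f show ?thesis
    by (induction A rule: infinite_finite_induct) (simp_all add: clin_def)
qed

lemma clin_cl_mult: "clin (cl_mult x)"
  by (simp add: clin_def cl_add_right cl_scale_right)

lemma clin_id: "clin (\<lambda>x. x)"
  by (simp add: clin_def)

definition trace_basis :: "(complex^'m::finite) set \<Rightarrow> (complex^'m) set" where
  "trace_basis V = (SOME B. vec.independent B \<and> vec.span B = V)"

lemma trace_on_basis: "trace_on V T = (\<Sum>b\<in>trace_basis V. vec.representation (trace_basis V) (T b) b)"
  by (simp add: trace_on_def trace_basis_def Let_def)

lemma trace_basis:
  assumes "vec.subspace V"
  shows "vec.independent (trace_basis V)" "vec.span (trace_basis V) = V" "finite (trace_basis V)"
    "trace_basis V \<subseteq> V"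
proof -
  obtain B where "B \<subseteq> V" "vec.independent B" "V \<subseteq> vec.span B"
    by (rule vec.maximal_independent_subset)
  then have "vec.independent B \<and> vec.span B = V"
    using assms by (meson subset_antisym vec.span_minimal)
  then have "vec.independent (trace_basis V) \<and> vec.span (trace_basis V) = V"
    unfolding trace_basis_def by (rule someI)
  then show "vec.independent (trace_basis V)" "vec.span (trace_basis V) = V" "finite (trace_basis V)"
    "trace_basis V \<subseteq> V"
    using vec.span_superset[of "trace_basis V"] by (auto intro: vec.finiteI_independent)
qed

lemma trace_on_cong:
  assumes "vec.subspace V" "\<And>x. x \<in> V \<Longrightarrow> S x = T x"
  shows "trace_on V S = trace_on V T"
  unfolding trace_on_basis using assms(2) trace_basis(4)[OF assms(1)] by (auto intro!: sum.cong)

text \<open>Two different spaces are allowed so that one map can be an inclusion: the trace on an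
  eigenspace becomes a trace on the whole space. With equal spaces this is cyclicity.\<close>

lemma trace_on_comm:
  assumes "vec.subspace V" "vec.subspace W" "clin A" "clin C"
    and "\<And>x. x \<in> V \<Longrightarrow> A x \<in> W" "\<And>y. y \<in> W \<Longrightarrow> C y \<in> V"
  shows "trace_on V (\<lambda>x. C (A x)) = trace_on W (\<lambda>y. A (C y))"
proof -
  let ?B = "trace_basis V" and ?D = "trace_basis W"
  let ?rB = "vec.representation ?B" and ?rD = "vec.representation ?D"
  note B = trace_basis[OF assms(1)] and D = trace_basis[OF assms(2)]
  \<comment> \<open>The matrix entry of a composition, for auxiliary spaces and maps because it is
    used twice, with the two spaces exchanged.\<close>
  have entry: "vec.representation (trace_basis V') (C' (A' b)) b
      = (\<Sum>c\<in>trace_basis W'. vec.representation (trace_basis W') (A' b) c * vec.representation (trace_basis V') (C' c) b)"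
    if "vec.subspace V'" "vec.subspace W'" "clin C'" "b \<in> V'"
      "\<And>x. x \<in> V' \<Longrightarrow> A' x \<in> W'" "\<And>y. y \<in> W' \<Longrightarrow> C' y \<in> V'"
    for V' :: "(complex^'x) set" and W' :: "(complex^'y) set" and A' C' b
  proof -
    note V' = trace_basis[OF that(1)] and W' = trace_basis[OF that(2)]
    have "A' b = (\<Sum>c\<in>trace_basis W'. vec.representation (trace_basis W') (A' b) c *s c)"
      using W' that(4,5) by (intro vec.sum_representation_eq[symmetric]) auto
    then have "C' (A' b) = C' (\<Sum>c\<in>trace_basis W'. vec.representation (trace_basis W') (A' b) c *s c)"
      by (rule arg_cong)
    then have "C' (A' b) = (\<Sum>c\<in>trace_basis W'. vec.representation (trace_basis W') (A' b) c *s C' c)"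
      unfolding clin_sum[OF that(3)] .
    moreover have mem: "C' c \<in> vec.span (trace_basis V')" if "c \<in> trace_basis W'" for c
      using that V' W' \<open>\<And>y. y \<in> W' \<Longrightarrow> C' y \<in> V'\<close> by auto
    ultimately show ?thesis
      by (simp add: vec.representation_sum[OF V'(1)] vec.span_scale vec.representation_scale[OF V'(1)])
  qed
  have "trace_on V (\<lambda>x. C (A x)) = (\<Sum>b\<in>?B. \<Sum>c\<in>?D. ?rD (A b) c * ?rB (C c) b)"
    unfolding trace_on_basis using B(4) assms by (intro sum.cong refl entry) auto
  also have "\<dots> = (\<Sum>c\<in>?D. \<Sum>b\<in>?B. ?rB (C c) b * ?rD (A b) c)"
    by (subst sum.swap) (simp add: mult.commute)
  also have "\<dots> = trace_on W (\<lambda>y. A (C y))"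
    unfolding trace_on_basis using D(4) assms by (intro sum.cong refl entry[symmetric]) auto
  finally show ?thesis .
qed

lemma trace_on_linear:
  assumes "vec.subspace V" "\<And>x. x \<in> V \<Longrightarrow> S x \<in> V" "\<And>x. x \<in> V \<Longrightarrow> T x \<in> V"
  shows "trace_on V (\<lambda>x. c *s S x + d *s T x) = c * trace_on V S + d * trace_on V T"
proof -
  note B = trace_basis[OF assms(1)]
  have "vec.representation (trace_basis V) (c *s S b + d *s T b) b
      = c * vec.representation (trace_basis V) (S b) b + d * vec.representation (trace_basis V) (T b) b"
    if "b \<in> trace_basis V" for b
    using that B assms(2,3)
    by (subst vec.representation_add) (auto simp: vec.representation_scale intro!: vec.subspace_scale[OF assms(1)])
  then show ?thesis
    unfolding trace_on_basis by (simp add: sum.distrib sum_distrib_left)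
qed

lemma trace_on_id:
  assumes "vec.subspace V"
  shows "trace_on V (\<lambda>x. x) = of_nat (vec.dim V)"
proof -
  note B = trace_basis[OF assms]
  have "trace_on V (\<lambda>x. x) = (\<Sum>b\<in>trace_basis V. 1)"
    unfolding trace_on_basis by (rule sum.cong) (simp_all add: vec.representation_basis[OF B(1)])
  then show ?thesis
    using vec.basis_card_eq_dim[OF B(4) _ B(1)] B(2) by simp
qed

section \<open>Spinors\<close>

lemma clifford_span: "clifford N = vec.span (cprod ` {vs. set vs \<subseteq> N})"
  by (simp add: clifford_def cprod_def cv_def[abs_def] image_Collect)

lemma subspace_clifford: "vec.subspace (clifford N)"
  by (simp add: clifford_span)

lemma clifford_cprod: "set vs \<subseteq> N \<Longrightarrow> cprod vs \<in> clifford N"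
  unfolding clifford_span by (intro vec.span_base) auto

lemma clifford_cv: "v \<in> N \<Longrightarrow> cv v \<in> clifford N"
  using clifford_cprod[of "[v]" N] by simp

lemma clifford_one: "mv_one \<in> clifford N"
  using clifford_cprod[of "[]" N] by simp

lemma clifford_act:
  assumes "vec.subspace S" "\<And>v s. v \<in> N \<Longrightarrow> s \<in> S \<Longrightarrow> cv v \<odot> s \<in> S" "a \<in> clifford N" "s \<in> S"
  shows "a \<odot> s \<in> S"
proof -
  have cp: "set vs \<subseteq> N \<Longrightarrow> cprod vs \<odot> t \<in> S" if "t \<in> S" for vs t
    by (induction vs) (use that assms(2) in \<open>auto simp: cl_assoc\<close>)
  have "clifford N \<subseteq> {a. a \<odot> s \<in> S}"
    unfolding clifford_span
  proof (rule vec.span_minimal)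
    show "cprod ` {vs. set vs \<subseteq> N} \<subseteq> {a. a \<odot> s \<in> S}"
      using cp assms(4) by auto
    show "vec.subspace {a. a \<odot> s \<in> S}"
      using assms(1) by (auto simp: vec.subspace_def cl_add_left cl_scale_left)
  qed
  then show ?thesis
    using assms(3) by auto
qed

lemma clifford_mult:
  assumes "a \<in> clifford N" "b \<in> clifford N"
  shows "a \<odot> b \<in> clifford N"
proof (rule clifford_act[OF subspace_clifford _ assms])
  fix v s assume v: "v \<in> N" and s: "s \<in> clifford N"
  have "clifford N \<subseteq> {s. cv v \<odot> s \<in> clifford N}"
    unfolding clifford_span
  proof (rule vec.span_minimal)
    show "cprod ` {vs. set vs \<subseteq> N} \<subseteq> {s. cv v \<odot> s \<in> vec.span (cprod ` {vs. set vs \<subseteq> N})}"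
      using clifford_cprod[of "v # vs" N for vs] v by (auto simp: clifford_span)
    show "vec.subspace {s. cv v \<odot> s \<in> vec.span (cprod ` {vs. set vs \<subseteq> N})}"
      by (auto simp: vec.subspace_def cl_add_right cl_scale_right vec.span_zero vec.span_add vec.span_scale)
  qed
  then show "cv v \<odot> s \<in> clifford N"
    using s by auto
qed

section \<open>Construction of a spinor space\<close>

lemma clifford_bivec: "p \<in> K \<Longrightarrow> bivec p \<in> clifford (frame_space K)"
  unfolding bivec_def by (intro clifford_mult clifford_cv frame_space_mem)

lemma clifford_rotor: "set l \<subseteq> K \<Longrightarrow> rotor l c s \<in> clifford (frame_space K)"
proof (induction l)
  case Nil
  show ?case by (simp add: clifford_one)
next
  case (Cons p l)
  then show ?case
    by (auto intro!: vec.subspace_add[OF subspace_clifford] vec.subspace_scale[OF subspace_clifford]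
        clifford_mult clifford_bivec)
qed

text \<open>The vacuum vector of a Fock space. If the projection
  \<open>P - \<i> *s (bivec p \<odot> P)\<close> vanishes, \<open>P\<close> has the opposite
  eigenvalue; multiplication by \<open>fst p\<close> flips it, since this vector anticommutes with
  \<open>bivec p\<close> and commutes with the bivectors already treated.\<close>

lemma ex_joint_eigenvector:
  assumes "frame K" "set l \<subseteq> K" "distinct l"
  shows "\<exists>P\<in>clifford (frame_space K). P \<noteq> 0 \<and> (\<forall>q\<in>set l. bivec q \<odot> P = \<i> *s P)"
  using assms(2,3)
proof (induction l)
  case Nil
  then show ?case
    using clifford_one by (intro bexI[of _ mv_one]) (auto simp: mv_one_def axis_eq_0_iff)
next
  case (Cons p l)
  then obtain P where P: "P \<in> clifford (frame_space K)" "P \<noteq> 0" "\<And>q. q \<in> set l \<Longrightarrow> bivec q \<odot> P = \<i> *s P"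
    by auto
  have p: "p \<in> K" "\<And>q. q \<in> set l \<Longrightarrow> q \<in> K \<and> q \<noteq> p"
    using Cons.prems by auto
  have sq: "bivec p \<odot> (bivec p \<odot> x) = - x" for x
    by (rule bivec_square_cancel) (rule frame_bivec(4)[OF assms(1) p(1) p(1)])
  show ?case
  proof (cases "P - \<i> *s (bivec p \<odot> P) = 0")
    case False
    let ?P = "P - \<i> *s (bivec p \<odot> P)"
    have "?P \<in> clifford (frame_space K)"
      using P p by (intro vec.subspace_diff[OF subspace_clifford] vec.subspace_scale[OF subspace_clifford]
          clifford_mult clifford_bivec)
    moreover have "bivec p \<odot> ?P = \<i> *s ?P"
      by (simp add: cl_linear sq)
    moreover have "bivec q \<odot> ?P = \<i> *s ?P" if "q \<in> set l" for q
    proof -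
      have "bivec q \<odot> (bivec p \<odot> P) = bivec p \<odot> (bivec q \<odot> P)"
        using frame_bivec(3)[OF assms(1) p(1), of q] p(2)[OF that] by (metis cl_assoc)
      then show ?thesis
        using P(3)[OF that] by (simp add: cl_linear vec.scale_right_diff_distrib)
    qed
    ultimately show ?thesis
      using False by (intro bexI[of _ ?P]) auto
  next
    case True
    then have "\<i> *s (P - \<i> *s (bivec p \<odot> P)) = 0"
      by simp
    then have "bivec p \<odot> P = - (\<i> *s P)"
      by (simp add: vec_eq_iff algebra_simps eq_neg_iff_add_eq_0)
    let ?e = "cv (fst p)"
    have unit: "fst p \<bullet> fst p = 1"
      using frame_inner(1)[OF assms(1) p(1) p(1)] by simp
    have "?e \<odot> P \<in> clifford (frame_space K)"
      using P p by (intro clifford_mult clifford_cv frame_space_mem)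
    moreover have "?e \<odot> P \<noteq> 0"
      using cv_unit_cancel[OF unit, of P] P(2) by auto
    moreover have "bivec p \<odot> (?e \<odot> P) = \<i> *s (?e \<odot> P)"
    proof -
      have "bivec p \<odot> ?e = - (?e \<odot> bivec p)"
        using frame_bivec(1)[OF assms(1) p(1) p(1)] by simp
      then have "bivec p \<odot> (?e \<odot> P) = - (?e \<odot> (bivec p \<odot> P))"
        by (simp only: cl_assoc[symmetric] cl_minus_left)
      then show ?thesis
        using \<open>bivec p \<odot> P = - (\<i> *s P)\<close> by (simp add: cl_linear)
    qed
    moreover have "bivec q \<odot> (?e \<odot> P) = \<i> *s (?e \<odot> P)" if "q \<in> set l" for q
    proof -
      have "bivec q \<odot> ?e = ?e \<odot> bivec q"
        using frame_bivec(1)[OF assms(1) _ p(1), of q] p(2)[OF that] by simp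
      then have "bivec q \<odot> (?e \<odot> P) = ?e \<odot> (bivec q \<odot> P)"
        by (metis cl_assoc)
      then show ?thesis
        using P(3)[OF that] by (simp add: cl_scale_right)
    qed
    ultimately show ?thesis
      by (intro bexI[of _ "?e \<odot> P"]) auto
  qed
qed

text \<open>The Fock space over the vacuum \<open>P\<close>: each plane adds a copy shifted by its
  first vector.\<close>

fun spinor_sum :: "'n::{finite,linorder} plane list \<Rightarrow> 'n multivector \<Rightarrow> 'n multivector set" where
  "spinor_sum [] P = vec.span {P}"
| "spinor_sum (p # l) P = {x + y | x y. x \<in> spinor_sum l P \<and> y \<in> cl_mult (cv (fst p)) ` spinor_sum l P}"

lemma spinor_sum_Cons_iff:
  "z \<in> spinor_sum (p # l) P \<longleftrightarrow> (\<exists>x\<in>spinor_sum l P. \<exists>y\<in>spinor_sum l P. z = x + cv (fst p) \<odot> y)"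
  by auto

lemma linear_cl_mult: "Vector_Spaces.linear (*s) (*s) (cl_mult a)"
  by unfold_locales (simp_all add: cl_add_right cl_scale_right)

lemma subspace_cl_image: "vec.subspace S \<Longrightarrow> vec.subspace (cl_mult a ` S)"
  by (rule module_hom.subspace_image) (simp_all add: module_hom_iff_linear linear_cl_mult)

lemma subspace_spinor_sum: "vec.subspace (spinor_sum l P)"
proof (induction l)
  case (Cons p l)
  then show ?case
    by (simp add: vec.subspace_sums subspace_cl_image)
qed simp

context
  fixes K :: "'n::{finite,linorder} plane set" and P :: "'n multivector"
  assumes K: "frame K" and P: "\<And>q. q \<in> K \<Longrightarrow> bivec q \<odot> P = \<i> *s P"
begin

lemma bivec_fst:
  assumes "p \<in> K" "q \<in> K"
  shows "bivec q \<odot> (cv (fst p) \<odot> x) = (if q = p then - 1 else 1) *s (cv (fst p) \<odot> (bivec q \<odot> x))"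
  by (simp only: cl_assoc[symmetric] frame_bivec(1)[OF K assms(2,1)] cl_scale_left)

text \<open>The bivector of a plane outside the list commutes with all vectors applied to
  \<open>P\<close>, so it keeps the eigenvalue of the vacuum.\<close>

lemma spinor_sum_eigen:
  assumes "set l \<subseteq> K" "q \<in> K" "q \<notin> set l" "x \<in> spinor_sum l P"
  shows "bivec q \<odot> x = \<i> *s x"
  using assms
proof (induction l arbitrary: x)
  case Nil
  then obtain c where "x = c *s P"
    by (auto simp: vec.span_singleton)
  then show ?case
    using P[OF Nil(2)] by (simp add: cl_scale_right mult.commute)
next
  case (Cons p l)
  then obtain y z where yz: "y \<in> spinor_sum l P" "z \<in> spinor_sum l P" "x = y + cv (fst p) \<odot> z"
    by (auto simp: spinor_sum_Cons_iff simp del: spinor_sum.simps)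
  then have "bivec q \<odot> y = \<i> *s y" "bivec q \<odot> z = \<i> *s z"
    using Cons by auto
  then show ?case
    using Cons.prems yz by (auto simp: cl_add_right bivec_fst cl_scale_right vec.scale_right_distrib)
qed

lemma spinor_sum_bivec:
  assumes "set l \<subseteq> K" "q \<in> K" "x \<in> spinor_sum l P"
  shows "bivec q \<odot> x \<in> spinor_sum l P"
  using assms
proof (induction l arbitrary: x)
  case Nil
  then show ?case
    using spinor_sum_eigen[of "[]" q x] by (simp add: vec.span_scale)
next
  case (Cons p l)
  then obtain y z where yz: "y \<in> spinor_sum l P" "z \<in> spinor_sum l P" "x = y + cv (fst p) \<odot> z"
    by (auto simp: spinor_sum_Cons_iff simp del: spinor_sum.simps)
  have "bivec q \<odot> x = bivec q \<odot> y + cv (fst p) \<odot> ((if q = p then - 1 else 1) *s (bivec q \<odot> z))"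
    using Cons.prems yz by (simp add: cl_add_right bivec_fst cl_scale_right)
  moreover have "bivec q \<odot> y \<in> spinor_sum l P" "bivec q \<odot> z \<in> spinor_sum l P"
    using Cons yz by auto
  ultimately show ?case
    unfolding spinor_sum_Cons_iff using vec.subspace_scale[OF subspace_spinor_sum] by blast
qed

lemma spinor_sum_fst:
  assumes "set l \<subseteq> K" "distinct l" "q \<in> set l" "x \<in> spinor_sum l P"
  shows "cv (fst q) \<odot> x \<in> spinor_sum l P"
  using assms
proof (induction l arbitrary: x)
  case (Cons p l)
  then obtain y z where yz: "y \<in> spinor_sum l P" "z \<in> spinor_sum l P" "x = y + cv (fst p) \<odot> z"
    by (auto simp: spinor_sum_Cons_iff simp del: spinor_sum.simps)
  show ?case
  proof (cases "q = p")
    case True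
    have "fst p \<bullet> fst p = 1"
      using frame_inner(1)[OF K, of p p] Cons.prems by simp
    then have "cv (fst q) \<odot> x = - z + cv (fst p) \<odot> y"
      using True yz by (simp add: cl_add_right cv_unit_cancel)
    then show ?thesis
      unfolding spinor_sum_Cons_iff using vec.subspace_neg[OF subspace_spinor_sum] yz by blast
  next
    case False
    have "fst q \<bullet> fst p = 0"
      using frame_inner(1)[OF K, of q p] Cons.prems False by auto
    then have "cv (fst q) \<odot> (cv (fst p) \<odot> z) = - (cv (fst p) \<odot> (cv (fst q) \<odot> z))"
      by (simp only: cl_assoc[symmetric] cv_anticommute[of "fst q" "fst p"] cl_minus_left)
    then have "cv (fst q) \<odot> x = cv (fst q) \<odot> y + cv (fst p) \<odot> (- (cv (fst q) \<odot> z))"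
      using yz by (simp add: cl_add_right cl_minus_right)
    moreover have "cv (fst q) \<odot> y \<in> spinor_sum l P" "cv (fst q) \<odot> z \<in> spinor_sum l P"
      using Cons yz False by auto
    ultimately show ?thesis
      unfolding spinor_sum_Cons_iff using vec.subspace_neg[OF subspace_spinor_sum] by blast
  qed
qed simp

text \<open>The second vector of a plane is minus the first vector times the bivector, and both of
  these preserve the space.\<close>

lemma spinor_sum_snd:
  assumes "set l \<subseteq> K" "distinct l" "q \<in> set l" "x \<in> spinor_sum l P"
  shows "cv (snd q) \<odot> x \<in> spinor_sum l P"
proof -
  have q: "q \<in> K"
    using assms by auto
  have "cv (fst q) \<odot> (bivec q \<odot> x) = - (cv (snd q) \<odot> x)"
    using frame_inner(1)[OF K q q] by (simp add: bivec_def cl_assoc cv_unit_cancel)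
  then have "cv (snd q) \<odot> x = - (cv (fst q) \<odot> (bivec q \<odot> x))"
    by simp
  then show ?thesis
    using assms q by (simp add: vec.subspace_neg[OF subspace_spinor_sum] spinor_sum_fst spinor_sum_bivec)
qed

text \<open>Each doubling is direct: \<open>bivec p\<close> acts by \<open>\<i>\<close> on the space
  built so far and by \<open>- \<i>\<close> on its image under \<open>fst p\<close>.\<close>

lemma dim_spinor_sum:
  assumes "P \<noteq> 0" "set l \<subseteq> K" "distinct l"
  shows "vec.dim (spinor_sum l P) = 2 ^ length l"
  using assms(2,3)
proof (induction l)
  case Nil
  then show ?case
    using assms(1) by (simp add: vec.dim_span_eq_card_independent vec.independent_insert)
next
  case (Cons p l)
  let ?S = "spinor_sum l P" and ?T = "cl_mult (cv (fst p)) ` spinor_sum l P"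
  have p: "p \<in> K" "p \<notin> set l" "set l \<subseteq> K" "distinct l"
    using Cons.prems by auto
  have unit: "fst p \<bullet> fst p = 1"
    using frame_inner(1)[OF K p(1) p(1)] by simp
  have "inj (cl_mult (cv (fst p)))"
    by (rule injI) (metis cv_unit_cancel[OF unit] minus_equation_iff)
  then have "inj_on (cl_mult (cv (fst p))) (vec.span ?S)"
    by (rule inj_on_subset) simp
  then have "vec.dim ?T = vec.dim ?S"
    by (rule vec.dim_image_eq[OF linear_cl_mult])
  moreover have "?S \<inter> ?T = {0}"
  proof -
    have "z = 0" if z: "z \<in> ?S" "z = cv (fst p) \<odot> y" "y \<in> ?S" for z y
    proof -
      have "bivec p \<odot> z = \<i> *s z" "bivec p \<odot> y = \<i> *s y"
        using spinor_sum_eigen[OF p(3,1,2)] z by auto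
      then have "\<i> *s z = - (\<i> *s z)"
        using bivec_fst[OF p(1) p(1), of y] z(2) by (simp add: cl_scale_right)
      then show ?thesis
        by (simp add: vec_eq_iff)
    qed
    then show ?thesis
      using vec.subspace_0[OF subspace_spinor_sum[of l P]] vec.subspace_0[OF subspace_cl_image[OF subspace_spinor_sum[of l P]], of "cv (fst p)"]
      by blast
  qed
  ultimately show ?case
    using vec.dim_sums_Int[OF subspace_spinor_sum[of l P] subspace_cl_image[OF subspace_spinor_sum[of l P]], of "cv (fst p)"]
      Cons.IH p by simp
qed

lemma spinor_sum_clifford:
  assumes "P \<in> clifford (frame_space K)" "set l \<subseteq> K"
  shows "spinor_sum l P \<subseteq> clifford (frame_space K)"
  using assms(2)
proof (induction l)
  case Nil
  then show ?case
    using assms(1) by (simp add: vec.span_minimal subspace_clifford)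
next
  case (Cons p l)
  then show ?case
    by (auto intro!: vec.subspace_add[OF subspace_clifford] clifford_mult clifford_cv frame_space_mem)
qed

end

text \<open>The Fock space shows that a candidate exists; from here on the chosen
  \<open>spinors N\<close> is known solely through these properties.\<close>

lemma spinors_frame:
  assumes "frame (set l)" "distinct l"
  defines "N \<equiv> frame_space (set l)"
  shows "vec.subspace (spinors N)" "spinors N \<subseteq> clifford N"
    "\<And>a s. a \<in> clifford N \<Longrightarrow> s \<in> spinors N \<Longrightarrow> a \<odot> s \<in> spinors N"
    "vec.dim (spinors N) = 2 ^ length l"
proof -
  obtain P where P: "P \<in> clifford N" "P \<noteq> 0" "\<And>q. q \<in> set l \<Longrightarrow> bivec q \<odot> P = \<i> *s P"
    using ex_joint_eigenvector[OF assms(1) subset_refl assms(2)] by (auto simp: N_def)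
  let ?S = "spinor_sum l P"
  have act: "cv v \<odot> s \<in> ?S" if "v \<in> N" "s \<in> ?S" for v s
  proof -
    have "N \<subseteq> {v. cv v \<odot> s \<in> ?S}"
      unfolding N_def
    proof (rule frame_space_subset)
      show "subspace {v. cv v \<odot> s \<in> ?S}"
        using vec.subspace_0[OF subspace_spinor_sum[of l P]] vec.subspace_add[OF subspace_spinor_sum[of l P]]
          vec.subspace_scale[OF subspace_spinor_sum[of l P]]
        by (auto simp: subspace_def cv_add cv_scale cl_add_left cl_scale_left)
    qed (use spinor_sum_fst[OF assms(1) P(3)] spinor_sum_snd[OF assms(1) P(3)] assms(2) that(2) in auto)
    then show ?thesis
      using that by auto
  qed
  have "vec.subspace ?S \<and> ?S \<subseteq> clifford N \<and> (\<forall>a\<in>clifford N. \<forall>s\<in>?S. a \<odot> s \<in> ?S)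
      \<and> vec.dim ?S = 2 ^ (dim N div 2)"
    using subspace_spinor_sum spinor_sum_clifford[OF assms(1) P(3), of l] P(1)
      clifford_act[OF subspace_spinor_sum act] dim_spinor_sum[OF assms(1) P(3,2), of l] assms(2)
    by (auto simp: N_def dim_frame_space[OF assms(1,2)])
  then have "vec.subspace (spinors N) \<and> spinors N \<subseteq> clifford N \<and> (\<forall>a\<in>clifford N. \<forall>s\<in>spinors N. a \<odot> s \<in> spinors N)
      \<and> vec.dim (spinors N) = 2 ^ (dim N div 2)"
    unfolding spinors_def by (rule someI)
  then show "vec.subspace (spinors N)" "spinors N \<subseteq> clifford N"
    "\<And>a s. a \<in> clifford N \<Longrightarrow> s \<in> spinors N \<Longrightarrow> a \<odot> s \<in> spinors N"
    "vec.dim (spinors N) = 2 ^ length l"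
    by (auto simp: N_def dim_frame_space[OF assms(1,2)])
qed

text \<open>Conjugation by the first vector of a plane changes the sign of its bivector, so only the
  scalar part of a rotor contributes to the trace.\<close>

lemma trace_rotor:
  assumes "vec.subspace S" "\<And>a s. a \<in> clifford (frame_space K) \<Longrightarrow> s \<in> S \<Longrightarrow> a \<odot> s \<in> S"
    and "frame K" "set l \<subseteq> K" "distinct l"
  shows "trace_on S (cl_mult (rotor l c s)) = of_nat (vec.dim S) * (\<Prod>p\<in>set l. c p)"
  using assms(4,5)
proof (induction l)
  case Nil
  then show ?case
    using trace_on_id[OF assms(1)] by simp
next
  case (Cons p l)
  let ?A = "rotor l c s" and ?b = "bivec p" and ?e = "cv (fst p)"
  have p: "p \<in> K" "\<And>q. q \<in> set l \<Longrightarrow> q \<in> K \<and> q \<noteq> p"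
    using Cons.prems by auto
  have A: "?A \<in> clifford (frame_space K)" and e: "?e \<in> clifford (frame_space K)"
    and b: "?b \<in> clifford (frame_space K)"
    using Cons.prems by (auto intro: clifford_rotor clifford_cv frame_space_mem clifford_bivec)
  have bA: "?b \<odot> ?A \<in> clifford (frame_space K)"
    using A b by (rule clifford_mult[rotated])
  have ebA: "?e \<odot> (?b \<odot> ?A) \<in> clifford (frame_space K)"
    using e bA by (rule clifford_mult)
  have eA: "?e \<odot> ?A = ?A \<odot> ?e"
    by (rule rotor_commute) (use p frame_bivec(1)[OF assms(3) _ p(1)] in auto)
  have be: "?b \<odot> ?e = - (?e \<odot> ?b)"
    using frame_bivec(1)[OF assms(3) p(1) p(1)] by simp
  have cancel: "?e \<odot> (?e \<odot> x) = - x" for x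
    by (rule cv_unit_cancel) (use frame_inner(1)[OF assms(3) p(1) p(1)] in simp)
  \<comment> \<open>One order of the two factors gives minus the trace of
    \<open>?b \<odot> ?A\<close>, the other gives the trace itself.\<close>
  have "trace_on S (\<lambda>x. ?e \<odot> ((?e \<odot> (?b \<odot> ?A)) \<odot> x)) = trace_on S (\<lambda>x. (?e \<odot> (?b \<odot> ?A)) \<odot> (?e \<odot> x))"
    by (rule trace_on_comm[OF assms(1,1) clin_cl_mult clin_cl_mult]) (use assms(2) e ebA in auto)
  moreover have "?e \<odot> ((?e \<odot> (?b \<odot> ?A)) \<odot> x) = - 1 *s ((?b \<odot> ?A) \<odot> x) + 0 *s x" for x
    by (simp add: cl_assoc cancel)
  moreover have "(?e \<odot> (?b \<odot> ?A)) \<odot> (?e \<odot> x) = (?b \<odot> ?A) \<odot> x" for x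
  proof -
    have "(?e \<odot> (?b \<odot> ?A)) \<odot> (?e \<odot> x) = ?e \<odot> (?b \<odot> ((?A \<odot> ?e) \<odot> x))"
      by (simp only: cl_assoc)
    also have "\<dots> = ?e \<odot> ((?b \<odot> ?e) \<odot> (?A \<odot> x))"
      by (simp only: cl_assoc eA[symmetric])
    also have "\<dots> = (?b \<odot> ?A) \<odot> x"
      by (simp only: be cl_minus_left cl_minus_right cl_assoc cancel minus_minus)
    finally show ?thesis .
  qed
  ultimately have "- 1 * trace_on S (cl_mult (?b \<odot> ?A)) + 0 * trace_on S (\<lambda>x. x) = trace_on S (cl_mult (?b \<odot> ?A))"
    using trace_on_linear[OF assms(1), of "cl_mult (?b \<odot> ?A)" "\<lambda>x. x" "- 1" 0] assms(2)[OF bA] by simp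
  then have zero: "trace_on S (cl_mult (?b \<odot> ?A)) = 0"
    by simp
  have "cl_mult (rotor (p # l) c s) = (\<lambda>x. c p *s (?A \<odot> x) + s p *s ((?b \<odot> ?A) \<odot> x))"
    by (rule ext) (simp add: cl_linear)
  then have "trace_on S (cl_mult (rotor (p # l) c s))
      = c p * trace_on S (cl_mult ?A) + s p * trace_on S (cl_mult (?b \<odot> ?A))"
    using trace_on_linear[OF assms(1), of "cl_mult ?A" "cl_mult (?b \<odot> ?A)"] assms(2)[OF A] assms(2)[OF bA] by simp
  then show ?case
    using Cons zero by simp
qed

section \<open>Spinor trace and supertrace of a rotor\<close>

lemma rotor_scalar: "rotor l (\<lambda>p. c p) (\<lambda>p. 0) = (\<Prod>p\<leftarrow>l. c p) *s mv_one"
  by (induction l) simp_all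

lemma rotor_volume: "rotor l (\<lambda>p. 0) (\<lambda>p. 1) = cprod (flat l)"
proof (induction l)
  case (Cons p l)
  then show ?case
    unfolding cprod_flat_Cons by simp
qed simp

lemma prod_set_scale:
  assumes "distinct l"
  shows "(a :: complex) ^ length l * (\<Prod>p\<in>set l. f p) = (\<Prod>p\<in>set l. a * f p)"
  using assms by (simp add: prod.distrib distinct_card)

lemma spin_Tr_rotor:
  assumes "frame (set l)" "distinct l"
  shows "spin_Tr (frame_space (set l)) (spin_rotor l \<theta>) = (\<Prod>p\<in>set l. cexpi (- \<theta> p / 2) + cexpi (\<theta> p / 2))"
proof -
  have "spin_Tr (frame_space (set l)) (spin_rotor l \<theta>) = 2 ^ length l * (\<Prod>p\<in>set l. cos (\<theta> p / 2))"
    unfolding spin_Tr_def spin_rotor_def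
    using trace_rotor[OF spinors_frame(1)[OF assms] spinors_frame(3)[OF assms] assms(1) subset_refl assms(2)]
    by (simp add: spinors_frame(4)[OF assms])
  also have "\<dots> = (\<Prod>p\<in>set l. cexpi (- \<theta> p / 2) + cexpi (\<theta> p / 2))"
    unfolding prod_set_scale[OF assms(2)] by (rule prod.cong) (simp_all add: cos_exp_eq cexpi_def)
  finally show ?thesis .
qed

text \<open>The supertrace is the trace of \<open>g \<odot> \<Gamma>\<close>. The chirality element
  is a multiple of a rotor with all cosines zero, so the product has scalar coefficients
  \<open>- sin (\<theta> p / 2)\<close>, and \<open>- 2 * \<i> * sin (\<theta> p / 2)\<close> is the
  required difference of exponentials.\<close>

lemma spin_Str_rotor:
  assumes "frame (set l)" "distinct l" "\<sigma> * \<sigma> = 1"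
  shows "spin_Str (frame_space (set l)) (\<sigma> *s cprod (flat l)) (spin_rotor l \<theta>)
    = \<sigma> * (\<Prod>p\<in>set l. cexpi (- \<theta> p / 2) - cexpi (\<theta> p / 2))"
proof -
  define N where "N = frame_space (set l)"
  define S where "S = spinors N"
  define \<Gamma> where "\<Gamma> = chirality N (\<sigma> *s cprod (flat l))"
  define g where "g = spin_rotor l \<theta>"
  have S: "vec.subspace S" "\<And>a s. a \<in> clifford N \<Longrightarrow> s \<in> S \<Longrightarrow> a \<odot> s \<in> S" "vec.dim S = 2 ^ length l"
    using spinors_frame[OF assms(1,2)] by (auto simp: S_def N_def)
  have \<Gamma>_rotor: "\<Gamma> = (\<i> ^ length l * \<sigma>) *s rotor l (\<lambda>p. 0) (\<lambda>p. 1)"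
    by (simp add: \<Gamma>_def chirality_def rotor_volume N_def dim_frame_space[OF assms(1,2)])
  have gN: "g \<in> clifford N" and \<Gamma>N: "\<Gamma> \<in> clifford N"
    unfolding g_def spin_rotor_def \<Gamma>_rotor N_def
    by (auto intro: vec.subspace_scale[OF subspace_clifford] clifford_rotor)
  have "\<Gamma> \<odot> \<Gamma> = (\<i> ^ length l * \<sigma>) *s ((\<i> ^ length l * \<sigma>) *s ((- 1) ^ length l *s mv_one))"
    unfolding \<Gamma>_rotor by (simp add: cl_linear rotor_mult[OF assms(1,2)] rotor_scalar map_replicate_const)
  also have "\<dots> = ((\<sigma> * \<sigma>) * (\<i> * \<i> * (- 1)) ^ length l) *s mv_one"
    unfolding vec.scale_scale power_mult_distrib by (simp only: mult_ac)
  finally have \<Gamma>\<Gamma>: "\<Gamma> \<odot> \<Gamma> = mv_one"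
    by (simp add: assms(3))
  have comm: "\<Gamma> \<odot> g = g \<odot> \<Gamma>"
    unfolding g_def spin_rotor_def \<Gamma>_rotor cl_scale_left cl_scale_right rotor_mult[OF assms(1,2)]
    by (simp add: mult.commute)
  \<comment> \<open>The projection onto the eigenspace is
    \<open>(1 / 2) *s (mv_one + r *s \<Gamma>)\<close>; composed with the inclusion it turns the
    trace on the eigenspace into one on \<open>S\<close>.\<close>
  have half: "trace_on {s \<in> S. \<Gamma> \<odot> s = r *s s} (cl_mult g)
      = (1 / 2) * trace_on S (cl_mult g) + (r / 2) * trace_on S (cl_mult (g \<odot> \<Gamma>))"
    if r: "r * r = 1" for r
  proof -
    let ?V = "{s \<in> S. \<Gamma> \<odot> s = r *s s}"
    let ?\<pi> = "(1 / 2) *s (mv_one + r *s \<Gamma>)"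
    have V: "vec.subspace ?V"
      using S(1) by (auto simp: vec.subspace_def cl_add_right cl_scale_right vec.scale_right_distrib mult.commute)
    have expand: "(g \<odot> ?\<pi>) \<odot> x = (1 / 2) *s (g \<odot> x) + (r / 2) *s ((g \<odot> \<Gamma>) \<odot> x)" for x
      by (simp add: cl_linear vec.scale_right_distrib cl_assoc)
    have rr: "r * (r * z) = z" for z
      using r by (simp flip: mult.assoc)
    have eig: "\<Gamma> \<odot> ((g \<odot> ?\<pi>) \<odot> x) = r *s ((g \<odot> ?\<pi>) \<odot> x)" for x
    proof -
      have "\<Gamma> \<odot> (g \<odot> x) = (g \<odot> \<Gamma>) \<odot> x"
        by (simp only: comm flip: cl_assoc)
      moreover have "\<Gamma> \<odot> ((g \<odot> \<Gamma>) \<odot> x) = g \<odot> x"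
        by (metis comm \<Gamma>\<Gamma> cl_assoc cl_one(2))
      ultimately show ?thesis
        unfolding expand by (simp add: cl_linear) (simp add: vec_eq_iff field_simps rr r)
    qed
    have "trace_on S (\<lambda>x. (\<lambda>y. y) ((g \<odot> ?\<pi>) \<odot> x)) = trace_on ?V (\<lambda>y. (g \<odot> ?\<pi>) \<odot> ((\<lambda>y. y) y))"
    proof (rule trace_on_comm[OF S(1) V clin_cl_mult clin_id])
      fix x assume x: "x \<in> S"
      have "(g \<odot> ?\<pi>) \<odot> x \<in> S"
        using S x gN clifford_mult[OF gN \<Gamma>N] unfolding expand
        by (intro vec.subspace_add[OF S(1)] vec.subspace_scale[OF S(1)]) auto
      then show "(g \<odot> ?\<pi>) \<odot> x \<in> ?V"
        using eig by simp
    qed auto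
    moreover have "trace_on ?V (\<lambda>y. (g \<odot> ?\<pi>) \<odot> y) = trace_on ?V (cl_mult g)"
    proof (rule trace_on_cong[OF V])
      fix y assume "y \<in> ?V"
      then have "(g \<odot> \<Gamma>) \<odot> y = r *s (g \<odot> y)"
        by (simp add: cl_assoc cl_scale_right)
      then show "(g \<odot> ?\<pi>) \<odot> y = g \<odot> y"
        unfolding expand by (simp add: r) (simp add: vec_eq_iff)
    qed
    moreover have "trace_on S (\<lambda>x. (g \<odot> ?\<pi>) \<odot> x) = (1 / 2) * trace_on S (cl_mult g) + (r / 2) * trace_on S (cl_mult (g \<odot> \<Gamma>))"
      unfolding expand by (rule trace_on_linear[OF S(1)]) (use S gN clifford_mult[OF gN \<Gamma>N] in auto)
    ultimately show ?thesis
      by simp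
  qed
  have plus: "trace_on {s \<in> S. \<Gamma> \<odot> s = s} (cl_mult g) = trace_on S (cl_mult g) / 2 + trace_on S (cl_mult (g \<odot> \<Gamma>)) / 2"
    and minus: "trace_on {s \<in> S. \<Gamma> \<odot> s = - s} (cl_mult g) = trace_on S (cl_mult g) / 2 - trace_on S (cl_mult (g \<odot> \<Gamma>)) / 2"
    using half[of 1] half[of "- 1"] by simp_all
  have "spin_Str N (\<sigma> *s cprod (flat l)) g = trace_on S (cl_mult (g \<odot> \<Gamma>))"
    unfolding spin_Str_def spinors_plus_def spinors_minus_def S_def[symmetric] \<Gamma>_def[symmetric]
    unfolding plus minus by (simp add: field_simps)
  also have "g \<odot> \<Gamma> = (\<i> ^ length l * \<sigma>) *s rotor l (\<lambda>p. - sin (\<theta> p / 2)) (\<lambda>p. cos (\<theta> p / 2))"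
    unfolding \<Gamma>_rotor g_def spin_rotor_def cl_scale_right rotor_mult[OF assms(1,2)] by simp
  also have "trace_on S (cl_mult ((\<i> ^ length l * \<sigma>) *s rotor l (\<lambda>p. - sin (\<theta> p / 2)) (\<lambda>p. cos (\<theta> p / 2))))
      = (\<i> ^ length l * \<sigma>) * trace_on S (cl_mult (rotor l (\<lambda>p. - sin (\<theta> p / 2)) (\<lambda>p. cos (\<theta> p / 2))))"
  proof -
    let ?r = "rotor l (\<lambda>p. - sin (\<theta> p / 2)) (\<lambda>p. cos (\<theta> p / 2))"
    have "cl_mult ((\<i> ^ length l * \<sigma>) *s ?r) = (\<lambda>x. (\<i> ^ length l * \<sigma>) *s (?r \<odot> x) + 0 *s (?r \<odot> x))"
      by (rule ext) (simp add: cl_scale_left)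
    moreover have "?r \<in> clifford N"
      unfolding N_def by (simp add: clifford_rotor)
    ultimately show ?thesis
      using trace_on_linear[OF S(1), of "cl_mult ?r" "cl_mult ?r" "\<i> ^ length l * \<sigma>" 0] S(2) by simp
  qed
  also have "trace_on S (cl_mult (rotor l (\<lambda>p. - sin (\<theta> p / 2)) (\<lambda>p. cos (\<theta> p / 2))))
      = 2 ^ length l * (\<Prod>p\<in>set l. - sin (\<theta> p / 2))"
    using trace_rotor[OF S(1) S(2)[unfolded N_def] assms(1) subset_refl assms(2)] by (simp add: S(3))
  also have "(\<i> ^ length l * \<sigma>) * (2 ^ length l * (\<Prod>p\<in>set l. - sin (\<theta> p / 2)))
      = \<sigma> * ((2 * \<i>) ^ length l * (\<Prod>p\<in>set l. - sin (\<theta> p / 2)))"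
    by (simp add: power_mult_distrib)
  also have "\<dots> = \<sigma> * (\<Prod>p\<in>set l. cexpi (- \<theta> p / 2) - cexpi (\<theta> p / 2))"
    unfolding prod_set_scale[OF assms(2)] by (simp add: sin_exp_eq cexpi_def)
  finally show ?thesis
    by (simp add: N_def g_def)
qed

section \<open>The orientation defined by a spin lift\<close>

lemma orientation_ratio_scale:
  fixes W :: "'n::{finite,linorder} multivector"
  assumes "W \<noteq> 0" "r \<noteq> 0" "\<sigma> = 1 \<or> \<sigma> = - 1"
  shows "orientation_ratio (of_real r *s W) (of_real \<sigma> *s W) = sgn r * \<sigma>"
proof -
  have "(\<exists>c>0. of_real r *s W = c *\<^sub>R (of_real \<sigma> *s W)) \<longleftrightarrow> (\<exists>c>0. r = c * \<sigma>)"
  proof -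
    have "c *\<^sub>R (of_real \<sigma> *s W) = of_real (c * \<sigma>) *s W" for c :: real
      by (simp add: vec_eq_iff) (simp add: scaleR_conv_of_real)
    moreover have "of_real r *s W = of_real t *s W \<longleftrightarrow> r = t" for t :: real
      using assms(1) by auto
    ultimately show ?thesis
      by (simp only:)
  qed
  also have "\<dots> \<longleftrightarrow> r * \<sigma> > 0"
  proof
    show "\<exists>c>0. r = c * \<sigma>" if "r * \<sigma> > 0"
      using that assms(3) by (intro exI[of _ "r * \<sigma>"]) auto
  qed (use assms(3) in auto)
  finally show ?thesis
    using assms(2,3) unfolding orientation_ratio_def by (auto simp: sgn_if)
qed

text \<open>The top coefficient of the spin lift is the product of the sines of the half angles. A
  full turn in one plane, invisible in \<open>SO(N)\<close>, therefore changes the sign.\<close>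

lemma Os_frame:
  assumes "frame (set l)" "distinct l" "\<sigma> = 1 \<or> \<sigma> = - 1" "\<And>p. p \<in> set l \<Longrightarrow> sin (a p / 2) \<noteq> 0"
  shows "Os (frame_space (set l)) (rskew (set l) a) (of_real \<sigma> *s cprod (flat l))
    = sgn (\<Prod>p\<in>set l. sin (a p / 2)) * \<sigma>"
proof -
  have "prod_list (map (\<lambda>p. sin (complex_of_real (a p) / 2)) l) = (\<Prod>p\<in>set l. sin (complex_of_real (a p) / 2))"
    using assms(2) by (rule prod.distinct_set_conv_list[symmetric])
  also have "\<dots> = of_real (\<Prod>p\<in>set l. sin (a p / 2))"
    by (simp add: sin_of_real[symmetric])
  finally have "top_degree (frame_space (set l)) (spin_exp (cmat (rskew (set l) a)))
      = of_real (\<Prod>p\<in>set l. sin (a p / 2)) *s cprod (flat l)"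
    unfolding cmat_rskew spin_exp_skew[OF assms(1,2)] spin_rotor_def
    by (simp add: top_degree_rotor[OF assms(1,2)])
  then show ?thesis
    unfolding Os_def using assms(3,4) cprod_nonzero[OF orthonormal_flat[OF assms(1,2)]]
    by (simp only:) (rule orientation_ratio_scale, auto)
qed

section \<open>Normal forms of commuting rotations\<close>

lemma skew_inner:
  fixes X :: "'n::finite rmatrix"
  assumes "transpose X = - X"
  shows "x \<bullet> (X *v y) = - ((X *v x) \<bullet> y)"
proof -
  have "x \<bullet> (X *v y) = (transpose X *v x) \<bullet> y"
    by (simp add: dot_lmul_matrix transpose_matrix_vector)
  also have "transpose X *v x = - (X *v x)"
    unfolding assms by (simp add: vec_eq_iff matrix_vector_mult_def sum_negf)
  finally show ?thesis
    by simp
qed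

text \<open>The quadratic form is maximised on the unit sphere of \<open>V\<close>. If the residual
  \<open>d = A *v v - l *\<^sub>R v\<close> were nonzero, moving from \<open>v\<close> towards
  \<open>d\<close> would increase the Rayleigh quotient to first order.\<close>

lemma symmetric_eigenvector:
  fixes A :: "'n::finite rmatrix"
  assumes V: "subspace V" "V \<noteq> {0}" "\<And>v. v \<in> V \<Longrightarrow> A *v v \<in> V"
    and sym: "\<And>x y. x \<in> V \<Longrightarrow> y \<in> V \<Longrightarrow> x \<bullet> (A *v y) = (A *v x) \<bullet> y"
  obtains v l where "v \<in> V" "v \<bullet> v = 1" "A *v v = l *\<^sub>R v"
proof -
  let ?S = "V \<inter> sphere 0 1"
  have "compact ?S"
    by (intro closed_Int_compact closed_subspace V compact_sphere)
  moreover have "?S \<noteq> {}"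
  proof -
    obtain w where "w \<in> V" "w \<noteq> 0"
      using V subspace_0[OF V(1)] by auto
    then have "(1 / norm w) *\<^sub>R w \<in> ?S"
      using V(1) by (auto simp: subspace_mul)
    then show ?thesis by blast
  qed
  moreover have "continuous_on ?S (\<lambda>v. v \<bullet> (A *v v))"
    by (intro continuous_intros matrix_vector_mult_linear_continuous_on)
  ultimately obtain v where v: "v \<in> ?S" and max: "\<And>w. w \<in> ?S \<Longrightarrow> w \<bullet> (A *v w) \<le> v \<bullet> (A *v v)"
    using continuous_attains_sup[of ?S "\<lambda>v. v \<bullet> (A *v v)"] by blast
  have vV: "v \<in> V" and vv: "v \<bullet> v = 1"
    using v by (auto simp: norm_eq_1)
  define l where "l = v \<bullet> (A *v v)"
  have bound: "w \<bullet> (A *v w) \<le> l * (w \<bullet> w)" if "w \<in> V" for w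
  proof (cases "w = 0")
    case False
    let ?u = "(1 / norm w) *\<^sub>R w"
    have "?u \<in> ?S"
      using V(1) that False by (auto simp: subspace_mul)
    from max[OF this] have "(1 / norm w) * ((1 / norm w) * (w \<bullet> (A *v w))) \<le> l"
      by (simp add: l_def matrix_vector_mult_scaleR)
    then have "w \<bullet> (A *v w) \<le> l * (norm w * norm w)"
      using False by (simp add: field_simps)
    then show ?thesis
      by (simp add: dot_square_norm power2_eq_square)
  qed simp
  define d where "d = A *v v - l *\<^sub>R v"
  have dV: "d \<in> V"
    using V vV by (simp add: d_def subspace_diff subspace_mul)
  have vd: "v \<bullet> d = 0"
    by (simp add: d_def inner_diff_right vv l_def)
  have dAv: "d \<bullet> (A *v v) = d \<bullet> d"
    using vd by (simp add: d_def inner_diff_right inner_commute)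
  have quad: "2 * t * (d \<bullet> d) + t * t * (d \<bullet> (A *v d) - l * (d \<bullet> d)) \<le> 0" for t
  proof -
    have "(v + t *\<^sub>R d) \<bullet> (A *v (v + t *\<^sub>R d)) \<le> l * ((v + t *\<^sub>R d) \<bullet> (v + t *\<^sub>R d))"
      by (rule bound) (use V vV dV in \<open>simp add: subspace_add subspace_mul\<close>)
    moreover have "v \<bullet> (A *v d) = d \<bullet> d"
      using sym[OF vV dV] dAv by (simp add: inner_commute)
    ultimately show ?thesis
      using vd vv dAv
      by (simp add: matrix_vector_right_distrib matrix_vector_mult_scaleR inner_add_left inner_add_right
          inner_commute l_def[symmetric] algebra_simps)
  qed
  have "d \<bullet> d \<le> 0"
  proof (rule ccontr)
    assume "\<not> d \<bullet> d \<le> 0"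
    then have pos: "d \<bullet> d > 0" by linarith
    \<comment> \<open>\<open>c\<close> is positive and bounds the quadratic coefficient. With the
      step size \<open>(d \<bullet> d) / c\<close> the quadratic term costs at most
      \<open>d \<bullet> d\<close>, half of the linear gain.\<close>
    define c where "c = \<bar>d \<bullet> (A *v d) - l * (d \<bullet> d)\<bar> + 1"
    define t where "t = (d \<bullet> d) / c"
    have c: "c > 0"
      by (simp add: c_def)
    then have t: "t > 0"
      unfolding t_def by (intro divide_pos_pos pos)
    have "t * (2 * (d \<bullet> d) + t * (d \<bullet> (A *v d) - l * (d \<bullet> d))) \<le> 0"
      using quad[of t] by (simp add: algebra_simps)
    then have "2 * (d \<bullet> d) + t * (d \<bullet> (A *v d) - l * (d \<bullet> d)) \<le> 0"
      using t by (simp add: mult_le_0_iff)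
    moreover have "t * (d \<bullet> (A *v d) - l * (d \<bullet> d)) \<ge> - (t * c)"
    proof -
      have "- c \<le> d \<bullet> (A *v d) - l * (d \<bullet> d)"
        unfolding c_def by arith
      then show ?thesis
        using t mult_left_mono[of "- c" "d \<bullet> (A *v d) - l * (d \<bullet> d)" t] by simp
    qed
    moreover have "t * c = d \<bullet> d"
      using c by (simp add: t_def)
    ultimately show False
      using pos by simp
  qed
  then have "d = 0"
    using inner_ge_zero[of d] inner_eq_zero_iff[of d] by linarith
  then have "A *v v = l *\<^sub>R v"
    by (simp add: d_def)
  then show thesis
    using that vV vv by blast
qed

text \<open>An eigenspace of \<open>A\<close> is stable under the commuting map \<open>B\<close>, to
  which the case of one map applies again.\<close>

lemma common_eigenvector:
  fixes A B :: "'n::finite rmatrix"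
  assumes V: "subspace V" "V \<noteq> {0}" "\<And>v. v \<in> V \<Longrightarrow> A *v v \<in> V" "\<And>v. v \<in> V \<Longrightarrow> B *v v \<in> V"
    and sym: "\<And>x y. x \<in> V \<Longrightarrow> y \<in> V \<Longrightarrow> x \<bullet> (A *v y) = (A *v x) \<bullet> y"
      "\<And>x y. x \<in> V \<Longrightarrow> y \<in> V \<Longrightarrow> x \<bullet> (B *v y) = (B *v x) \<bullet> y"
    and comm: "A ** B = B ** A"
  obtains v l m where "v \<in> V" "v \<bullet> v = 1" "A *v v = l *\<^sub>R v" "B *v v = m *\<^sub>R v"
proof -
  obtain w l where w: "w \<in> V" "w \<bullet> w = 1" "A *v w = l *\<^sub>R w"
    using symmetric_eigenvector[OF V(1-3) sym(1)] by blast
  let ?W = "{v \<in> V. A *v v = l *\<^sub>R v}"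
  have "subspace ?W"
    using V(1) by (auto simp: subspace_def matrix_vector_right_distrib matrix_vector_mult_scaleR scaleR_right_distrib)
  moreover have "w \<in> ?W" "w \<noteq> 0"
    using w by auto
  moreover have "B *v v \<in> ?W" if "v \<in> ?W" for v
  proof -
    have "A *v (B *v v) = B *v (A *v v)"
      by (simp add: matrix_vector_mul_assoc comm)
    then show ?thesis
      using that V(4) by (simp add: matrix_vector_mult_scaleR)
  qed
  moreover have "x \<bullet> (B *v y) = (B *v x) \<bullet> y" if "x \<in> ?W" "y \<in> ?W" for x y
    using sym(2) that by simp
  ultimately obtain v m where "v \<in> ?W" "v \<bullet> v = 1" "B *v v = m *\<^sub>R v"
    using symmetric_eigenvector[of ?W B] by blast
  then show thesis
    using that by blast
qed

definition angle_of :: "'n::finite rmatrix \<Rightarrow> 'n plane \<Rightarrow> real" where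
  "angle_of X p = (X *v fst p) \<bullet> snd p"

definition rotates :: "'n::finite rmatrix \<Rightarrow> 'n plane \<Rightarrow> bool" where
  "rotates X p \<longleftrightarrow> X *v fst p = angle_of X p *\<^sub>R snd p \<and> X *v snd p = - (angle_of X p *\<^sub>R fst p)"

lemma rotatesI:
  assumes "snd p \<bullet> snd p = 1" "X *v fst p = a *\<^sub>R snd p" "X *v snd p = - (a *\<^sub>R fst p)"
  shows "rotates X p" "angle_of X p = a"
  using assms by (simp_all add: rotates_def angle_of_def)

text \<open>A common eigenvector \<open>e\<close> of the symmetric maps \<open>J\<^sup>2\<close> and \<open>J R\<close> spans, together with \<open>J e\<close>,
  a plane rotated by both \<open>J\<close> and \<open>R\<close>.\<close>

lemma ex_rotated_plane:
  fixes J R :: "'n::finite rmatrix"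
  assumes N: "subspace N" "N \<noteq> {0}" "\<And>v. v \<in> N \<Longrightarrow> J *v v \<in> N" "\<And>v. v \<in> N \<Longrightarrow> R *v v \<in> N"
    and skew: "transpose J = - J" "transpose R = - R" and comm: "J ** R = R ** J"
    and inj: "\<And>v. v \<in> N \<Longrightarrow> J *v v = 0 \<Longrightarrow> v = 0"
  obtains p where "fst p \<in> N" "snd p \<in> N" "frame {p}" "rotates J p" "rotates R p"
proof -
  have JR: "J *v (R *v x) = R *v (J *v x)" for x
    by (simp add: matrix_vector_mul_assoc comm)
  have "J ** J ** (J ** R) = J ** R ** (J ** J)"
    by (simp add: comm matrix_mul_assoc) (metis comm matrix_mul_assoc)
  moreover have "x \<bullet> ((J ** J) *v y) = ((J ** J) *v x) \<bullet> y" for x y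
    by (simp add: matrix_vector_mul_assoc[symmetric] skew_inner[OF skew(1)])
  moreover have "x \<bullet> ((J ** R) *v y) = ((J ** R) *v x) \<bullet> y" for x y
    by (simp add: matrix_vector_mul_assoc[symmetric] skew_inner[OF skew(1)] skew_inner[OF skew(2)] JR)
  moreover have "(J ** J) *v v \<in> N" "(J ** R) *v v \<in> N" if "v \<in> N" for v
    using that N by (simp_all add: matrix_vector_mul_assoc[symmetric])
  ultimately obtain e l m where e: "e \<in> N" "e \<bullet> e = 1" "(J ** J) *v e = l *\<^sub>R e" "(J ** R) *v e = m *\<^sub>R e"
    using common_eigenvector[OF N(1,2), of "J ** J" "J ** R"] by blast
  define a where "a = norm (J *v e)"
  define f where "f = (1 / a) *\<^sub>R (J *v e)"
  have a: "a > 0"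
    using inj[OF e(1)] e(2) by (auto simp: a_def)
  have JJ: "J *v (J *v e) = l *\<^sub>R e" and JRe: "J *v (R *v e) = m *\<^sub>R e"
    using e(3,4) by (simp_all add: matrix_vector_mul_assoc)
  have "l = - (a * a)"
    using skew_inner[OF skew(1), of e "J *v e"] e(2) unfolding JJ
    by (simp add: a_def dot_square_norm power2_eq_square)
  have ff: "f \<bullet> f = 1"
    using a by (simp add: f_def dot_square_norm a_def power2_eq_square)
  have ef: "e \<bullet> f = 0"
    using skew_inner[OF skew(1), of e e] by (simp add: f_def inner_commute)
  have fN: "f \<in> N"
    using N e(1) by (simp add: f_def subspace_mul)
  have Je: "J *v e = a *\<^sub>R f"
    using a by (simp add: f_def)
  have Jf: "J *v f = - (a *\<^sub>R e)"
    using a JJ \<open>l = - (a * a)\<close> by (simp add: f_def matrix_vector_mult_scaleR)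
  \<comment> \<open>The multiple of \<open>f\<close> is chosen to have the same image under
    \<open>J\<close> as \<open>R *v e\<close>; injectivity of \<open>J\<close> on \<open>N\<close>
    then identifies the two.\<close>
  have "J *v (R *v e - (- m / a) *\<^sub>R f) = 0"
    unfolding matrix_vector_mult_diff_distrib matrix_vector_mult_scaleR JRe Jf using a by simp
  moreover have "R *v e - (- m / a) *\<^sub>R f \<in> N"
    by (intro subspace_diff subspace_mul N e fN)
  ultimately have Re: "R *v e = (- m / a) *\<^sub>R f"
    using inj right_minus_eq by metis
  have Rf: "R *v f = - ((- m / a) *\<^sub>R e)"
    using a JRe by (simp add: f_def matrix_vector_mult_scaleR JR[symmetric])
  have "frame {(e, f)}"
    by (simp add: frame_def e(2) ff ef)
  then show thesis
    using that[of "(e, f)"] e(1) fN rotatesI[of "(e, f)" J a] rotatesI[of "(e, f)" R "- m / a"] ff Je Jf Re Rf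
    by simp
qed

lemma frame_insert:
  assumes "frame B" "frame {p}" "p \<notin> B"
    and "\<And>q. q \<in> B \<Longrightarrow> fst q \<bullet> fst p = 0 \<and> fst q \<bullet> snd p = 0 \<and> snd q \<bullet> fst p = 0 \<and> snd q \<bullet> snd p = 0"
  shows "frame (insert p B)"
  unfolding frame_def
proof (intro conjI ballI)
  fix r s assume rs: "r \<in> insert p B" "s \<in> insert p B"
  have B: "fst r \<bullet> fst s = (if r = s then 1 else 0)" "snd r \<bullet> snd s = (if r = s then 1 else 0)"
    "fst r \<bullet> snd s = 0" if "r \<in> B" "s \<in> B"
    using frame_inner[OF assms(1) that] by auto
  have p: "fst p \<bullet> fst p = 1" "snd p \<bullet> snd p = 1" "fst p \<bullet> snd p = 0"
    using frame_inner[OF assms(2), of p p] by auto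
  have q: "fst q \<bullet> fst p = 0" "fst q \<bullet> snd p = 0" "snd q \<bullet> fst p = 0" "snd q \<bullet> snd p = 0"
    "fst p \<bullet> fst q = 0" "snd p \<bullet> fst q = 0" "fst p \<bullet> snd q = 0" "snd p \<bullet> snd q = 0" if "q \<in> B" for q
    using assms(4)[OF that] by (metis inner_commute)+
  have cases: "(r = p \<and> s = p) \<or> (r = p \<and> s \<in> B \<and> p \<noteq> s) \<or> (r \<in> B \<and> r \<noteq> p \<and> s = p) \<or> (r \<in> B \<and> s \<in> B)"
    using rs assms(3) by blast
  show "fst r \<bullet> fst s = (if r = s then 1 else 0)" "snd r \<bullet> snd s = (if r = s then 1 else 0)"
    "fst r \<bullet> snd s = 0"
    using cases by (elim disjE conjE; simp add: B p q)+
qed (simp add: frame_finite[OF assms(1)])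

text \<open>The orthogonal complement of a rotated plane is stable because both maps are skew. As
  \<open>J\<close> stays injective there, another plane can be split off until nothing is
  left.\<close>

lemma ex_normal_form:
  fixes J R :: "'n::finite rmatrix"
  assumes "subspace N" "\<And>v. v \<in> N \<Longrightarrow> J *v v \<in> N" "\<And>v. v \<in> N \<Longrightarrow> R *v v \<in> N"
    and skew: "transpose J = - J" "transpose R = - R" and comm: "J ** R = R ** J"
    and "\<And>v. v \<in> N \<Longrightarrow> J *v v = 0 \<Longrightarrow> v = 0"
  shows "\<exists>B. frame B \<and> frame_space B = N \<and> (\<forall>p\<in>B. rotates J p \<and> rotates R p)"
  using assms(1-3,7)
proof (induction "dim N" arbitrary: N rule: less_induct)
  case less
  show ?case
  proof (cases "N = {0}")
    case True
    then show ?thesis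
      by (intro exI[of _ "{}"]) (simp add: frame_def frame_space_def)
  next
    case False
    obtain p where p: "fst p \<in> N" "snd p \<in> N" "frame {p}" "rotates J p" "rotates R p"
      using ex_rotated_plane[OF less.prems(1) False less.prems(2,3) skew comm less.prems(4)] by blast
    have inn: "fst p \<bullet> fst p = 1" "snd p \<bullet> snd p = 1" "fst p \<bullet> snd p = 0" "snd p \<bullet> fst p = 0"
      using frame_inner[OF p(3), of p p] by auto
    let ?M = "{v \<in> N. v \<bullet> fst p = 0 \<and> v \<bullet> snd p = 0}"
    have M: "subspace ?M"
      using less.prems(1) by (auto simp: subspace_def inner_add_left)
    have stable: "X *v v \<in> ?M" if "transpose X = - X" "rotates X p" "\<And>v. v \<in> N \<Longrightarrow> X *v v \<in> N" "v \<in> ?M" for X v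
    proof -
      have "(X *v v) \<bullet> fst p = - (v \<bullet> (X *v fst p))" "(X *v v) \<bullet> snd p = - (v \<bullet> (X *v snd p))"
        using skew_inner[OF that(1)] by simp_all
      then show ?thesis
        using that by (simp add: rotates_def)
    qed
    have "fst p \<notin> ?M"
      using inn by simp
    then have "?M \<subset> N"
      using p(1) by blast
    then have "dim ?M < dim N"
      using M less.prems(1) by (intro dim_psubset) (simp add: span_eq_iff[THEN iffD2])
    then have "\<exists>B. frame B \<and> frame_space B = ?M \<and> (\<forall>p\<in>B. rotates J p \<and> rotates R p)"
    proof (rule less.hyps[OF _ M])
      show "J *v v \<in> ?M" if "v \<in> ?M" for v
        using stable[OF skew(1) p(4) less.prems(2) that] .
      show "R *v v \<in> ?M" if "v \<in> ?M" for v
        using stable[OF skew(2) p(5) less.prems(3) that] .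
      show "v = 0" if "v \<in> ?M" "J *v v = 0" for v
        using less.prems(4) that by simp
    qed
    then obtain B where B: "frame B" "frame_space B = ?M" "\<And>q. q \<in> B \<Longrightarrow> rotates J q \<and> rotates R q"
      by blast
    have mem: "fst q \<in> ?M" "snd q \<in> ?M" if "q \<in> B" for q
      unfolding B(2)[symmetric] by (rule frame_space_mem[OF that])+
    have "p \<notin> B"
      using mem(1)[of p] \<open>fst p \<notin> ?M\<close> by blast
    then have "frame (insert p B)"
      by (rule frame_insert[OF B(1) p(3)]) (use mem in blast)
    moreover have "frame_space (insert p B) = N"
    proof
      show "frame_space (insert p B) \<subseteq> N"
        by (rule frame_space_subset[OF less.prems(1)]) (use p mem in auto)
      show "N \<subseteq> frame_space (insert p B)"
      proof
        fix v assume v: "v \<in> N"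
        let ?w = "v - ((v \<bullet> fst p) *\<^sub>R fst p + (v \<bullet> snd p) *\<^sub>R snd p)"
        have "?w \<in> ?M"
          using v p less.prems(1) inn
          by (simp add: subspace_diff subspace_add subspace_mul inner_diff_left inner_add_left)
        then have "?w \<in> frame_space (insert p B)"
          unfolding B(2)[symmetric] using frame_space_mono[of B "insert p B"] by blast
        moreover have "(v \<bullet> fst p) *\<^sub>R fst p + (v \<bullet> snd p) *\<^sub>R snd p \<in> frame_space (insert p B)"
          by (intro subspace_add subspace_mul subspace_frame_space frame_space_mem) simp_all
        ultimately have "?w + ((v \<bullet> fst p) *\<^sub>R fst p + (v \<bullet> snd p) *\<^sub>R snd p) \<in> frame_space (insert p B)"
          by (rule subspace_add[OF subspace_frame_space])
        then show "v \<in> frame_space (insert p B)"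
          by simp
      qed
    qed
    ultimately show ?thesis
      using B(3) p by (intro exI[of _ "insert p B"]) auto
  qed
qed

section \<open>Skew matrices in a frame\<close>

lemma plane_rot_vector: "plane_rot p *v v = (fst p \<bullet> v) *\<^sub>R snd p - (snd p \<bullet> v) *\<^sub>R fst p"
  by (simp add: vec_eq_iff matrix_vector_mult_def plane_rot_def inner_vec_def left_diff_distrib
      right_diff_distrib sum_subtractf sum_distrib_left sum_distrib_right mult_ac)

lemma rskew_vector: "rskew B a *v v = (\<Sum>p\<in>B. a p *\<^sub>R ((fst p \<bullet> v) *\<^sub>R snd p - (snd p \<bullet> v) *\<^sub>R fst p))"
proof -
  have "(\<Sum>p\<in>B. f p) *v v = (\<Sum>p\<in>B. f p *v v)" for f :: "'a plane \<Rightarrow> 'a rmatrix"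
    by (induction B rule: infinite_finite_induct) (simp_all add: matrix_vector_mult_add_rdistrib)
  then show ?thesis
    by (simp add: rskew_def scaleR_matrix_vector_assoc[symmetric] plane_rot_vector)
qed

lemma rskew_in_so: "rskew B a \<in> so (frame_space B)"
proof -
  have "transpose (rskew B a) = - rskew B a"
    by (simp add: rskew_def transpose_def vec_eq_iff sum_component plane_rot_def sum_negf[symmetric]
        algebra_simps)
  moreover have "rskew B a *v v \<in> frame_space B" for v
    unfolding rskew_vector
    by (intro subspace_sum[OF subspace_frame_space] subspace_mul[OF subspace_frame_space]
        subspace_diff[OF subspace_frame_space] frame_space_mem)
  ultimately show ?thesis
    by (simp add: so_def)
qed

lemma rskew_frame:
  assumes "frame B" "q \<in> B"
  shows "rskew B a *v fst q = a q *\<^sub>R snd q" "rskew B a *v snd q = - (a q *\<^sub>R fst q)"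
proof -
  have "rskew B a *v fst q = (\<Sum>p\<in>B. if p = q then a q *\<^sub>R snd q else 0)"
    unfolding rskew_vector by (rule sum.cong) (use assms in \<open>auto simp: frame_inner\<close>)
  then show "rskew B a *v fst q = a q *\<^sub>R snd q"
    using assms(2) frame_finite[OF assms(1)] by simp
  have "rskew B a *v snd q = (\<Sum>p\<in>B. if p = q then - (a q *\<^sub>R fst q) else 0)"
    unfolding rskew_vector by (rule sum.cong) (use assms in \<open>auto simp: frame_inner\<close>)
  then show "rskew B a *v snd q = - (a q *\<^sub>R fst q)"
    using assms(2) frame_finite[OF assms(1)] by simp
qed

text \<open>By skewness the squared length of \<open>X *v v\<close> is minus the inner product of
  \<open>v\<close> with a vector in the image of \<open>X\<close>, which lies in
  \<open>N\<close>.\<close>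

lemma so_kernel:
  assumes "X \<in> so N" "\<And>w. w \<in> N \<Longrightarrow> v \<bullet> w = 0"
  shows "X *v v = 0"
proof -
  have X: "transpose X = - X" "\<And>u. X *v u \<in> N"
    using assms(1) by (auto simp: so_def)
  have "(X *v v) \<bullet> (X *v v) = - (v \<bullet> (X *v (X *v v)))"
    by (simp add: skew_inner[OF X(1)])
  also have "\<dots> = 0"
    using assms(2) X(2) by simp
  finally show ?thesis
    by simp
qed

lemma so_eq_rskew:
  assumes "frame B" "X \<in> so (frame_space B)" "\<And>p. p \<in> B \<Longrightarrow> X *v fst p = a p *\<^sub>R snd p"
    "\<And>p. p \<in> B \<Longrightarrow> X *v snd p = - (a p *\<^sub>R fst p)"
  shows "X = rskew B a"
proof (rule matrix_eqI_vector)
  fix v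
  let ?Y = "rskew B a"
  let ?w = "frame_proj B v"
  have "frame_space B \<subseteq> {u. X *v u = ?Y *v u}"
    by (rule frame_space_subset) (use assms rskew_frame[OF assms(1)] in
      \<open>auto simp: subspace_def matrix_vector_right_distrib matrix_vector_mult_scaleR\<close>)
  then have "X *v ?w = ?Y *v ?w"
    using frame_proj_mem[of B v] by auto
  moreover have "X *v (v - ?w) = 0" "?Y *v (v - ?w) = 0"
    using so_kernel[OF assms(2)] so_kernel[OF rskew_in_so] frame_proj_orthogonal[OF assms(1)] by blast+
  ultimately show "X *v v = ?Y *v v"
    by (simp add: matrix_vector_mult_diff_distrib)
qed

section \<open>Roots of unity and divisibility by \<open>k\<close>\<close>

lemma cexpi_eq_1_iff: "cexpi (complex_of_real x) = 1 \<longleftrightarrow> (\<exists>n::int. x = 2 * pi * of_int n)"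
  unfolding cexpi_def exp_eq_1 by (simp add: mult_ac)

lemma cexpi_root_eq_1_iff:
  assumes "k > 0"
  shows "cexpi (complex_of_real (2 * pi * of_int n / of_nat k)) = 1 \<longleftrightarrow> int k dvd n"
proof -
  have "2 * pi * of_int n / real k = 2 * pi * of_int m \<longleftrightarrow> n = int k * m" for m :: int
  proof -
    have "2 * pi * of_int n / real k = 2 * pi * of_int m \<longleftrightarrow> real_of_int n = real_of_int (int k * m)"
      using assms by (simp add: field_simps)
    then show ?thesis
      by (simp only: of_int_eq_iff)
  qed
  then show ?thesis
    unfolding cexpi_eq_1_iff dvd_def by simp
qed

lemma cexpi_root_eq_iff:
  assumes "k > 0"
  shows "cexpi (complex_of_real (2 * pi * of_int n / of_nat k)) = cexpi (complex_of_real (2 * pi * of_int m / of_nat k))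
    \<longleftrightarrow> int k dvd n - m"
proof -
  have "complex_of_real (2 * pi * of_int (n - m) / of_nat k)
      = complex_of_real (2 * pi * of_int n / of_nat k) + - complex_of_real (2 * pi * of_int m / of_nat k)"
    by (simp add: diff_divide_distrib right_diff_distrib)
  then have "cexpi (complex_of_real (2 * pi * of_int (n - m) / of_nat k))
      = cexpi (complex_of_real (2 * pi * of_int n / of_nat k)) * inverse (cexpi (complex_of_real (2 * pi * of_int m / of_nat k)))"
    by (simp only: cexpi_add cexpi_minus)
  moreover have "x * inverse y = 1 \<longleftrightarrow> x = y" if "y \<noteq> 0" for x y :: complex
    using that by (simp add: field_simps)
  ultimately show ?thesis
    unfolding cexpi_root_eq_1_iff[OF assms, of "n - m", symmetric] by (simp only: cexpi_nonzero simp_thms)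
qed

lemma cexpi_root_eq_minus_1_iff:
  assumes "k > 0"
  shows "cexpi (complex_of_real (2 * pi * of_int n / of_nat k)) = - 1 \<longleftrightarrow> int k dvd 2 * n \<and> \<not> int k dvd n"
proof -
  let ?z = "cexpi (complex_of_real (2 * pi * of_int n / of_nat k))"
  have "complex_of_real (2 * pi * of_int (2 * n) / of_nat k)
      = complex_of_real (2 * pi * of_int n / of_nat k) + complex_of_real (2 * pi * of_int n / of_nat k)"
    by simp
  then have "cexpi (complex_of_real (2 * pi * of_int (2 * n) / of_nat k)) = ?z * ?z"
    by (simp only: cexpi_add)
  then have "?z * ?z = 1 \<longleftrightarrow> int k dvd 2 * n"
    using cexpi_root_eq_1_iff[OF assms, of "2 * n"] by simp
  moreover have "?z = 1 \<longleftrightarrow> int k dvd n"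
    by (rule cexpi_root_eq_1_iff[OF assms])
  moreover have "?z * ?z = 1 \<longleftrightarrow> ?z = 1 \<or> ?z = - 1"
    by (rule square_eq_1_iff)
  moreover have "(1 :: complex) \<noteq> - 1"
    by simp
  ultimately show ?thesis
    by metis
qed

section \<open>Rotations acting on vectors\<close>

lemma plane_u_sum: "cvec (fst p) = (1 / 2) *s (plane_u (p, True) + plane_u (p, False))"
  "cvec (snd p) = (\<i> / 2) *s (plane_u (p, True) - plane_u (p, False))"
  by (simp_all add: plane_u_def bsign_def vec_eq_iff algebra_simps)

lemma rotation_plane_u:
  assumes "frame B" "p \<in> B"
  shows "rotation B \<theta> *v plane_u (p, s) = cexpi (bsign s * \<theta> p) *s plane_u (p, s)"
  unfolding rotation_def using diag_id_eigen[OF biorth_plane[OF assms(1)], of "(p, s)"] assms(2) by simp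

lemma cdot_rotation:
  assumes "frame B" "p \<in> B"
  shows "cdot (plane_w (p, s)) (rotation B \<theta> *v x) = cexpi (bsign s * \<theta> p) * cdot (plane_w (p, s)) x"
  unfolding rotation_def using cdot_diag_id[OF biorth_plane[OF assms(1)], of "(p, s)"] assms(2) by simp

lemma skew_plane_u:
  assumes "frame B" "p \<in> B"
  shows "skew B \<theta> *v plane_u (p, s) = (\<i> * (bsign s * \<theta> p)) *s plane_u (p, s)"
  unfolding skew_plane_diag using diag_sum_eigen[OF biorth_plane[OF assms(1)], of "(p, s)"] assms(2) by simp

lemma cdot_skew:
  assumes "frame B" "p \<in> B"
  shows "cdot (plane_w (p, s)) (skew B \<theta> *v x) = \<i> * (bsign s * \<theta> p) * cdot (plane_w (p, s)) x"
  unfolding skew_plane_diag using cdot_diag_sum[OF biorth_plane[OF assms(1)], of "(p, s)"] assms(2) by simp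

lemma rotation_cvec:
  assumes "frame B" "p \<in> B"
  shows "rotation B \<theta> *v cvec (fst p) = cos (\<theta> p) *s cvec (fst p) + sin (\<theta> p) *s cvec (snd p)"
    "rotation B \<theta> *v cvec (snd p) = cos (\<theta> p) *s cvec (snd p) - sin (\<theta> p) *s cvec (fst p)"
proof -
  have e: "cexpi (bsign s * \<theta> p) = cos (\<theta> p) + \<i> * (bsign s * sin (\<theta> p))" for s
    using exp_Euler[of "bsign s * \<theta> p"] by (cases s) (simp_all add: cexpi_def bsign_def)
  show "rotation B \<theta> *v cvec (fst p) = cos (\<theta> p) *s cvec (fst p) + sin (\<theta> p) *s cvec (snd p)"
    "rotation B \<theta> *v cvec (snd p) = cos (\<theta> p) *s cvec (snd p) - sin (\<theta> p) *s cvec (fst p)"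
    unfolding plane_u_sum vector_scalar_commute matrix_vector_right_distrib
      matrix_vector_mult_diff_distrib rotation_plane_u[OF assms] e
    by (simp_all add: vec_eq_iff bsign_def field_simps)
qed

lemma rotation_power:
  assumes "frame B"
  shows "mat_power (rotation B \<theta>) m = rotation B (\<lambda>p. of_nat m * \<theta> p)"
proof (induction m)
  case 0
  have "diag_sum (B \<times> UNIV) plane_u plane_w (\<lambda>i. 0) = 0"
    by (simp add: vec_eq_iff diag_sum_component)
  then show ?case
    by (simp add: mat_power_0 rotation_def diag_id_def case_prod_unfold)
next
  case (Suc m)
  then show ?case
    by (simp add: mat_power_Suc rotation_mult[OF assms] algebra_simps)
qed

lemma plane_u_nonzero:
  assumes "frame B" "p \<in> B"
  shows "plane_u (p, s) \<noteq> 0"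
proof
  assume "plane_u (p, s) = 0"
  moreover have "cdot (plane_w (p, s)) (plane_u (p, s)) = 1"
    using biorth_plane[OF assms(1)] assms(2) by (simp add: biorth_def)
  ultimately show False
    by (simp add: cdot_def)
qed

lemma rotation_eq_1:
  assumes "frame B" "p \<in> B" "rotation B \<theta> = mat 1"
  shows "cexpi (\<theta> p) = 1"
proof -
  have "cexpi (\<theta> p) *s plane_u (p, True) = 1 *s plane_u (p, True)"
    using rotation_plane_u[OF assms(1,2), of \<theta> True] assms(3) by (simp add: bsign_def)
  then show ?thesis
    using plane_u_nonzero[OF assms(1,2), of True] by (metis vec.scale_right_imp_eq)
qed

lemma cdot_plane_w_cvec: "cdot (plane_w (p, s)) (cvec v) = (of_real (v \<bullet> fst p) + bsign s * \<i> * of_real (v \<bullet> snd p)) / 2"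
  by (simp add: plane_w_def cdot_scale_left cdot_add_left cdot_cvec inner_commute)

text \<open>For a real vector the single coefficient along \<open>plane_u (p, True)\<close> has, up
  to a factor, the two inner products as real and imaginary parts, so its vanishing kills
  both.\<close>

lemma rotation_real_eigenvector:
  assumes "frame B" "p \<in> B" "rotation B \<theta> *v cvec v = of_real r *s cvec v" "cexpi (\<theta> p) \<noteq> of_real r"
  shows "v \<bullet> fst p = 0 \<and> v \<bullet> snd p = 0"
proof -
  have "cexpi (\<theta> p) * cdot (plane_w (p, True)) (cvec v) = of_real r * cdot (plane_w (p, True)) (cvec v)"
    using cdot_rotation[OF assms(1,2), of True \<theta> "cvec v"] assms(3) by (auto simp: cdot_scale_right bsign_def)
  then have "cdot (plane_w (p, True)) (cvec v) = 0"
    using assms(4) by (metis mult_cancel_right)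
  then show ?thesis
    by (simp add: cdot_plane_w_cvec bsign_def complex_eq_iff)
qed

lemma frame_space_subset_mem:
  assumes "frame B" "A \<subseteq> B" "v \<in> frame_space B" "\<And>p. p \<in> B - A \<Longrightarrow> v \<bullet> fst p = 0 \<and> v \<bullet> snd p = 0"
  shows "v \<in> frame_space A"
proof -
  have "v = frame_proj B v"
    using frame_proj_id[OF assms(1,3)] by simp
  also have "\<dots> = frame_proj A v"
    unfolding frame_proj_def using assms frame_finite[OF assms(1)]
    by (intro sum.mono_neutral_right) auto
  finally show ?thesis
    using frame_proj_mem[of A v] by simp
qed

lemma frame_space_disjoint_orthogonal:
  assumes "frame B" "A \<subseteq> B" "p \<in> B - A" "w \<in> frame_space A"
  shows "fst p \<bullet> w = 0" "snd p \<bullet> w = 0"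
proof -
  have "fst p \<bullet> fst q = 0 \<and> fst p \<bullet> snd q = 0" "snd p \<bullet> fst q = 0 \<and> snd p \<bullet> snd q = 0" if "q \<in> A" for q
  proof -
    have pq: "p \<in> B" "q \<in> B" "p \<noteq> q"
      using assms(2,3) that by auto
    show "fst p \<bullet> fst q = 0 \<and> fst p \<bullet> snd q = 0" "snd p \<bullet> fst q = 0 \<and> snd p \<bullet> snd q = 0"
      using frame_inner[OF assms(1) pq(1,2)] frame_inner(4)[OF assms(1) pq(2,1)] pq(3) by simp_all
  qed
  then show "fst p \<bullet> w = 0" "snd p \<bullet> w = 0"
    using frame_space_orthogonal[of A _ w] assms(4) by blast+
qed

section \<open>Complexified frames and weights\<close>

lemma plane_u_complexification: "p \<in> B \<Longrightarrow> plane_u (p, s) \<in> complexification (frame_space B)"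
proof -
  assume p: "p \<in> B"
  have "(\<chi> i. Re (plane_u (p, s) $ i)) = fst p" "(\<chi> i. Im (plane_u (p, s) $ i)) = (if s then - 1 else 1) *\<^sub>R snd p"
    by (simp_all add: vec_eq_iff plane_u_def bsign_def)
  then show ?thesis
    using frame_space_mem[OF p] subspace_neg[OF subspace_frame_space frame_space_mem(2)[OF p]]
    by (simp add: complexification_def)
qed

lemma complexification_expand:
  assumes "frame B" "v \<in> complexification (frame_space B)"
  shows "v = (\<Sum>i\<in>B \<times> UNIV. cdot (plane_w i) v *s plane_u i)"
proof -
  define x where "x = (\<chi> i. Re (v $ i))"
  define y where "y = (\<chi> i. Im (v $ i))"
  have mem: "x \<in> frame_space B" "y \<in> frame_space B"
    using assms(2) by (auto simp: complexification_def x_def y_def)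
  have v: "v = cvec x + \<i> *s cvec y"
    by (simp add: vec_eq_iff x_def y_def complex_eq_iff)
  have "orth_proj (frame_space B) *v w = w" if "w \<in> frame_space B" for w
    using frame_proj_id[OF assms(1) that] by (simp add: orth_proj_frame[OF assms(1)] frame_proj_matrix)
  then have "cmat (orth_proj (frame_space B)) *v v = v"
    unfolding v by (simp add: matrix_vector_right_distrib vector_scalar_commute cmat_cvec mem)
  then show ?thesis
    by (simp add: cmat_orth_proj[OF assms(1)] diag_sum_vector)
qed

lemma independent_plane_u:
  assumes "frame B" "I \<subseteq> B \<times> UNIV"
  shows "vec.independent (plane_u ` I)" "inj_on plane_u I" "finite I"
proof -
  note bi = biorth_plane[OF assms(1), unfolded biorth_def]
  have w: "cdot (plane_w i) (plane_u j) = (if i = j then 1 else 0)" if "i \<in> I" "j \<in> I" for i j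
    using bi that assms(2) by blast
  show fin: "finite I"
    using bi assms(2) finite_subset by blast
  show inj: "inj_on plane_u I"
    by (rule inj_onI) (metis w zero_neq_one)
  show "vec.independent (plane_u ` I)"
  proof (rule vec.independent_if_scalars_zero)
    fix f x assume sum: "(\<Sum>x\<in>plane_u ` I. f x *s x) = 0" and "x \<in> plane_u ` I"
    then obtain j where j: "j \<in> I" "x = plane_u j"
      by auto
    have "0 = cdot (plane_w j) (\<Sum>i\<in>I. f (plane_u i) *s plane_u i)"
      using sum by (simp add: sum.reindex[OF inj] cdot_def)
    also have "\<dots> = (\<Sum>i\<in>I. if i = j then f (plane_u j) else 0)"
      unfolding cdot_sum_right by (rule sum.cong) (use w j in \<open>auto simp: cdot_scale_right\<close>)
    finally show "f x = 0"
      using fin j by simp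
  qed (simp add: fin)
qed

text \<open>The vectors \<open>plane_u\<close> of the matching weight form a basis, since a weight
  vector has no component along the others. A plane with \<open>m p = 0\<close> supplies two vectors
  of weight zero, one to each count.\<close>

lemma dim_weight_space:
  assumes "frame B"
  shows "vec.dim (weight_space (frame_space B) (rskew B (\<lambda>p. 2 * pi * of_int (m p))) c)
    = card {p \<in> B. m p = c} + card {p \<in> B. - m p = c}"
proof -
  let ?I = "{(p, s). p \<in> B \<and> (if s then m p else - m p) = c}"
  let ?W = "weight_space (frame_space B) (rskew B (\<lambda>p. 2 * pi * of_int (m p))) c"
  let ?\<theta> = "\<lambda>p. complex_of_real (2 * pi * of_int (m p))"
  have sub: "?I \<subseteq> B \<times> UNIV"
    by auto
  have eig: "\<i> * (bsign s * ?\<theta> p) = 2 * \<i> * of_real pi * of_int c \<longleftrightarrow> (if s then m p else - m p) = c" for p s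
  proof -
    have "\<i> * (bsign s * ?\<theta> p) = 2 * \<i> * of_real pi * of_int (if s then m p else - m p)"
      by (simp add: bsign_def)
    then show ?thesis
      by simp
  qed
  have "plane_u ` ?I \<subseteq> ?W"
  proof
    fix v assume "v \<in> plane_u ` ?I"
    then obtain p s where ps: "p \<in> B" "(if s then m p else - m p) = c" "v = plane_u (p, s)"
      by auto
    then show "v \<in> ?W"
      using skew_plane_u[OF assms ps(1), of ?\<theta> s] eig[of s p]
      by (simp add: weight_space_def cmat_rskew plane_u_complexification)
  qed
  moreover have "?W \<subseteq> vec.span (plane_u ` ?I)"
  proof
    fix v assume v: "v \<in> ?W"
    then have "v \<in> complexification (frame_space B)" and ev: "skew B ?\<theta> *v v = (2 * \<i> * of_real pi * of_int c) *s v"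
      by (auto simp: weight_space_def cmat_rskew)
    then have "v = (\<Sum>i\<in>B \<times> UNIV. cdot (plane_w i) v *s plane_u i)"
      using complexification_expand[OF assms] by simp
    also have "\<dots> \<in> vec.span (plane_u ` ?I)"
    proof (rule vec.span_sum)
      fix i assume i: "i \<in> B \<times> (UNIV :: bool set)"
      obtain p s where ps: "i = (p, s)" "p \<in> B"
        using i by auto
      show "cdot (plane_w i) v *s plane_u i \<in> vec.span (plane_u ` ?I)"
      proof (cases "i \<in> ?I")
        case True
        then show ?thesis
          by (intro vec.span_scale vec.span_base imageI)
      next
        case False
        then have "\<i> * (bsign s * ?\<theta> p) \<noteq> 2 * \<i> * of_real pi * of_int c"
          unfolding eig using ps by simp
        moreover have "\<i> * (bsign s * ?\<theta> p) * cdot (plane_w i) v = (2 * \<i> * of_real pi * of_int c) * cdot (plane_w i) v"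
          using cdot_skew[OF assms ps(2), of s ?\<theta> v] unfolding ev cdot_scale_right ps by auto
        ultimately have "cdot (plane_w i) v = 0"
          by (metis mult_cancel_right)
        then show ?thesis
          by (simp add: vec.span_zero)
      qed
    qed
    finally show "v \<in> vec.span (plane_u ` ?I)" .
  qed
  ultimately have "vec.dim ?W = card (plane_u ` ?I)"
    using vec.basis_card_eq_dim[OF _ _ independent_plane_u(1)[OF assms sub]] by simp
  also have "\<dots> = card ?I"
    by (rule card_image) (rule independent_plane_u(2)[OF assms sub])
  also have "?I = {p \<in> B. m p = c} \<times> {True} \<union> {p \<in> B. - m p = c} \<times> {False}"
    by (auto split: if_splits)
  also have "card \<dots> = card {p \<in> B. m p = c} + card {p \<in> B. - m p = c}"
    using frame_finite[OF assms] by (subst card_Un_disjoint) (auto simp: card_cartesian_product)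
  finally show ?thesis .
qed

section \<open>Parity of half of the weights\<close>

lemma sum_mset_abs_parity: "even (\<Sum>\<^sub># D + sum_mset (image_mset abs D))" for D :: "int multiset"
  by (induction D) (auto simp: abs_if)

text \<open>Modulo 2 a sum equals the sum of absolute values, and the latter is half of that of the
  symmetric multiset, whichever half was chosen.\<close>

lemma half_weights_parity:
  fixes D E :: "int multiset"
  assumes "D + image_mset uminus D = E + image_mset uminus E"
  shows "even (\<Sum>\<^sub># D) \<longleftrightarrow> even (\<Sum>\<^sub># E)"
proof -
  have double: "sum_mset (image_mset abs (F + image_mset uminus F)) = 2 * sum_mset (image_mset abs F)" for F :: "int multiset"
    by (simp add: image_mset.compositionality comp_def)
  have "sum_mset (image_mset abs D) = sum_mset (image_mset abs E)"
    using double[of D] double[of E] unfolding assms by simp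
  then show ?thesis
    using sum_mset_abs_parity[of D] sum_mset_abs_parity[of E] by simp
qed

lemma powi_minus_one_parity: "even a \<longleftrightarrow> even b \<Longrightarrow> (- 1 :: 'a::field) powi a = (- 1) powi b"
  by (simp add: power_int_minus_one_minus power_int_minus_left)

lemma count_image_mset_set:
  assumes "finite B"
  shows "count (image_mset f (mset_set B)) a = card {p \<in> B. f p = a}"
proof -
  have "count (image_mset f (mset_set B)) a = (\<Sum>p\<in>{p \<in> B. f p = a}. 1)"
    unfolding count_image_mset by (rule sum.cong) (use assms in auto)
  then show ?thesis
    by simp
qed

lemma eps_sign_rskew:
  assumes "frame B"
  shows "eps_sign (rskew B (\<lambda>p. 2 * pi * of_int (m p))) (frame_space B) = (- 1) powi (\<Sum>p\<in>B. m p)"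
proof -
  let ?hw = "half_weights (frame_space B) (rskew B (\<lambda>p. 2 * pi * of_int (m p)))"
  define E where "E = image_mset m (mset_set B)"
  have "count E a = card {p \<in> B. m p = a}" "count (image_mset uminus E) a = card {p \<in> B. - m p = a}" for a
    by (simp_all add: E_def image_mset.compositionality comp_def count_image_mset_set[OF frame_finite[OF assms]])
  then have count: "count (E + image_mset uminus E) a
      = vec.dim (weight_space (frame_space B) (rskew B (\<lambda>p. 2 * pi * of_int (m p))) a)" for a
    by (simp add: dim_weight_space[OF assms])
  then have "?hw E"
    by (simp add: half_weights_def)
  define D where "D = (SOME D. ?hw D)"
  have "?hw D"
    unfolding D_def by (rule someI) fact
  then have "count (D + image_mset uminus D) a = count (E + image_mset uminus E) a" for a
    unfolding half_weights_def count by blast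
  then have "D + image_mset uminus D = E + image_mset uminus E"
    by (rule multiset_eqI)
  then have "(- 1 :: real) powi (\<Sum>\<^sub># D) = (- 1) powi (\<Sum>\<^sub># E)"
    by (intro powi_minus_one_parity half_weights_parity)
  moreover have "\<Sum>\<^sub># E = (\<Sum>p\<in>B. m p)"
    by (simp add: E_def sum_unfold_sum_mset)
  ultimately show ?thesis
    unfolding eps_sign_def D_def[symmetric] by simp
qed

section \<open>The functions \<open>Z\<close> and \<open>EM\<close> of a frame\<close>

lemma real_sign_cases:
  fixes \<sigma> :: real
  assumes "\<sigma> = 1 \<or> \<sigma> = - 1"
  shows "complex_of_real \<sigma> * complex_of_real \<sigma> = 1" "inverse (complex_of_real \<sigma>) = complex_of_real \<sigma>"
  using assms by auto

lemma Z_frame: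
  assumes "Im \<tau> > 0" "frame (set l)" "distinct l" "\<sigma> = 1 \<or> \<sigma> = - 1"
  shows "Z \<tau> (frame_space (set l)) (complex_of_real \<sigma> *s cprod (flat l)) (skew (set l) \<theta>)
    = complex_of_real \<sigma> * (\<Prod>p\<in>set l. Zblock \<tau> (\<theta> p))"
  unfolding Z_def mat_exp_skew[OF assms(2)] W_rotation(1)[OF assms(1,2)] spin_exp_skew[OF assms(2,3)]
    spin_Str_rotor[OF assms(2,3) real_sign_cases(1)[OF assms(4)]] Zblock_eq[OF assms(1)] prod_dividef
  using assms(4) by auto

lemma Zg_frame:
  assumes "Im \<tau> > 0" "frame (set l)" "distinct l" "\<sigma> = 1 \<or> \<sigma> = - 1"
  shows "Zg \<gamma> (rskew (set l) a) \<tau> (frame_space (set l)) (complex_of_real \<sigma> *s cprod (flat l)) (skew (set l) \<theta>)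
    = complex_of_real \<sigma> * (\<Prod>p\<in>set l. Zblock \<tau> (\<gamma> * complex_of_real (a p) + \<theta> p))"
  unfolding Zg_def cmat_rskew mscale_skew mat_exp_skew[OF assms(2)] rotation_mult[OF assms(2)]
    W_rotation(1)[OF assms(1,2)] spin_exp_skew[OF assms(2,3)] spin_rotor_mult[OF assms(2,3)]
    spin_Str_rotor[OF assms(2,3) real_sign_cases(1)[OF assms(4)]] Zblock_eq[OF assms(1)] prod_dividef
  using assms(4) by auto

text \<open>Full periods reduce the shift to one of the three half periods. The exponent of \<sigma>
  is even unless \<alpha> and \<beta> are both odd, the only case that contains a
  supertrace.\<close>

lemma EM_eps_frame:
  fixes \<sigma> :: real
  assumes "Im \<tau> > 0" "frame (set l)" "distinct l" "\<sigma> = 1 \<or> \<sigma> = - 1" "odd \<alpha> \<or> odd \<beta>"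
  shows "EM_eps \<alpha> \<beta> \<tau> (frame_space (set l)) (complex_of_real \<sigma> *s cprod (flat l)) (skew (set l) \<theta>)
    = complex_of_real \<sigma> powi (\<alpha> + \<beta> + 1)
      * (\<Prod>p\<in>set l. Zblock \<tau> (\<theta> p + of_real pi * (of_int \<alpha> + of_int \<beta> * \<tau>)))"
proof -
  have dim: "dim (frame_space (set l)) = 2 * length l"
    by (rule dim_frame_space[OF assms(2,3)])
  have sgn_power: "(- 1 :: complex) powi (A * int (length l)) = ((- 1) powi A) ^ length l" for A
    by (simp add: power_int_mult)
  have q: "qpow \<tau> (real (2 * length l) / 8) = qpow \<tau> (1/4) ^ length l"
    by (simp add: qpow_power)
  note formulas = mat_exp_skew[OF assms(2)] W_rotation[OF assms(1,2)] spin_exp_skew[OF assms(2,3)]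
    spin_Str_rotor[OF assms(2,3) real_sign_cases(1)[OF assms(4)]] spin_Tr_rotor[OF assms(2,3)] dim q sgn_power
  have shift: "Zblock \<tau> (x + 2 * of_real pi * (of_int a + of_int b * \<tau>)) = (- 1) powi (a + b) * Zblock \<tau> x" for x a b
    by (rule Zblock_shift[OF assms(1)])
  consider (1) "odd \<alpha>" "even \<beta>" | (2) "even \<alpha>" "odd \<beta>" | (3) "odd \<alpha>" "odd \<beta>"
    using assms(5) by blast
  then show ?thesis
  proof cases
    case 1
    then obtain a b where ab: "\<alpha> = 2 * a + 1" "\<beta> = 2 * b"
      by (meson oddE evenE)
    have "Zblock \<tau> (x + of_real pi * (of_int \<alpha> + of_int \<beta> * \<tau>))
        = \<i> * (- 1) powi (a + b) * (1 / (cexpi (- x / 2) + cexpi (x / 2)) * wblock (qpow \<tau> 1) (qpow \<tau> (1/2)) (- qpow \<tau> 1) x)" for x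
      using shift[of "x + of_real pi" a b] Zblock_half_1[OF assms(1), of x]
      by (simp add: ab algebra_simps)
    then have "(\<Prod>p\<in>set l. Zblock \<tau> (\<theta> p + of_real pi * (of_int \<alpha> + of_int \<beta> * \<tau>)))
        = \<i> ^ length l * ((- 1) powi (a + b)) ^ length l * (1 / (\<Prod>p\<in>set l. cexpi (- \<theta> p / 2) + cexpi (\<theta> p / 2))
          * (\<Prod>p\<in>set l. wblock (qpow \<tau> 1) (qpow \<tau> (1/2)) (- qpow \<tau> 1) (\<theta> p)))"
      by (simp add: prod.distrib prod_dividef distinct_card[OF assms(3)] power_mult_distrib)
    moreover have "complex_of_real \<sigma> powi (\<alpha> + \<beta> + 1) = 1"
    proof -
      have "\<alpha> + \<beta> + 1 = 2 * (a + b + 1)"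
        by (simp add: ab)
      then show ?thesis
        using assms(4) by (auto simp: power_int_minus_one_minus power_int_mult)
    qed
    moreover have "(\<alpha> + \<beta> - 1) div 2 = a + b"
      by (simp add: ab)
    ultimately show ?thesis
      using 1 unfolding EM_eps_def formulas by (simp add: formulas)
  next
    case 2
    then obtain a b where ab: "\<alpha> = 2 * a" "\<beta> = 2 * b + 1"
      by (meson oddE evenE)
    have "Zblock \<tau> (x + of_real pi * (of_int \<alpha> + of_int \<beta> * \<tau>))
        = qpow \<tau> (1/4) * (- 1) powi (a + b) * ((cexpi (- x / 2) + cexpi (x / 2)) * wblock (qpow \<tau> 1) (- qpow \<tau> 1) (qpow \<tau> (1/2)) x)" for x
      using shift[of "x + of_real pi * \<tau>" a b] Zblock_half_tau[OF assms(1), of x]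
      by (simp add: ab algebra_simps)
    then have "(\<Prod>p\<in>set l. Zblock \<tau> (\<theta> p + of_real pi * (of_int \<alpha> + of_int \<beta> * \<tau>)))
        = qpow \<tau> (1/4) ^ length l * ((- 1) powi (a + b)) ^ length l * ((\<Prod>p\<in>set l. cexpi (- \<theta> p / 2) + cexpi (\<theta> p / 2))
          * (\<Prod>p\<in>set l. wblock (qpow \<tau> 1) (- qpow \<tau> 1) (qpow \<tau> (1/2)) (\<theta> p)))"
      by (simp add: prod.distrib distinct_card[OF assms(3)] power_mult_distrib)
    moreover have "complex_of_real \<sigma> powi (\<alpha> + \<beta> + 1) = 1"
    proof -
      have "\<alpha> + \<beta> + 1 = 2 * (a + b + 1)"
        by (simp add: ab)
      then show ?thesis
        using assms(4) by (auto simp: power_int_minus_one_minus power_int_mult)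
    qed
    moreover have "(\<alpha> + \<beta> - 1) div 2 = a + b"
      by (simp add: ab)
    ultimately show ?thesis
      using 2 unfolding EM_eps_def formulas by (simp add: formulas)
  next
    case 3
    then obtain a b where ab: "\<alpha> = 2 * a + 1" "\<beta> = 2 * b + 1"
      by (meson oddE evenE)
    have sgn: "(- 1 :: complex) powi (a + b + 1) = - ((- 1) powi (a + b))"
      by (rule uminus_one_powi_add_one)
    have "Zblock \<tau> (x + of_real pi * (of_int \<alpha> + of_int \<beta> * \<tau>))
        = \<i> * qpow \<tau> (1/4) * (- 1) powi (a + b + 1) * ((cexpi (- x / 2) - cexpi (x / 2)) * wblock (qpow \<tau> 1) (qpow \<tau> 1) (- qpow \<tau> (1/2)) x)" for x
    proof -
      have "x + of_real pi * (of_int \<alpha> + of_int \<beta> * \<tau>) = x + of_real pi * (1 + \<tau>) + 2 * of_real pi * (of_int a + of_int b * \<tau>)"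
        by (simp add: ab algebra_simps)
      then show ?thesis
        unfolding sgn by (simp only: shift Zblock_half_1_tau[OF assms(1)]) simp
    qed
    then have "(\<Prod>p\<in>set l. Zblock \<tau> (\<theta> p + of_real pi * (of_int \<alpha> + of_int \<beta> * \<tau>)))
        = \<i> ^ length l * qpow \<tau> (1/4) ^ length l * ((- 1) powi (a + b + 1)) ^ length l * ((\<Prod>p\<in>set l. cexpi (- \<theta> p / 2) - cexpi (\<theta> p / 2))
          * (\<Prod>p\<in>set l. wblock (qpow \<tau> 1) (qpow \<tau> 1) (- qpow \<tau> (1/2)) (\<theta> p)))"
      by (simp add: prod.distrib distinct_card[OF assms(3)] power_mult_distrib)
    moreover have sg: "complex_of_real \<sigma> powi (\<alpha> + \<beta> + 1) = complex_of_real \<sigma>"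
    proof -
      have "\<alpha> + \<beta> + 1 = 2 * (a + b + 1) + 1"
        by (simp add: ab)
      then show ?thesis
        using assms(4) by (auto simp: power_int_minus_one_minus power_int_mult power_int_add)
    qed
    moreover have "(\<alpha> + \<beta>) div 2 = a + b + 1"
      by (simp add: ab)
    ultimately show ?thesis
      using 3 unfolding EM_eps_def formulas sg by (simp add: formulas)
  qed
qed

text \<open>The sign contributed to \<open>Os\<close> by a plane rotated by
  \<open>2 * pi * n / k\<close>: the bivector coefficient of its spin lift is the sine of half that
  angle.\<close>

definition sine_sign :: "nat \<Rightarrow> int \<Rightarrow> real" where
  "sine_sign k n = sgn (sin (pi * of_int n / of_nat k))"

text \<open>The contribution to \<open>EM\<close> of a plane on which \<open>\<zeta>\<close> rotates by \<open>2 * pi * n / k\<close>, with the sign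
  \<open>Os\<close> distributed over the planes.\<close>

definition EMblock :: "nat \<Rightarrow> int \<Rightarrow> complex \<Rightarrow> complex \<Rightarrow> int \<Rightarrow> complex \<Rightarrow> complex" where
  "EMblock k c \<gamma> \<tau> n \<theta> = complex_of_real (sine_sign k n) powi c * Zblock \<tau> (\<gamma> * (2 * of_real pi * of_int n) + \<theta>)"

lemma Zblock_gamma_shift:
  assumes "Im \<tau> > 0" "of_nat k * \<gamma> = of_int \<alpha> + of_int \<beta> * \<tau>"
  shows "Zblock \<tau> (\<gamma> * (2 * of_real pi * of_int (int k * j)) + x) = (- 1) powi (j * (\<alpha> + \<beta>)) * Zblock \<tau> x"
proof -
  have "\<gamma> * (2 * of_real pi * of_int (int k * j)) = 2 * of_real pi * of_int j * (of_nat k * \<gamma>)"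
    by simp
  also have "\<dots> = 2 * of_real pi * (of_int (j * \<alpha>) + of_int (j * \<beta>) * \<tau>)"
    unfolding assms(2) by (simp add: algebra_simps)
  finally show ?thesis
    using Zblock_shift[OF assms(1), of x "j * \<alpha>" "j * \<beta>"] by (simp add: add.commute distrib_left)
qed

lemma sine_sign_shift:
  assumes "k > 0"
  shows "sine_sign k (int k * j + n) = (- 1) powi j * sine_sign k n"
proof -
  have "pi * of_int (int k * j + n) / of_nat k = pi * of_int j + pi * of_int n / of_nat k"
    using assms by (simp add: field_simps)
  then have "sin (pi * of_int (int k * j + n) / of_nat k) = (- 1) powi j * sin (pi * of_int n / of_nat k)"
    by (simp only: sin_add sin_npi_int cos_npi_int) (auto simp: power_int_minus_left)
  then show ?thesis
    unfolding sine_sign_def by (simp only: sgn_mult) (simp add: power_int_minus_left)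
qed

lemma minus_one_powi_square: "((- 1 :: complex) powi j) powi c * (- 1) powi (j * c) = 1"
  by (simp add: power_int_mult[symmetric] flip: power_int_add)

lemma EMblock_shift:
  assumes "Im \<tau> > 0" "of_nat k * \<gamma> = of_int \<alpha> + of_int \<beta> * \<tau>" "k > 0" "int k dvd n - n'"
  shows "EMblock k (\<alpha> + \<beta>) \<gamma> \<tau> n \<theta> = EMblock k (\<alpha> + \<beta>) \<gamma> \<tau> n' \<theta>"
proof -
  obtain j where j: "n = int k * j + n'"
    using assms(4) by (metis dvd_def diff_add_cancel)
  have "\<gamma> * (2 * of_real pi * of_int n) + \<theta> = \<gamma> * (2 * of_real pi * of_int (int k * j)) + (\<gamma> * (2 * of_real pi * of_int n') + \<theta>)"
    by (simp add: j algebra_simps)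
  then have "EMblock k (\<alpha> + \<beta>) \<gamma> \<tau> n \<theta> = complex_of_real ((- 1) powi j * sine_sign k n') powi (\<alpha> + \<beta>)
      * ((- 1) powi (j * (\<alpha> + \<beta>)) * Zblock \<tau> (\<gamma> * (2 * of_real pi * of_int n') + \<theta>))"
    unfolding EMblock_def j sine_sign_shift[OF assms(3)] by (simp only: Zblock_gamma_shift[OF assms(1,2)])
  also have "\<dots> = (((- 1) powi j) powi (\<alpha> + \<beta>) * (- 1) powi (j * (\<alpha> + \<beta>))) * EMblock k (\<alpha> + \<beta>) \<gamma> \<tau> n' \<theta>"
    by (simp add: EMblock_def power_int_mult_distrib)
  finally show ?thesis
    unfolding minus_one_powi_square by simp
qed

text \<open>Here \<open>2 * n = k * (2 * j + 1)\<close>, so the angle is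
  \<open>pi * (2 * j + 1)\<close> times \<open>k * \<gamma>\<close>. The full periods in it give
  \<open>(- 1) powi (j * (\<alpha> + \<beta>))\<close>, which cancels the power of the sine sign
  \<open>(- 1) powi j\<close>.\<close>

lemma EMblock_half:
  assumes "Im \<tau> > 0" "of_nat k * \<gamma> = of_int \<alpha> + of_int \<beta> * \<tau>" "k > 0" "int k dvd 2 * n" "\<not> int k dvd n"
  shows "EMblock k (\<alpha> + \<beta>) \<gamma> \<tau> n \<theta> = Zblock \<tau> (\<theta> + of_real pi * (of_int \<alpha> + of_int \<beta> * \<tau>))"
proof -
  obtain s where s: "2 * n = int k * s"
    using assms(4) by (auto simp: dvd_def)
  have "odd s"
  proof
    assume "even s"
    then obtain t where "s = 2 * t" by auto
    then show False
      using s assms(5) by simp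
  qed
  then obtain j where j: "s = 2 * j + 1"
    by (rule oddE)
  have real_s: "2 * real_of_int n = real k * (2 * real_of_int j + 1)"
  proof -
    have "real_of_int (2 * n) = real_of_int (int k * (2 * j + 1))"
      using s j by simp
    then show ?thesis by simp
  qed
  then have "pi * of_int n / of_nat k = pi * of_int j + pi / 2"
    using assms(3) by (simp add: field_simps)
  then have "sin (pi * of_int n / of_nat k) = (- 1) powi j"
    by (simp only: sin_add sin_npi_int cos_npi_int) (auto simp: power_int_minus_left)
  then have sgn: "complex_of_real (sine_sign k n) = (- 1) powi j"
    by (simp add: sine_sign_def power_int_minus_left)
  have "2 * complex_of_int n = of_nat k * (2 * of_int j + 1)"
  proof -
    have "complex_of_int (2 * n) = complex_of_int (int k * (2 * j + 1))"
      using s j by simp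
    then show ?thesis by simp
  qed
  then have "\<gamma> * (2 * of_real pi * of_int n) + \<theta> = of_real pi * (2 * of_int j + 1) * (of_nat k * \<gamma>) + \<theta>"
    by (simp add: mult_ac)
  also have "\<dots> = \<gamma> * (2 * of_real pi * of_int (int k * j)) + (\<theta> + of_real pi * (of_nat k * \<gamma>))"
    by (simp add: algebra_simps)
  finally have "EMblock k (\<alpha> + \<beta>) \<gamma> \<tau> n \<theta> = ((- 1) powi j) powi (\<alpha> + \<beta>)
      * ((- 1) powi (j * (\<alpha> + \<beta>)) * Zblock \<tau> (\<theta> + of_real pi * (of_nat k * \<gamma>)))"
    unfolding EMblock_def sgn by (simp only: Zblock_gamma_shift[OF assms(1,2)])
  then show ?thesis
    unfolding mult.assoc[symmetric] minus_one_powi_square assms(2) by simp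
qed

lemma prod_power_int: "(\<Prod>p\<in>A. f p :: complex) powi c = (\<Prod>p\<in>A. f p powi c)"
  by (induction A rule: infinite_finite_induct) (simp_all add: power_int_mult_distrib)

lemma sgn_prod: "sgn (\<Prod>p\<in>A. f p :: real) = (\<Prod>p\<in>A. sgn (f p))"
  by (induction A rule: infinite_finite_induct) (simp_all add: sgn_mult)

lemma sine_nonzero:
  assumes "k > 0" "\<not> int k dvd n"
  shows "sin (pi * of_int n / of_nat k) \<noteq> 0"
proof
  assume "sin (pi * of_int n / of_nat k) = 0"
  then obtain i :: int where "pi * of_int n / of_nat k = of_int i * pi"
    by (auto simp: sin_zero_iff_int2)
  then have "real_of_int n = real_of_int (int k * i)"
    using assms(1) by (simp add: field_simps)
  then have "n = int k * i"
    by (simp only: of_int_eq_iff)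
  then show False
    using assms(2) by simp
qed

lemma Os_frame_integral:
  assumes "frame (set l)" "distinct l" "\<sigma> = 1 \<or> \<sigma> = - 1" "k > 0" "\<And>p. p \<in> set l \<Longrightarrow> \<not> int k dvd n p"
  shows "Os (frame_space (set l)) ((1 / real k) *\<^sub>R rskew (set l) (\<lambda>p. 2 * pi * of_int (n p))) (complex_of_real \<sigma> *s cprod (flat l))
    = \<sigma> * (\<Prod>p\<in>set l. sine_sign k (n p))"
proof -
  have "(1 / real k) *\<^sub>R rskew (set l) (\<lambda>p. 2 * pi * of_int (n p)) = rskew (set l) (\<lambda>p. 2 * (pi * of_int (n p) / real k))"
    by (simp add: rskew_def scaleR_right.sum mult.assoc)
  moreover have "Os (frame_space (set l)) (rskew (set l) (\<lambda>p. 2 * (pi * of_int (n p) / real k))) (complex_of_real \<sigma> *s cprod (flat l))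
      = sgn (\<Prod>p\<in>set l. sin (2 * (pi * of_int (n p) / real k) / 2)) * \<sigma>"
    by (rule Os_frame[OF assms(1-3)]) (use sine_nonzero[OF assms(4,5)] in simp)
  ultimately show ?thesis
    by (simp add: sgn_prod sine_sign_def mult.commute)
qed

section \<open>Adapted infinitesimal rotations\<close>

context
  fixes \<zeta> :: "'n::{finite,linorder} rmatrix" and B C :: "'n plane set" and n :: "'n plane \<Rightarrow> int" and k :: nat
  assumes B: "frame B" and k: "k > 0" and C: "C \<subseteq> B"
    and \<zeta>: "cmat \<zeta> = rotation B (\<lambda>p. complex_of_real (2 * pi * of_int (n p) / of_nat k))"
    and n: "\<And>p. p \<in> C \<Longrightarrow> \<not> int k dvd 2 * n p"
begin

private definition ev :: "'n plane \<times> bool \<Rightarrow> complex" where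
  "ev = (\<lambda>(p, s). cexpi (bsign s * complex_of_real (2 * pi * of_int (n p) / of_nat k)))"

lemma ev_cnj: "ev (p, \<not> s) = cnj (ev (p, s))"
  by (simp add: ev_def cexpi_def bsign_def exp_cnj)

lemma ev_root: "ev (p, s) = cexpi (complex_of_real (2 * pi * of_int (if s then n p else - n p) / of_nat k))"
  by (simp add: ev_def bsign_def)

lemma frame_C: "frame C"
  using frame_subset[OF B C] .

text \<open>A real root of unity is \<open>1\<close> or \<open>- 1\<close>, and either would make
  twice the exponent divisible by \<open>k\<close>.\<close>

lemma Im_ev:
  assumes "p \<in> C"
  shows "Im (ev (p, s)) \<noteq> 0"
proof
  assume im: "Im (ev (p, s)) = 0"
  have "norm (ev (p, s)) = 1"
    unfolding ev_root by (simp add: cexpi_def)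
  then have "ev (p, s) = 1 \<or> ev (p, s) = - 1"
    using im by (auto simp: cmod_def complex_eq_iff abs_if split: if_splits)
  then have "int k dvd 2 * (if s then n p else - n p)"
    unfolding ev_root cexpi_root_eq_1_iff[OF k] cexpi_root_eq_minus_1_iff[OF k] by (cases s) (auto intro: dvd_mult)
  then show False
    using n[OF assms] by (cases s) auto
qed

lemma eigenspace_plane_u: "p \<in> C \<Longrightarrow> plane_u (p, s) \<in> eigenspace_on (frame_space C) \<zeta> (ev (p, s))"
  using rotation_plane_u[OF B, of p _ s] C
  by (auto simp: eigenspace_on_def \<zeta> ev_def plane_u_complexification)

lemma eigenspace_component:
  assumes "v \<in> eigenspace_on (frame_space C) \<zeta> u" "p \<in> C" "ev (p, s) \<noteq> u"
  shows "cdot (plane_w (p, s)) v = 0"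
proof -
  have "rotation B (\<lambda>p. complex_of_real (2 * pi * of_int (n p) / of_nat k)) *v v = u *s v"
    using assms(1) unfolding eigenspace_on_def \<zeta> by blast
  moreover have "p \<in> B"
    using assms(2) C by blast
  ultimately have "ev (p, s) * cdot (plane_w (p, s)) v = u * cdot (plane_w (p, s)) v"
    using cdot_rotation[OF B, of p s "\<lambda>p. complex_of_real (2 * pi * of_int (n p) / of_nat k)" v]
    by (simp only: ev_def cdot_scale_right prod.case)
  then show ?thesis
    using assms(3) by (metis mult_cancel_right)
qed

lemma eigenspace_expand:
  assumes "v \<in> eigenspace_on (frame_space C) \<zeta> u"
  shows "v = (\<Sum>i\<in>C \<times> UNIV. cdot (plane_w i) v *s plane_u i)"
  using complexification_expand[OF frame_C] assms by (simp add: eigenspace_on_def)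

lemma ev_image: "u \<in> ev ` (C \<times> UNIV) \<Longrightarrow> \<exists>p s. p \<in> C \<and> u = ev (p, s)"
  by (elim imageE SigmaE) blast

lemma spectrum_eq: "{u. eigenspace_on (frame_space C) \<zeta> u \<noteq> {0}} = ev ` (C \<times> UNIV)"
proof (intro set_eqI iffI)
  fix u assume u: "u \<in> {u. eigenspace_on (frame_space C) \<zeta> u \<noteq> {0}}"
  have "0 \<in> complexification (frame_space C)"
    using subspace_0[OF subspace_frame_space[of C]]
    by (simp add: complexification_def zero_vec_def[symmetric])
  then have "0 \<in> eigenspace_on (frame_space C) \<zeta> u"
    by (simp add: eigenspace_on_def)
  then obtain v where v: "v \<in> eigenspace_on (frame_space C) \<zeta> u" "v \<noteq> 0"
    using u by auto
  show "u \<in> ev ` (C \<times> UNIV)"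
  proof (rule ccontr)
    assume "u \<notin> ev ` (C \<times> UNIV)"
    then have "ev i \<noteq> u" if "i \<in> C \<times> UNIV" for i
      using that by blast
    then have "cdot (plane_w i) v = 0" if "i \<in> C \<times> UNIV" for i
      using that eigenspace_component[OF v(1), of "fst i" "snd i"] by (simp add: mem_Times_iff)
    then show False
      using eigenspace_expand[OF v(1)] v(2) by simp
  qed
next
  fix u assume "u \<in> ev ` (C \<times> UNIV)"
  then obtain p s where "p \<in> C" "u = ev (p, s)"
    using ev_image by blast
  then show "u \<in> {u. eigenspace_on (frame_space C) \<zeta> u \<noteq> {0}}"
    using eigenspace_plane_u[of p s] plane_u_nonzero[OF frame_C, of p s] by auto
qed

lemma ev_exp: "\<exists>a :: int. ev i = exp (2 * \<i> * of_real pi * of_int a / of_nat k)"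
proof -
  obtain p s where "i = (p, s)"
    by (cases i)
  then show ?thesis
    by (intro exI[of _ "if s then n p else - n p"]) (simp add: ev_root cexpi_def mult_ac)
qed

text \<open>No eigenvalue is real, so those in the upper half-plane can serve as \<open>Fp\<close>.
  The exponent \<open>a u\<close> is chosen once for each eigenvalue, so that planes sharing an
  eigenvalue receive matching integers.\<close>

lemma ex_adapted: "\<exists>K. adapted k (frame_space C) \<zeta> K"
proof -
  define a where "a u = (SOME a :: int. u = exp (2 * \<i> * of_real pi * of_int a / of_nat k))" for u
  \<comment> \<open>The integer of a plane is read off from whichever of its two eigenvalues lies in
    the upper half-plane; on \<open>plane_u (p, False)\<close> the weight is \<open>- m p\<close>,
    hence the negation.\<close>
  define m where "m p = (if Im (ev (p, True)) > 0 then a (ev (p, True)) else - a (ev (p, False)))" for p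
  define K where "K = rskew C (\<lambda>p. 2 * pi * of_int (m p))"
  define Fp where "Fp = {u \<in> ev ` (C \<times> UNIV). Im u > 0}"
  have cnj_mem: "cnj u \<in> ev ` (C \<times> UNIV)" if u: "u \<in> ev ` (C \<times> UNIV)" for u
  proof -
    obtain p s where "p \<in> C" "u = ev (p, s)"
      using ev_image[OF u] by blast
    then have "cnj u = ev (p, \<not> s)" "(p, \<not> s) \<in> C \<times> UNIV"
      by (simp_all add: ev_cnj)
    then show ?thesis
      by blast
  qed
  have im: "Im u \<noteq> 0" if "u \<in> ev ` (C \<times> UNIV)" for u
    using ev_image[OF that] Im_ev by blast
  have F1: "Fp \<union> cnj ` Fp = ev ` (C \<times> UNIV)"
  proof (intro set_eqI iffI)
    fix u assume u: "u \<in> ev ` (C \<times> UNIV)"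
    show "u \<in> Fp \<union> cnj ` Fp"
    proof (cases "Im u > 0")
      case False
      then have "cnj u \<in> Fp"
        using im[OF u] cnj_mem[OF u] by (simp add: Fp_def)
      then show ?thesis
        by (metis UnI2 complex_cnj_cnj image_eqI)
    qed (use u in \<open>simp add: Fp_def\<close>)
  qed (use cnj_mem in \<open>auto simp: Fp_def\<close>)
  have F2: "Fp \<inter> cnj ` Fp = {}"
  proof (rule equals0I)
    fix u assume "u \<in> Fp \<inter> cnj ` Fp"
    then obtain w where "u \<in> Fp" "w \<in> Fp" "u = cnj w"
      by blast
    then show False
      by (simp add: Fp_def)
  qed
  have F3: "u = exp (2 * \<i> * of_real pi * of_int (a u) / of_nat k)" if "u \<in> Fp" for u
  proof -
    have "\<exists>a :: int. u = exp (2 * \<i> * of_real pi * of_int a / of_nat k)"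
      using that ev_exp by (auto simp: Fp_def)
    then show ?thesis
      unfolding a_def by (rule someI_ex)
  qed
  have F4: "cmat K *v v = (2 * \<i> * of_real pi * of_int (a u)) *s v"
    if u: "u \<in> Fp" and v: "v \<in> eigenspace_on (frame_space C) \<zeta> u" for u v
  proof -
    let ?c = "2 * \<i> * of_real pi * of_int (a u)"
    have "cmat K *v v = (\<Sum>i\<in>C \<times> UNIV. (\<i> * (case i of (p, s) \<Rightarrow> bsign s * complex_of_real (2 * pi * of_int (m p))) * cdot (plane_w i) v) *s plane_u i)"
      unfolding K_def cmat_rskew skew_plane_diag diag_sum_vector by (simp add: case_prod_unfold)
    also have "\<dots> = (\<Sum>i\<in>C \<times> UNIV. (?c * cdot (plane_w i) v) *s plane_u i)"
    proof (rule sum.cong[OF refl])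
      fix i assume "i \<in> C \<times> (UNIV :: bool set)"
      then obtain p s where i: "i = (p, s)" "p \<in> C"
        by auto
      show "(\<i> * (case i of (p, s) \<Rightarrow> bsign s * complex_of_real (2 * pi * of_int (m p))) * cdot (plane_w i) v) *s plane_u i
          = (?c * cdot (plane_w i) v) *s plane_u i"
      proof (cases "ev (p, s) = u")
        case True
        then have "Im (ev (p, s)) > 0"
          using u by (simp add: Fp_def)
        then have "bsign s * complex_of_int (m p) = of_int (a u)"
          using True ev_cnj[of p False] by (cases s) (auto simp: m_def bsign_def)
        then have "\<i> * (bsign s * complex_of_real (2 * pi * of_int (m p))) = ?c"
          by (simp add: mult_ac)
        then show ?thesis
          by (simp add: i)
      next
        case False
        then show ?thesis
          using eigenspace_component[OF v i(2)] i by simp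
      qed
    qed
    also have "\<dots> = ?c *s (\<Sum>i\<in>C \<times> UNIV. cdot (plane_w i) v *s plane_u i)"
      by (simp add: vec.scale_sum_right)
    finally show ?thesis
      using eigenspace_expand[OF v] by simp
  qed
  have F5: "K \<in> so (frame_space C)"
    unfolding K_def by (rule rskew_in_so)
  have "adapted k (frame_space C) \<zeta> K"
    unfolding adapted_def spectrum_eq
    by (intro conjI F5 exI[of _ Fp] exI[of _ a] F1 F2 ballI F3 F4)
  then show ?thesis ..
qed

text \<open>One of the two conjugate eigenvalues of the plane lies in \<open>Fp\<close>, and
  equality of the corresponding roots of unity is congruence modulo \<open>k\<close>.\<close>

lemma adapted_on_plane:
  assumes "adapted k (frame_space C) \<zeta> K" "p \<in> C"
  shows "\<exists>m::int. int k dvd m - n p \<and> K *v fst p = (2 * pi * of_int m) *\<^sub>R snd p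
    \<and> K *v snd p = - ((2 * pi * of_int m) *\<^sub>R fst p)"
proof -
  obtain Fp and a :: "complex \<Rightarrow> int" where Fp: "Fp \<union> cnj ` Fp = ev ` (C \<times> UNIV)"
    and rest: "\<forall>u\<in>Fp. u = exp (2 * \<i> * of_real pi * of_int (a u) / of_nat k)
      \<and> (\<forall>v\<in>eigenspace_on (frame_space C) \<zeta> u. cmat K *v v = (2 * \<i> * of_real pi * of_int (a u)) *s v)"
    using assms(1) unfolding adapted_def spectrum_eq by (elim conjE exE) (rule that)
  have a: "u = exp (2 * \<i> * of_real pi * of_int (a u) / of_nat k)" if "u \<in> Fp" for u
    using bspec[OF rest that] by (rule conjunct1)
  have K: "cmat K *v v = (2 * \<i> * of_real pi * of_int (a u)) *s v"
    if "u \<in> Fp" "v \<in> eigenspace_on (frame_space C) \<zeta> u" for u v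
    using bspec[OF rest that(1)] that(2) by blast
  have "ev (p, True) \<in> Fp \<union> cnj ` Fp"
    using Fp assms(2) by blast
  then have "ev (p, True) \<in> Fp \<or> ev (p, False) \<in> Fp"
    using ev_cnj[of p True] by auto
  then obtain s where s: "ev (p, s) \<in> Fp"
    by blast
  define c where "c = a (ev (p, s))"
  define m where "m = (if s then c else - c)"
  have "cexpi (complex_of_real (2 * pi * of_int (if s then n p else - n p) / of_nat k)) = cexpi (complex_of_real (2 * pi * of_int c / of_nat k))"
    using a[OF s] by (simp add: ev_root c_def cexpi_def mult_ac)
  then have "int k dvd (if s then n p else - n p) - c"
    by (rule cexpi_root_eq_iff[OF k, THEN iffD1])
  moreover have "m - n p = (if s then - 1 else 1) * ((if s then n p else - n p) - c)"
    by (simp add: m_def)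
  ultimately have "int k dvd m - n p"
    by (metis dvd_mult)
  have "cmat K *v plane_u (p, s) = (2 * \<i> * of_real pi * of_int c) *s plane_u (p, s)"
    using K[OF s eigenspace_plane_u[OF assms(2)]] by (simp add: c_def)
  then have "cvec (K *v fst p) - (bsign s * \<i>) *s cvec (K *v snd p)
      = (2 * \<i> * of_real pi * of_int c) *s (cvec (fst p) - (bsign s * \<i>) *s cvec (snd p))"
    by (simp add: plane_u_def matrix_vector_mult_diff_distrib vector_scalar_commute cmat_cvec)
  then have *: "complex_of_real ((K *v fst p) $ i) - bsign s * \<i> * complex_of_real ((K *v snd p) $ i)
      = 2 * \<i> * of_real pi * of_int c * (complex_of_real (fst p $ i) - bsign s * \<i> * complex_of_real (snd p $ i))" for i
    unfolding vec_eq_iff by (simp add: right_diff_distrib mult.assoc)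
  \<comment> \<open>The equation for one complex eigenvector contains both real equations, as its
    real and imaginary parts.\<close>
  have "(K *v fst p) $ i = 2 * pi * of_int m * snd p $ i" "(K *v snd p) $ i = - (2 * pi * of_int m * fst p $ i)" for i
    using arg_cong[OF *[of i], of Re] arg_cong[OF *[of i], of Im] by (cases s; simp add: bsign_def m_def)+
  then have "K *v fst p = (2 * pi * of_int m) *\<^sub>R snd p" "K *v snd p = - ((2 * pi * of_int m) *\<^sub>R fst p)"
    by (simp_all add: vec_eq_iff)
  then show ?thesis
    using \<open>int k dvd m - n p\<close> by blast
qed

lemma adapted_eq_rskew:
  assumes "adapted k (frame_space C) \<zeta> K"
  obtains m where "K = rskew C (\<lambda>p. 2 * pi * of_int (m p))" "\<And>p. p \<in> C \<Longrightarrow> int k dvd m p - n p"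
proof -
  obtain m where m: "\<And>p. p \<in> C \<Longrightarrow> int k dvd m p - n p \<and> K *v fst p = (2 * pi * of_int (m p)) *\<^sub>R snd p
      \<and> K *v snd p = - ((2 * pi * of_int (m p)) *\<^sub>R fst p)"
    using adapted_on_plane[OF assms] by metis
  have "K \<in> so (frame_space C)"
    using assms by (simp add: adapted_def)
  then have "K = rskew C (\<lambda>p. 2 * pi * of_int (m p))"
    by (rule so_eq_rskew[OF frame_C]) (use m in auto)
  then show thesis
    using that m by blast
qed

text \<open>The integers of the chosen \<open>K\<close> are known only modulo \<open>k\<close>, and
  \<open>EMblock_shift\<close> replaces them by \<open>n p\<close>; this is the independence of the
  adapted choice.\<close>

lemma EM_reg_frame:
  fixes \<sigma> :: real
  assumes "Im \<tau> > 0" "of_nat k * \<gamma> = of_int \<alpha> + of_int \<beta> * \<tau>" "\<sigma> = 1 \<or> \<sigma> = - 1" "C = set l" "distinct l"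
  shows "EM_reg k \<alpha> \<beta> \<gamma> \<zeta> \<tau> (frame_space C) (complex_of_real \<sigma> *s cprod (flat l)) (skew C \<theta>)
    = complex_of_real \<sigma> powi (\<alpha> + \<beta> + 1) * (\<Prod>p\<in>C. EMblock k (\<alpha> + \<beta>) \<gamma> \<tau> (n p) (\<theta> p))"
proof -
  define K where "K = (SOME K. adapted k (frame_space C) \<zeta> K)"
  have "adapted k (frame_space C) \<zeta> K"
    unfolding K_def by (rule someI_ex) (rule ex_adapted)
  then obtain m where K: "K = rskew C (\<lambda>p. 2 * pi * of_int (m p))" and m: "\<And>p. p \<in> C \<Longrightarrow> int k dvd m p - n p"
    by (rule adapted_eq_rskew) blast
  have mk: "\<not> int k dvd m p" if "p \<in> C" for p
    using n[OF that] m[OF that] by (metis dvd_diff_right_iff dvd_mult)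
  have fr: "frame (set l)"
    using frame_C assms(4) by simp
  have "EM_reg k \<alpha> \<beta> \<gamma> \<zeta> \<tau> (frame_space C) (complex_of_real \<sigma> *s cprod (flat l)) (skew C \<theta>)
      = complex_of_real (\<sigma> * (\<Prod>p\<in>C. sine_sign k (m p))) powi (\<alpha> + \<beta>)
        * (complex_of_real \<sigma> * (\<Prod>p\<in>C. Zblock \<tau> (\<gamma> * complex_of_real (2 * pi * of_int (m p)) + \<theta> p)))"
    unfolding EM_reg_def K_def[symmetric] Let_def K unfolding assms(4)
    using Os_frame_integral[OF fr assms(5,3) k, of m] mk Zg_frame[OF assms(1) fr assms(5,3)] assms(4) by simp
  also have "\<dots> = complex_of_real \<sigma> powi (\<alpha> + \<beta>) * complex_of_real \<sigma> * (\<Prod>p\<in>C. EMblock k (\<alpha> + \<beta>) \<gamma> \<tau> (m p) (\<theta> p))"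
    by (simp add: EMblock_def power_int_mult_distrib prod.distrib prod_power_int)
  also have "complex_of_real \<sigma> powi (\<alpha> + \<beta>) * complex_of_real \<sigma> = complex_of_real \<sigma> powi (\<alpha> + \<beta> + 1)"
    using assms(3) by (auto simp: power_int_add)
  also have "(\<Prod>p\<in>C. EMblock k (\<alpha> + \<beta>) \<gamma> \<tau> (m p) (\<theta> p)) = (\<Prod>p\<in>C. EMblock k (\<alpha> + \<beta>) \<gamma> \<tau> (n p) (\<theta> p))"
    by (rule prod.cong[OF refl]) (rule EMblock_shift[OF assms(1,2) k], rule m)
  finally show ?thesis .
qed

end

section \<open>Sorting the planes by the action of \<open>\<zeta>\<close>\<close>

lemma ext_scale: "ext_mult (c *s a) (d *s b) = (c * d) *s ext_mult a b"
  by (simp add: ext_mult_twist twist_mult_def vec_eq_iff sum_distrib_left mult_ac)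

lemma ext_cprod_flat:
  assumes "frame (set (l @ m))" "distinct (l @ m)"
  shows "ext_mult (cprod (flat l)) (cprod (flat m)) = cprod (flat (l @ m))"
proof -
  have "frame (set l)" "frame (set m)" "distinct l" "distinct m"
    using assms frame_subset[OF assms(1)] by auto
  then show ?thesis
    using wedge_list_append[of "flat l" "flat m"] wedge_list_cprod[OF orthonormal_flat] assms
    unfolding flat_simps(3)[symmetric] by metis
qed

lemma is_orientation_sign:
  assumes "frame (set l)" "distinct l" "is_orientation (frame_space (set l)) \<omega>"
  obtains \<sigma> :: real where "\<sigma> = 1 \<or> \<sigma> = - 1" "\<omega> = complex_of_real \<sigma> *s cprod (flat l)"
  using assms(3) that[of 1] that[of "- 1"] unfolding is_orientation_frame[OF assms(1,2)] by auto

lemma rotation_fixes_real: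
  assumes "frame B" "p \<in> B" "cmat \<zeta> = rotation B \<theta>" "cexpi (\<theta> p) = of_real r" "r = 1 \<or> r = - 1"
  shows "\<zeta> *v fst p = r *\<^sub>R fst p" "\<zeta> *v snd p = r *\<^sub>R snd p"
proof -
  have inv: "cexpi (- \<theta> p) = of_real r"
    using assms(4,5) by (auto simp: cexpi_minus)
  have u: "rotation B \<theta> *v plane_u (p, s) = of_real r *s plane_u (p, s)" for s
    using rotation_plane_u[OF assms(1,2), of \<theta> s] assms(4) inv by (cases s) (simp_all add: bsign_def)
  have "rotation B \<theta> *v cvec (fst p) = of_real r *s cvec (fst p)" "rotation B \<theta> *v cvec (snd p) = of_real r *s cvec (snd p)"
    unfolding plane_u_sum vector_scalar_commute matrix_vector_right_distrib matrix_vector_mult_diff_distrib u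
    by (simp_all add: vec_eq_iff algebra_simps)
  then show "\<zeta> *v fst p = r *\<^sub>R fst p" "\<zeta> *v snd p = r *\<^sub>R snd p"
    unfolding assms(3)[symmetric] cmat_cvec cvec_simps(4)[symmetric] cvec_eq_iff by auto
qed

lemma frame_space_real_eigenvector:
  assumes "frame B" "C \<subseteq> B" "cmat \<zeta> = rotation B \<theta>" "v \<in> frame_space C" "\<zeta> *v v = r *\<^sub>R v"
    and "A \<subseteq> C" "\<And>p. p \<in> C - A \<Longrightarrow> cexpi (\<theta> p) \<noteq> of_real r"
  shows "v \<in> frame_space A"
proof (rule frame_space_subset_mem[OF frame_subset[OF assms(1,2)] assms(6,4)])
  fix p assume p: "p \<in> C - A"
  have "rotation B \<theta> *v cvec v = of_real r *s cvec v"
    unfolding assms(3)[symmetric] cmat_cvec assms(5) cvec_simps(4) ..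
  then show "v \<bullet> fst p = 0 \<and> v \<bullet> snd p = 0"
    using rotation_real_eigenvector[OF assms(1), of p \<theta> v r] assms(7)[OF p] p assms(2) by blast
qed

text \<open>Otherwise half of the relation would put \<open>k div 2\<close> times \<gamma> into the
  lattice, against the exactness of the order.\<close>

lemma has_order_not_both_even:
  assumes "has_order \<tau> \<gamma> k" "of_nat k * \<gamma> = of_int \<alpha> + of_int \<beta> * \<tau>" "even k"
  shows "odd \<alpha> \<or> odd \<beta>"
proof (rule ccontr)
  assume "\<not> (odd \<alpha> \<or> odd \<beta>)"
  then obtain a b where ab: "\<alpha> = 2 * a" "\<beta> = 2 * b"
    by (meson evenE)
  obtain j where j: "k = 2 * j"
    using assms(3) by (rule evenE)
  have "0 < j" "j < k"
    using assms(1) j by (auto simp: has_order_def)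
  moreover have "2 * (of_nat j * \<gamma>) = 2 * (of_int a + of_int b * \<tau>)"
    using assms(2) by (simp add: j ab algebra_simps)
  then have "of_nat j * \<gamma> = of_int a + of_int b * \<tau>"
    unfolding mult_cancel_left by simp
  ultimately show False
    using assms(1) unfolding has_order_def lattice_def by blast
qed

lemma minus_one_powi_sum: "(- 1 :: complex) powi (\<Sum>p\<in>A. f p) = (\<Prod>p\<in>A. (- 1) powi f p)"
  by (induction A rule: infinite_finite_induct) (simp_all add: power_int_add)

text \<open>The divisibility conditions say that \<open>\<zeta>\<close> is the identity on the planes in \<open>l0\<close>, minus the identity
  on those in \<open>lB\<close>, and has no real eigenvalue on those in \<open>lG\<close>.\<close>

context
  fixes B :: "'n::{finite,linorder} plane set" and \<zeta> :: "'n rmatrix" and n :: "'n plane \<Rightarrow> int"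
    and k :: nat and \<alpha> \<beta> :: int and \<gamma> \<tau> :: complex and l0 lB lG :: "'n plane list"
  assumes frame_B: "frame B" and k: "k > 0" and \<tau>: "Im \<tau> > 0"
    and \<gamma>: "of_nat k * \<gamma> = of_int \<alpha> + of_int \<beta> * \<tau>"
    and order: "has_order \<tau> \<gamma> k"
    and \<zeta>: "cmat \<zeta> = rotation B (\<lambda>p. complex_of_real (2 * pi * of_int (n p) / of_nat k))"
    and l0: "set l0 = {p \<in> B. int k dvd n p}"
    and lB: "set lB = {p \<in> B. int k dvd 2 * n p \<and> \<not> int k dvd n p}"
    and lG: "set lG = {p \<in> B. \<not> int k dvd 2 * n p}"
    and dist: "distinct (l0 @ lB @ lG)"
begin

section \<open>Eigenspaces of \<zeta> in terms of the sorted planes\<close>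

lemma sorted_frames:
  "set (l0 @ lB @ lG) = B" "frame (set l0)" "frame (set lB)" "frame (set lG)" "frame (set (lB @ lG))"
  "frame (set (l0 @ lB @ lG))" "set l0 \<subseteq> B" "set lB \<subseteq> B" "set lG \<subseteq> B" "set (lB @ lG) \<subseteq> B"
proof -
  show eq: "set (l0 @ lB @ lG) = B"
    by (auto simp: l0 lB lG)
  show sub: "set l0 \<subseteq> B" "set lB \<subseteq> B" "set lG \<subseteq> B" "set (lB @ lG) \<subseteq> B"
    by (auto simp: l0 lB lG)
  show "frame (set l0)" "frame (set lB)" "frame (set lG)" "frame (set (lB @ lG))" "frame (set (l0 @ lB @ lG))"
    using frame_subset[OF frame_B] sub eq by auto
qed

lemma zeta_planes:
  shows "p \<in> set l0 \<Longrightarrow> \<zeta> *v fst p = fst p \<and> \<zeta> *v snd p = snd p"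
    "p \<in> set lB \<Longrightarrow> \<zeta> *v fst p = - fst p \<and> \<zeta> *v snd p = - snd p"
proof -
  assume p: "p \<in> set l0"
  then have "cexpi (complex_of_real (2 * pi * of_int (n p) / of_nat k)) = of_real 1"
    using cexpi_root_eq_1_iff[OF k, of "n p"] by (simp add: l0)
  then show "\<zeta> *v fst p = fst p \<and> \<zeta> *v snd p = snd p"
    using rotation_fixes_real[OF frame_B _ \<zeta>, of p 1] p by (simp add: l0)
next
  assume p: "p \<in> set lB"
  then have "cexpi (complex_of_real (2 * pi * of_int (n p) / of_nat k)) = of_real (- 1)"
    using cexpi_root_eq_minus_1_iff[OF k, of "n p"] by (simp add: lB)
  then show "\<zeta> *v fst p = - fst p \<and> \<zeta> *v snd p = - snd p"
    using rotation_fixes_real[OF frame_B _ \<zeta>, of p "- 1"] p by (simp add: lB)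
qed

text \<open>The decomposition is given abstractly. The component in \<open>N\<^sub>1\<close> of a
  fixed vector is fixed and hence zero, which determines \<open>N\<^sub>0\<close>; then
  \<open>N\<^sub>1\<close> is its orthogonal complement.\<close>

lemma fixed_space_eq:
  assumes "orthogonal_sum (frame_space B) N\<^sub>0 N\<^sub>1" "\<forall>v\<in>N\<^sub>0. \<zeta> *v v = v" "invertible_on N\<^sub>1 (mat 1 - \<zeta>)"
  shows "N\<^sub>0 = frame_space (set l0)" "N\<^sub>1 = frame_space (set (lB @ lG))"
proof -
  have sub: "subspace N\<^sub>0" "subspace N\<^sub>1" and orth: "\<And>x y. x \<in> N\<^sub>0 \<Longrightarrow> y \<in> N\<^sub>1 \<Longrightarrow> x \<bullet> y = 0"
    and sum: "frame_space B = {x + y | x y. x \<in> N\<^sub>0 \<and> y \<in> N\<^sub>1}"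
    using assms(1) by (auto simp: orthogonal_sum_def)
  have in_B: "N\<^sub>0 \<subseteq> frame_space B" "N\<^sub>1 \<subseteq> frame_space B"
    unfolding sum using subspace_0[OF sub(1)] subspace_0[OF sub(2)] by force+
  have inj: "y = 0" if "y \<in> N\<^sub>1" "\<zeta> *v y = y" for y
  proof -
    have "(mat 1 - \<zeta>) *v y = (mat 1 - \<zeta>) *v 0"
      using that(2) by (simp add: matrix_vector_mult_diff_rdistrib)
    then show ?thesis
      using assms(3) that(1) subspace_0[OF sub(2)] unfolding invertible_on_def bij_betw_def inj_on_def by blast
  qed
  have fixed_in: "e \<in> N\<^sub>0" if e: "e \<in> frame_space B" "\<zeta> *v e = e" for e
  proof -
    obtain x y where xy: "e = x + y" "x \<in> N\<^sub>0" "y \<in> N\<^sub>1"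
      using e(1) unfolding sum by blast
    then have "\<zeta> *v y = y"
      using e(2) assms(2) by (simp add: matrix_vector_right_distrib)
    then show ?thesis
      using inj[OF xy(3)] xy by simp
  qed
  show N0: "N\<^sub>0 = frame_space (set l0)"
  proof
    show "frame_space (set l0) \<subseteq> N\<^sub>0"
    proof (rule frame_space_subset[OF sub(1)])
      fix p assume p: "p \<in> set l0"
      then have "p \<in> B"
        by (simp add: l0)
      then show "fst p \<in> N\<^sub>0 \<and> snd p \<in> N\<^sub>0"
        using fixed_in zeta_planes(1)[OF p] frame_space_mem[of p B] by blast
    qed
    show "N\<^sub>0 \<subseteq> frame_space (set l0)"
    proof
      fix v assume v: "v \<in> N\<^sub>0"
      show "v \<in> frame_space (set l0)"
      proof (rule frame_space_real_eigenvector[OF frame_B subset_refl \<zeta>, of v 1])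
        show "v \<in> frame_space B" "\<zeta> *v v = 1 *\<^sub>R v"
          using v in_B assms(2) by auto
        show "cexpi (complex_of_real (2 * pi * of_int (n p) / of_nat k)) \<noteq> of_real 1" if "p \<in> B - set l0" for p
          using that cexpi_root_eq_1_iff[OF k, of "n p"] by (simp add: l0)
      qed (rule sorted_frames(7))
    qed
  qed
  have perp_in: "e \<in> N\<^sub>1" if e: "e \<in> frame_space B" "\<And>x. x \<in> N\<^sub>0 \<Longrightarrow> e \<bullet> x = 0" for e
  proof -
    obtain x y where xy: "e = x + y" "x \<in> N\<^sub>0" "y \<in> N\<^sub>1"
      using e(1) unfolding sum by blast
    then have "x \<bullet> x = 0"
      using e(2)[OF xy(2)] orth[OF xy(2,3)] by (simp add: xy(1) inner_add_left inner_commute[of y])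
    then show ?thesis
      using xy by simp
  qed
  show "N\<^sub>1 = frame_space (set (lB @ lG))"
  proof
    show "frame_space (set (lB @ lG)) \<subseteq> N\<^sub>1"
    proof (rule frame_space_subset[OF sub(2)])
      fix p assume "p \<in> set (lB @ lG)"
      then have "p \<in> B - set l0" "p \<in> B"
        using dist sorted_frames(10) by auto
      then show "fst p \<in> N\<^sub>1 \<and> snd p \<in> N\<^sub>1"
        using perp_in frame_space_mem[of p B] frame_space_disjoint_orthogonal[OF frame_B sorted_frames(7)]
        unfolding N0 by blast
    qed
    show "N\<^sub>1 \<subseteq> frame_space (set (lB @ lG))"
    proof
      fix v assume v: "v \<in> N\<^sub>1"
      show "v \<in> frame_space (set (lB @ lG))"
      proof (rule frame_space_subset_mem[OF frame_B sorted_frames(10)])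
        show "v \<in> frame_space B"
          using v in_B by auto
        fix p assume "p \<in> B - set (lB @ lG)"
        then have "p \<in> set l0"
          using sorted_frames(1) by auto
        then have "fst p \<in> N\<^sub>0" "snd p \<in> N\<^sub>0"
          unfolding N0 by (simp_all add: frame_space_mem)
        then show "v \<bullet> fst p = 0 \<and> v \<bullet> snd p = 0"
          using orth[of "fst p" v] orth[of "snd p" v] v by (simp add: inner_commute[of v])
      qed
    qed
  qed
qed

lemma minus_one_space_eq:
  "{v \<in> frame_space (set (lB @ lG)). \<zeta> *v v = - v} = frame_space (set lB)"
proof
  show "{v \<in> frame_space (set (lB @ lG)). \<zeta> *v v = - v} \<subseteq> frame_space (set lB)"
  proof
    fix v assume v: "v \<in> {v \<in> frame_space (set (lB @ lG)). \<zeta> *v v = - v}"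
    show "v \<in> frame_space (set lB)"
    proof (rule frame_space_real_eigenvector[OF frame_B sorted_frames(10) \<zeta>, of v "- 1"])
      show "v \<in> frame_space (set (lB @ lG))" "\<zeta> *v v = (- 1) *\<^sub>R v"
        using v by auto
      show "cexpi (complex_of_real (2 * pi * of_int (n p) / of_nat k)) \<noteq> of_real (- 1)" if "p \<in> set (lB @ lG) - set lB" for p
        using that cexpi_root_eq_minus_1_iff[OF k, of "n p"] by (auto simp: lB lG)
    qed simp
  qed
  show "frame_space (set lB) \<subseteq> {v \<in> frame_space (set (lB @ lG)). \<zeta> *v v = - v}"
  proof (rule frame_space_subset)
    show "subspace {v \<in> frame_space (set (lB @ lG)). \<zeta> *v v = - v}"
      using subspace_frame_space[of "set (lB @ lG)"]
      by (auto simp: subspace_def matrix_vector_right_distrib matrix_vector_mult_scaleR)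
    show "fst p \<in> {v \<in> frame_space (set (lB @ lG)). \<zeta> *v v = - v} \<and> snd p \<in> {v \<in> frame_space (set (lB @ lG)). \<zeta> *v v = - v}"
      if "p \<in> set lB" for p
      using zeta_planes(2)[OF that] frame_space_mem[of p "set (lB @ lG)"] that by simp
  qed
qed

lemma regular_space_eq:
  "{v \<in> frame_space (set (lB @ lG)). \<forall>w\<in>frame_space (set lB). v \<bullet> w = 0} = frame_space (set lG)"
proof
  show "{v \<in> frame_space (set (lB @ lG)). \<forall>w\<in>frame_space (set lB). v \<bullet> w = 0} \<subseteq> frame_space (set lG)"
  proof
    fix v assume v: "v \<in> {v \<in> frame_space (set (lB @ lG)). \<forall>w\<in>frame_space (set lB). v \<bullet> w = 0}"
    show "v \<in> frame_space (set lG)"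
    proof (rule frame_space_subset_mem[OF sorted_frames(5)])
      show "v \<bullet> fst p = 0 \<and> v \<bullet> snd p = 0" if "p \<in> set (lB @ lG) - set lG" for p
      proof -
        have "p \<in> set lB"
          using that by auto
        then show ?thesis
          using v frame_space_mem by blast
      qed
    qed (use v in auto)
  qed
  show "frame_space (set lG) \<subseteq> {v \<in> frame_space (set (lB @ lG)). \<forall>w\<in>frame_space (set lB). v \<bullet> w = 0}"
  proof (rule frame_space_subset)
    show "subspace {v \<in> frame_space (set (lB @ lG)). \<forall>w\<in>frame_space (set lB). v \<bullet> w = 0}"
      using subspace_frame_space[of "set (lB @ lG)"]
      by (auto simp: subspace_def inner_add_left)
    show "fst p \<in> {v \<in> frame_space (set (lB @ lG)). \<forall>w\<in>frame_space (set lB). v \<bullet> w = 0}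
        \<and> snd p \<in> {v \<in> frame_space (set (lB @ lG)). \<forall>w\<in>frame_space (set lB). v \<bullet> w = 0}"
      if p: "p \<in> set lG" for p
    proof -
      have "p \<in> set (lB @ lG) - set lB" "set lB \<subseteq> set (lB @ lG)"
        using p dist by auto
      then show ?thesis
        using frame_space_disjoint_orthogonal[OF sorted_frames(5), of "set lB" p] frame_space_mem[of p "set (lB @ lG)"] p
        by auto
    qed
  qed
qed

text \<open>Injectivity is the absence of the eigenvalue \<open>- 1\<close>. The space is stable
  under \<zeta>, so a comparison of dimensions gives surjectivity.\<close>

lemma invertible_iff: "invertible_on (frame_space (set (lB @ lG))) (mat 1 + \<zeta>) \<longleftrightarrow> lB = []"
proof
  assume inv: "invertible_on (frame_space (set (lB @ lG))) (mat 1 + \<zeta>)"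
  show "lB = []"
  proof (rule ccontr)
    assume "lB \<noteq> []"
    then obtain p where p: "p \<in> set lB"
      by (cases lB) auto
    have "(mat 1 + \<zeta>) *v fst p = (mat 1 + \<zeta>) *v 0"
      using zeta_planes(2)[OF p] by (simp add: matrix_vector_mult_add_rdistrib)
    moreover have "fst p \<in> frame_space (set (lB @ lG))" "0 \<in> frame_space (set (lB @ lG))"
      using p by (auto intro: frame_space_mem subspace_0 subspace_frame_space)
    ultimately have "fst p = 0"
      using inv unfolding invertible_on_def bij_betw_def inj_on_def by blast
    then show False
      using frame_inner(1)[OF sorted_frames(3) p p] by simp
  qed
next
  assume lB: "lB = []"
  let ?N = "frame_space (set (lB @ lG))" and ?T = "\<lambda>v. (mat 1 + \<zeta>) *v v"
  have T: "?T v = v + \<zeta> *v v" for v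
    by (simp add: matrix_vector_mult_add_rdistrib)
  have "\<zeta> *v v \<in> ?N" if "v \<in> ?N" for v
  proof -
    have "?N \<subseteq> {v. \<zeta> *v v \<in> ?N}"
    proof (rule frame_space_subset)
      show "subspace {v. \<zeta> *v v \<in> ?N}"
        using subspace_frame_space[of "set (lB @ lG)"]
        by (auto simp: subspace_def matrix_vector_right_distrib matrix_vector_mult_scaleR)
      fix p assume p: "p \<in> set (lB @ lG)"
      let ?t = "2 * pi * of_int (n p) / of_nat k"
      have pB: "p \<in> B"
        using p sorted_frames(10) by auto
      have "cvec (\<zeta> *v fst p) = cvec (cos ?t *\<^sub>R fst p + sin ?t *\<^sub>R snd p)"
        "cvec (\<zeta> *v snd p) = cvec (cos ?t *\<^sub>R snd p - sin ?t *\<^sub>R fst p)"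
        unfolding cmat_cvec[symmetric] \<zeta> rotation_cvec[OF frame_B pB]
        by (simp_all only: cvec_simps cos_of_real sin_of_real)
      then have "\<zeta> *v fst p = cos ?t *\<^sub>R fst p + sin ?t *\<^sub>R snd p" "\<zeta> *v snd p = cos ?t *\<^sub>R snd p - sin ?t *\<^sub>R fst p"
        by (simp_all only: cvec_eq_iff)
      then show "fst p \<in> {v. \<zeta> *v v \<in> ?N} \<and> snd p \<in> {v. \<zeta> *v v \<in> ?N}"
        using p by (auto intro!: subspace_add subspace_diff subspace_mul subspace_frame_space frame_space_mem)
    qed
    then show ?thesis
      using that by auto
  qed
  then have maps: "?T ` ?N \<subseteq> ?N"
    unfolding T using subspace_add[OF subspace_frame_space] by blast
  have lin: "linear ?T"
    by (rule matrix_vector_mul_linear)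
  have inj: "inj_on ?T ?N"
  proof (rule inj_onI)
    fix x y assume xy: "x \<in> ?N" "y \<in> ?N" "?T x = ?T y"
    have "\<zeta> *v (x - y) = - (x - y)"
      using xy(3) unfolding T matrix_vector_mult_diff_distrib by (simp add: algebra_simps)
    then have "x - y \<in> {v \<in> ?N. \<zeta> *v v = - v}"
      using xy subspace_diff[OF subspace_frame_space] by blast
    then show "x = y"
      unfolding minus_one_space_eq by (simp add: lB frame_space_def)
  qed
  have "dim (?T ` ?N) = dim ?N"
    by (rule dim_image_eq[OF lin]) (use inj span_eq_iff[THEN iffD2, OF subspace_frame_space] in metis)
  then have "?T ` ?N = ?N"
    using maps by (intro subspace_dim_equal linear_subspace_image lin subspace_frame_space) simp_all
  then show "invertible_on ?N (mat 1 + \<zeta>)"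
    unfolding invertible_on_def bij_betw_def using inj by blast
qed

text \<open>\<open>EM\<close> picks some factorisation of the orientation. Only the product of its
  two signs is known, but both enter with the same exponent, so the product is enough.\<close>

lemma EM_frame:
  fixes \<sigma> :: real
  assumes \<sigma>: "\<sigma> = 1 \<or> \<sigma> = - 1"
  shows "EM k \<alpha> \<beta> \<gamma> \<zeta> \<tau> (frame_space (set (lB @ lG))) (complex_of_real \<sigma> *s cprod (flat (lB @ lG))) (skew (set (lB @ lG)) \<theta>)
    = complex_of_real \<sigma> powi (\<alpha> + \<beta> + 1) * (\<Prod>p\<in>set (lB @ lG). EMblock k (\<alpha> + \<beta>) \<gamma> \<tau> (n p) (\<theta> p))"
proof -
  have dG: "distinct lG" and dB: "distinct lB" and dBG: "distinct (lB @ lG)"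
    using dist by auto
  have reg: "EM_reg k \<alpha> \<beta> \<gamma> \<zeta> \<tau> (frame_space (set lG)) (complex_of_real \<sigma>' *s cprod (flat lG)) (skew (set lG) \<theta>)
    = complex_of_real \<sigma>' powi (\<alpha> + \<beta> + 1) * (\<Prod>p\<in>set lG. EMblock k (\<alpha> + \<beta>) \<gamma> \<tau> (n p) (\<theta> p))"
    if "\<sigma>' = 1 \<or> \<sigma>' = - 1" for \<sigma>' :: real
    by (rule EM_reg_frame[OF frame_B k sorted_frames(9) \<zeta> _ \<tau> \<gamma> that refl dG]) (simp add: lG)
  show ?thesis
  proof (cases "lB = []")
    case True
    then show ?thesis
      using invertible_iff reg[OF \<sigma>] by (simp add: EM_def)
  next
    case False
    define orient where "orient = (SOME (oB, oG). is_orientation (frame_space (set lB)) oB \<and> is_orientation (frame_space (set lG)) oG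
       \<and> ext_mult oB oG = complex_of_real \<sigma> *s cprod (flat (lB @ lG)))"
    define oB where "oB = fst orient"
    define oG where "oG = snd orient"
    let ?P = "\<lambda>(oB, oG). is_orientation (frame_space (set lB)) oB \<and> is_orientation (frame_space (set lG)) oG
       \<and> ext_mult oB oG = complex_of_real \<sigma> *s cprod (flat (lB @ lG))"
    have ext: "ext_mult (complex_of_real a *s cprod (flat lB)) (complex_of_real b *s cprod (flat lG))
        = complex_of_real (a * b) *s cprod (flat (lB @ lG))" for a b :: real
      unfolding ext_scale ext_cprod_flat[OF sorted_frames(5) dBG] by simp
    have "?P (complex_of_real 1 *s cprod (flat lB), complex_of_real \<sigma> *s cprod (flat lG))"
      unfolding prod.case is_orientation_frame[OF sorted_frames(3) dB] is_orientation_frame[OF sorted_frames(4) dG] ext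
      using \<sigma> by auto
    then have "?P orient"
      unfolding orient_def by (rule someI)
    then have P: "is_orientation (frame_space (set lB)) oB" "is_orientation (frame_space (set lG)) oG"
      "ext_mult oB oG = complex_of_real \<sigma> *s cprod (flat (lB @ lG))"
      by (simp_all add: oB_def oG_def case_prod_unfold)
    obtain \<sigma>B :: real where \<sigma>B: "\<sigma>B = 1 \<or> \<sigma>B = - 1" "oB = complex_of_real \<sigma>B *s cprod (flat lB)"
      by (rule is_orientation_sign[OF sorted_frames(3) dB P(1)])
    obtain \<sigma>G :: real where \<sigma>G: "\<sigma>G = 1 \<or> \<sigma>G = - 1" "oG = complex_of_real \<sigma>G *s cprod (flat lG)"
      by (rule is_orientation_sign[OF sorted_frames(4) dG P(2)])
    have "complex_of_real (\<sigma>B * \<sigma>G) *s cprod (flat (lB @ lG)) = complex_of_real \<sigma> *s cprod (flat (lB @ lG))"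
      using P(3) unfolding \<sigma>B(2) \<sigma>G(2) ext .
    then have "complex_of_real (\<sigma>B * \<sigma>G) = complex_of_real \<sigma>"
      using cprod_nonzero[OF orthonormal_flat[OF sorted_frames(5) dBG]] by (metis vec.scale_right_imp_eq)
    then have prod: "\<sigma>B * \<sigma>G = \<sigma>"
      by (simp only: of_real_eq_iff)
    obtain p where "p \<in> set lB"
      using False by (cases lB) auto
    then have np: "int k dvd 2 * n p" "\<not> int k dvd n p"
      by (auto simp: lB)
    \<comment> \<open>An odd \<open>k\<close> dividing \<open>2 * n p\<close> would divide
      \<open>n p\<close>. So the eigenvalue \<open>- 1\<close> forces an even order, and then
      \<alpha> or \<beta> is odd.\<close>
    have "even k"
    proof (rule ccontr)
      assume "odd k"
      then have "coprime (int k) 2"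
        by simp
      then show False
        using np by (simp add: coprime_dvd_mult_right_iff)
    qed
    then have "odd \<alpha> \<or> odd \<beta>"
      by (rule has_order_not_both_even[OF order \<gamma>])
    have "EM k \<alpha> \<beta> \<gamma> \<zeta> \<tau> (frame_space (set (lB @ lG))) (complex_of_real \<sigma> *s cprod (flat (lB @ lG))) (skew (set (lB @ lG)) \<theta>)
        = EM_eps \<alpha> \<beta> \<tau> (frame_space (set lB)) oB (skew (set lB) \<theta>)
          * EM_reg k \<alpha> \<beta> \<gamma> \<zeta> \<tau> (frame_space (set lG)) oG (skew (set lG) \<theta>)"
      unfolding EM_def invertible_iff minus_one_space_eq regular_space_eq Let_def orient_def[symmetric]
      using False restr_skew[OF sorted_frames(5), of "set lB"] restr_skew[OF sorted_frames(5), of "set lG"]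
      by (simp add: oB_def oG_def case_prod_unfold)
    also have "EM_eps \<alpha> \<beta> \<tau> (frame_space (set lB)) oB (skew (set lB) \<theta>)
        = complex_of_real \<sigma>B powi (\<alpha> + \<beta> + 1) * (\<Prod>p\<in>set lB. EMblock k (\<alpha> + \<beta>) \<gamma> \<tau> (n p) (\<theta> p))"
    proof -
      have "(\<Prod>p\<in>set lB. Zblock \<tau> (\<theta> p + of_real pi * (of_int \<alpha> + of_int \<beta> * \<tau>)))
          = (\<Prod>p\<in>set lB. EMblock k (\<alpha> + \<beta>) \<gamma> \<tau> (n p) (\<theta> p))"
        by (rule prod.cong[OF refl], rule EMblock_half[OF \<tau> \<gamma> k, symmetric]) (simp_all add: lB)
      then show ?thesis
        unfolding \<sigma>B(2) EM_eps_frame[OF \<tau> sorted_frames(3) dB \<sigma>B(1) \<open>odd \<alpha> \<or> odd \<beta>\<close>] by simp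
    qed
    also have "EM_reg k \<alpha> \<beta> \<gamma> \<zeta> \<tau> (frame_space (set lG)) oG (skew (set lG) \<theta>)
        = complex_of_real \<sigma>G powi (\<alpha> + \<beta> + 1) * (\<Prod>p\<in>set lG. EMblock k (\<alpha> + \<beta>) \<gamma> \<tau> (n p) (\<theta> p))"
      unfolding \<sigma>G(2) by (rule reg[OF \<sigma>G(1)])
    also have "(\<Prod>p\<in>set (lB @ lG). EMblock k (\<alpha> + \<beta>) \<gamma> \<tau> (n p) (\<theta> p))
        = (\<Prod>p\<in>set lB. EMblock k (\<alpha> + \<beta>) \<gamma> \<tau> (n p) (\<theta> p)) * (\<Prod>p\<in>set lG. EMblock k (\<alpha> + \<beta>) \<gamma> \<tau> (n p) (\<theta> p))"
      using dBG by (simp add: prod.union_disjoint)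
    ultimately show ?thesis
      by (simp add: prod[symmetric] power_int_mult_distrib mult_ac)
  qed
qed

text \<open>After evaluation both sides contain the same products of \<open>Zblock\<close>, and only
  signs remain. The sign of \<open>oN\<close> occurs twice on the right, and \<open>eps_sign\<close>
  cancels the sign that \<open>Zg\<close> acquires on the planes fixed by \<zeta>.\<close>

lemma main_identity:
  fixes \<sigma>0 \<sigma>1 \<sigma>N :: real and y :: complex
  assumes \<sigma>: "\<sigma>0 = 1 \<or> \<sigma>0 = - 1" "\<sigma>1 = 1 \<or> \<sigma>1 = - 1" "\<sigma>N = 1 \<or> \<sigma>N = - 1"
    and a: "a = (\<lambda>p. 2 * pi * of_int (n p))" and \<theta>: "\<theta> = (\<lambda>p. y * complex_of_real (a p) + \<phi> p)"
    and ori: "o0 = complex_of_real \<sigma>0 *s cprod (flat l0)" "o1 = complex_of_real \<sigma>1 *s cprod (flat (lB @ lG))"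
      "oN = complex_of_real \<sigma>N *s cprod (flat (l0 @ lB @ lG))"
  shows "Z \<tau> (frame_space (set l0)) o0 (skew (set l0) \<theta>)
      * EM k \<alpha> \<beta> \<gamma> \<zeta> \<tau> (frame_space (set (lB @ lG))) o1 (skew (set (lB @ lG)) \<theta>)
    = of_real (Os (frame_space (set (lB @ lG))) ((1 / real k) *\<^sub>R rskew (set (lB @ lG)) a) o1) powi (\<alpha> + \<beta>)
      * of_real (eps_sign ((1 / real k) *\<^sub>R rskew (set l0) a) (frame_space (set l0))) powi (\<alpha> + \<beta>)
      * of_real (orientation_ratio oN (ext_mult o0 o1))
      * Zg (\<gamma> + y) (rskew B a) \<tau> (frame_space B) oN (skew B \<phi>)"
proof -
  let ?c = "\<alpha> + \<beta>" and ?l1 = "lB @ lG" and ?l = "l0 @ lB @ lG"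
  have d: "distinct l0" "distinct ?l1" "set l0 \<inter> set ?l1 = {}"
    using dist by auto
  have B: "B = set ?l"
    using sorted_frames(1) by simp
  \<comment> \<open>On \<open>l0\<close> the division is exact, and \<open>m p\<close> is the weight
    of \<open>J\<close> divided by \<open>k\<close>.\<close>
  define m where "m p = n p div int k" for p
  have m: "n p = int k * m p" if "p \<in> set l0" for p
    using that by (simp add: l0 m_def)
  have Z0: "Z \<tau> (frame_space (set l0)) o0 (skew (set l0) \<theta>) = complex_of_real \<sigma>0 * (\<Prod>p\<in>set l0. Zblock \<tau> (\<theta> p))"
    unfolding ori by (rule Z_frame[OF \<tau> sorted_frames(2) d(1) \<sigma>(1)])
  have EM1: "EM k \<alpha> \<beta> \<gamma> \<zeta> \<tau> (frame_space (set ?l1)) o1 (skew (set ?l1) \<theta>)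
      = complex_of_real \<sigma>1 powi (?c + 1) * (\<Prod>p\<in>set ?l1. EMblock k ?c \<gamma> \<tau> (n p) (\<theta> p))"
    unfolding ori by (rule EM_frame[OF \<sigma>(2)])
  have Os1: "Os (frame_space (set ?l1)) ((1 / real k) *\<^sub>R rskew (set ?l1) a) o1 = \<sigma>1 * (\<Prod>p\<in>set ?l1. sine_sign k (n p))"
    unfolding ori a by (rule Os_frame_integral[OF sorted_frames(5) d(2) \<sigma>(2) k]) (auto simp: lB lG)
  have eps: "eps_sign ((1 / real k) *\<^sub>R rskew (set l0) a) (frame_space (set l0)) = (- 1) powi (\<Sum>p\<in>set l0. m p)"
  proof -
    have "(1 / real k) *\<^sub>R rskew (set l0) a = rskew (set l0) (\<lambda>p. 2 * pi * of_int (m p))"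
      unfolding rskew_def scaleR_right.sum using k by (intro sum.cong refl) (simp add: a m)
    then show ?thesis
      using eps_sign_rskew[OF sorted_frames(2)] by simp
  qed
  have ratio: "orientation_ratio oN (ext_mult o0 o1) = \<sigma>N * (\<sigma>0 * \<sigma>1)"
  proof -
    have "ext_mult o0 o1 = complex_of_real (\<sigma>0 * \<sigma>1) *s cprod (flat ?l)"
      unfolding ori ext_scale ext_cprod_flat[OF sorted_frames(6) dist] by simp
    then show ?thesis
      using orientation_ratio_scale[OF cprod_nonzero[OF orthonormal_flat[OF sorted_frames(6) dist]], of \<sigma>N "\<sigma>0 * \<sigma>1"] \<sigma> ori(3)
      by auto
  qed
  have arg: "(\<gamma> + y) * complex_of_real (a p) + \<phi> p = \<gamma> * (2 * of_real pi * of_int (n p)) + \<theta> p" for p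
    by (simp add: a \<theta> algebra_simps)
  have "Zg (\<gamma> + y) (rskew B a) \<tau> (frame_space B) oN (skew B \<phi>)
      = complex_of_real \<sigma>N * (\<Prod>p\<in>set ?l. Zblock \<tau> ((\<gamma> + y) * complex_of_real (a p) + \<phi> p))"
    unfolding ori B by (rule Zg_frame[OF \<tau> sorted_frames(6) dist \<sigma>(3)])
  also have "(\<Prod>p\<in>set ?l. Zblock \<tau> ((\<gamma> + y) * complex_of_real (a p) + \<phi> p))
      = (\<Prod>p\<in>set l0. Zblock \<tau> (\<gamma> * (2 * of_real pi * of_int (n p)) + \<theta> p))
        * (\<Prod>p\<in>set ?l1. Zblock \<tau> (\<gamma> * (2 * of_real pi * of_int (n p)) + \<theta> p))"
    unfolding arg using prod.union_disjoint[OF _ _ d(3)] by simp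
  also have "(\<Prod>p\<in>set l0. Zblock \<tau> (\<gamma> * (2 * of_real pi * of_int (n p)) + \<theta> p))
      = (\<Prod>p\<in>set l0. (- 1) powi (m p * ?c) * Zblock \<tau> (\<theta> p))"
    by (rule prod.cong[OF refl]) (simp only: m Zblock_gamma_shift[OF \<tau> \<gamma>])
  also have "\<dots> = (- 1) powi ((\<Sum>p\<in>set l0. m p) * ?c) * (\<Prod>p\<in>set l0. Zblock \<tau> (\<theta> p))"
    by (simp add: prod.distrib sum_distrib_right minus_one_powi_sum)
  finally have Zg: "Zg (\<gamma> + y) (rskew B a) \<tau> (frame_space B) oN (skew B \<phi>)
      = complex_of_real \<sigma>N * ((- 1) powi ((\<Sum>p\<in>set l0. m p) * ?c) * (\<Prod>p\<in>set l0. Zblock \<tau> (\<theta> p))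
        * (\<Prod>p\<in>set ?l1. Zblock \<tau> (\<gamma> * (2 * of_real pi * of_int (n p)) + \<theta> p)))" .
  have EMb: "(\<Prod>p\<in>set ?l1. EMblock k ?c \<gamma> \<tau> (n p) (\<theta> p))
      = (\<Prod>p\<in>set ?l1. complex_of_real (sine_sign k (n p))) powi ?c
        * (\<Prod>p\<in>set ?l1. Zblock \<tau> (\<gamma> * (2 * of_real pi * of_int (n p)) + \<theta> p))"
    unfolding EMblock_def prod.distrib prod_power_int ..
  define S where "S = (\<Prod>p\<in>set ?l1. complex_of_real (sine_sign k (n p))) powi ?c"
  define X where "X = (\<Prod>p\<in>set l0. Zblock \<tau> (\<theta> p))"
  define Y where "Y = (\<Prod>p\<in>set ?l1. Zblock \<tau> (\<gamma> * (2 * of_real pi * of_int (n p)) + \<theta> p))"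
  define M where "M = (\<Sum>p\<in>set l0. m p)"
  have Os_c: "complex_of_real (\<sigma>1 * (\<Prod>p\<in>set ?l1. sine_sign k (n p))) powi ?c = complex_of_real \<sigma>1 powi ?c * S"
    unfolding S_def of_real_mult of_real_prod power_int_mult_distrib ..
  have M1: "complex_of_real ((- 1) powi M) powi ?c * (- 1) powi (M * ?c) = 1"
    using minus_one_powi_square[of M ?c] by (simp add: of_real_power_int)
  have \<sigma>1: "complex_of_real \<sigma>1 powi (?c + 1) = complex_of_real \<sigma>1 powi ?c * complex_of_real \<sigma>1"
    using \<sigma>(2) by (auto simp: power_int_add)
  have "(complex_of_real \<sigma>1 powi ?c * S) * complex_of_real ((- 1) powi M) powi ?c * complex_of_real (\<sigma>N * (\<sigma>0 * \<sigma>1))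
      * (complex_of_real \<sigma>N * ((- 1) powi (M * ?c) * X * Y))
    = (complex_of_real \<sigma>N * complex_of_real \<sigma>N) * (complex_of_real ((- 1) powi M) powi ?c * (- 1) powi (M * ?c))
      * (complex_of_real \<sigma>0 * X * (complex_of_real \<sigma>1 powi ?c * complex_of_real \<sigma>1 * (S * Y)))"
    by (simp only: of_real_mult mult_ac)
  also have "\<dots> = complex_of_real \<sigma>0 * X * (complex_of_real \<sigma>1 powi ?c * complex_of_real \<sigma>1 * (S * Y))"
    unfolding M1 real_sign_cases(1)[OF \<sigma>(3)] by simp
  finally have "complex_of_real \<sigma>0 * X * (complex_of_real \<sigma>1 powi ?c * complex_of_real \<sigma>1 * (S * Y))
    = (complex_of_real \<sigma>1 powi ?c * S) * complex_of_real ((- 1) powi M) powi ?c * complex_of_real (\<sigma>N * (\<sigma>0 * \<sigma>1))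
      * (complex_of_real \<sigma>N * ((- 1) powi (M * ?c) * X * Y))" ..
  then show ?thesis
    unfolding Z0 EM1 Os1 eps ratio Zg EMb S_def[symmetric] X_def[symmetric] Y_def[symmetric] M_def[symmetric] Os_c \<sigma>1 .
qed

end

theorem theorem7p16:
  fixes N N\<^sub>0 N\<^sub>1 :: "(real^'n::{finite,linorder}) set"
    and \<zeta> J :: "'n rmatrix"
    and \<tau> \<gamma> :: complex
    and k :: nat
    and \<alpha> \<beta> :: int
    and oN o\<^sub>0 o\<^sub>1 :: "'n multivector"
  assumes "Im \<tau> > 0"
    and "k \<ge> 1"
    and "subspace N" and "even (dim N)"
    and "\<zeta> \<in> SO N" and "mat_power \<zeta> k = mat 1"
    and "has_order \<tau> \<gamma> k" and "of_nat k * \<gamma> = of_int \<alpha> + of_int \<beta> * \<tau>"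
    and "orthogonal_sum N N\<^sub>0 N\<^sub>1"
    and "\<forall>v\<in>N\<^sub>0. \<zeta> *v v = v"
    and "invertible_on N\<^sub>1 (mat 1 - \<zeta>)"
    and "J \<in> so N" and "invertible_on N J" and "J ** \<zeta> = \<zeta> ** J"
    and "mat_exp ((1 / real k) *\<^sub>R J) = \<zeta>"
    and "is_orientation N\<^sub>0 o\<^sub>0" and "is_orientation N\<^sub>1 o\<^sub>1" and "is_orientation N oN"
  shows "\<exists>\<delta>>0. \<forall>R \<in> so_commuting N J. \<forall>y::complex.
    norm R < \<delta> \<and> norm y < \<delta> \<and>
    Z_defined \<tau> N\<^sub>0 o\<^sub>0 (restr N\<^sub>0 (mscale y (cmat J) + cmat R)) \<and>
    Zg_defined (\<gamma> + y) J \<tau> N oN (cmat R) \<longrightarrow>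
    Z \<tau> N\<^sub>0 o\<^sub>0 (restr N\<^sub>0 (mscale y (cmat J) + cmat R))
      * EM k \<alpha> \<beta> \<gamma> \<zeta> \<tau> N\<^sub>1 o\<^sub>1 (restr N\<^sub>1 (mscale y (cmat J) + cmat R))
    = of_real (Os N\<^sub>1 ((1 / real k) *\<^sub>R rrestr N\<^sub>1 J) o\<^sub>1) powi (\<alpha> + \<beta>)
      * of_real (eps_sign ((1 / real k) *\<^sub>R rrestr N\<^sub>0 J) N\<^sub>0) powi (\<alpha> + \<beta>)
      * of_real (orientation_ratio oN (ext_mult o\<^sub>0 o\<^sub>1))
      * Zg (\<gamma> + y) J \<tau> N oN (cmat R)"
proof -
  have k: "k > 0"
    using assms(2) by simp
  have identity: "Z \<tau> N\<^sub>0 o\<^sub>0 (restr N\<^sub>0 (mscale y (cmat J) + cmat R))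
      * EM k \<alpha> \<beta> \<gamma> \<zeta> \<tau> N\<^sub>1 o\<^sub>1 (restr N\<^sub>1 (mscale y (cmat J) + cmat R))
    = of_real (Os N\<^sub>1 ((1 / real k) *\<^sub>R rrestr N\<^sub>1 J) o\<^sub>1) powi (\<alpha> + \<beta>)
      * of_real (eps_sign ((1 / real k) *\<^sub>R rrestr N\<^sub>0 J) N\<^sub>0) powi (\<alpha> + \<beta>)
      * of_real (orientation_ratio oN (ext_mult o\<^sub>0 o\<^sub>1))
      * Zg (\<gamma> + y) J \<tau> N oN (cmat R)"
    if R: "R \<in> so_commuting N J" for R y
  proof -
    have so: "J \<in> so N" "R \<in> so N" and comm: "J ** R = R ** J"
      using assms(12) R by (auto simp: so_commuting_def)
    \<comment> \<open>The planes depend on \<open>R\<close>: the frame has to be adapted to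
      \<open>J\<close> and \<open>R\<close> at once.\<close>
    have "\<exists>B. frame B \<and> frame_space B = N \<and> (\<forall>p\<in>B. rotates J p \<and> rotates R p)"
    proof (rule ex_normal_form[OF assms(3) _ _ _ _ comm])
      show "transpose J = - J" "transpose R = - R" "\<And>v. v \<in> N \<Longrightarrow> J *v v \<in> N" "\<And>v. v \<in> N \<Longrightarrow> R *v v \<in> N"
        using so by (auto simp: so_def)
      fix v assume "v \<in> N" "J *v v = 0"
      moreover have "J *v 0 = 0" "0 \<in> N"
        using subspace_0[OF assms(3)] by simp_all
      ultimately show "v = 0"
        using assms(13) unfolding invertible_on_def bij_betw_def inj_on_def by metis
    qed
    then obtain B where B: "frame B" "frame_space B = N" "\<And>p. p \<in> B \<Longrightarrow> rotates J p" "\<And>p. p \<in> B \<Longrightarrow> rotates R p"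
      by blast
    have J: "J = rskew B (angle_of J)"
      by (rule so_eq_rskew[OF B(1)]) (use so B in \<open>auto simp: rotates_def\<close>)
    have R_eq: "R = rskew B (angle_of R)"
      by (rule so_eq_rskew[OF B(1)]) (use so B in \<open>auto simp: rotates_def\<close>)
    have \<zeta>_angle: "cmat \<zeta> = rotation B (\<lambda>p. complex_of_real (angle_of J p / real k))"
    proof -
      have "(1 / real k) *\<^sub>R J = rskew B (\<lambda>p. angle_of J p / real k)"
        by (subst J) (simp add: rskew_def scaleR_right.sum)
      then show ?thesis
        using cmat_mat_exp_rskew[OF B(1), of "\<lambda>p. angle_of J p / real k"] assms(15) by simp
    qed
    \<comment> \<open>As the \<open>k\<close>-th power of \<zeta> is the identity, \<open>J\<close>
      turns every plane by a whole number of full turns.\<close>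
    have "\<exists>n :: int. angle_of J p = 2 * pi * of_int n" if "p \<in> B" for p
    proof -
      have "rotation B (\<lambda>p. of_nat k * complex_of_real (angle_of J p / real k)) = mat 1"
        unfolding rotation_power[OF B(1), symmetric] \<zeta>_angle[symmetric] cmat_power[symmetric] assms(6)
        by (rule cmat_mat_1)
      then have "cexpi (of_nat k * complex_of_real (angle_of J p / real k)) = 1"
        by (rule rotation_eq_1[OF B(1) that])
      then show ?thesis
        using k by (simp add: cexpi_eq_1_iff)
    qed
    then obtain n :: "'n plane \<Rightarrow> int" where n: "\<And>p. p \<in> B \<Longrightarrow> angle_of J p = 2 * pi * of_int (n p)"
      by metis
    define a where "a = (\<lambda>p. 2 * pi * real_of_int (n p))"
    have J_eq: "J = rskew B a"
      by (subst J) (simp add: rskew_def a_def n)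
    have \<zeta>: "cmat \<zeta> = rotation B (\<lambda>p. complex_of_real (2 * pi * of_int (n p) / of_nat k))"
      unfolding \<zeta>_angle rotation_def diag_id_def
      by (intro arg_cong2[of _ _ _ _ "(+)"] diag_sum_cong refl) (auto simp: n)
    obtain l0 where l0: "set l0 = {p \<in> B. int k dvd n p}" "distinct l0"
      using finite_distinct_list[of "{p \<in> B. int k dvd n p}"] frame_finite[OF B(1)] by auto
    obtain lB where lB: "set lB = {p \<in> B. int k dvd 2 * n p \<and> \<not> int k dvd n p}" "distinct lB"
      using finite_distinct_list[of "{p \<in> B. int k dvd 2 * n p \<and> \<not> int k dvd n p}"] frame_finite[OF B(1)] by auto
    obtain lG where lG: "set lG = {p \<in> B. \<not> int k dvd 2 * n p}" "distinct lG"
      using finite_distinct_list[of "{p \<in> B. \<not> int k dvd 2 * n p}"] frame_finite[OF B(1)] by auto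
    have dist: "distinct (l0 @ lB @ lG)"
      using l0 lB lG by auto
    note sorting = B(1) k assms(1,8,7) \<zeta> l0(1) lB(1) lG(1) dist
    note frames = sorted_frames[OF sorting]
    have N0: "N\<^sub>0 = frame_space (set l0)" and N1: "N\<^sub>1 = frame_space (set (lB @ lG))"
      using fixed_space_eq[OF sorting] assms(9,10,11) B(2) by auto
    have d1: "distinct l0" "distinct (lB @ lG)"
      using dist by auto
    obtain \<sigma>0 :: real where \<sigma>0: "\<sigma>0 = 1 \<or> \<sigma>0 = - 1" "o\<^sub>0 = complex_of_real \<sigma>0 *s cprod (flat l0)"
      using is_orientation_sign[OF frames(2) d1(1)] assms(16) N0 by blast
    obtain \<sigma>1 :: real where \<sigma>1: "\<sigma>1 = 1 \<or> \<sigma>1 = - 1" "o\<^sub>1 = complex_of_real \<sigma>1 *s cprod (flat (lB @ lG))"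
      using is_orientation_sign[OF frames(5) d1(2)] assms(17) N1 by blast
    obtain \<sigma>N :: real where \<sigma>N: "\<sigma>N = 1 \<or> \<sigma>N = - 1" "oN = complex_of_real \<sigma>N *s cprod (flat (l0 @ lB @ lG))"
      using is_orientation_sign[OF frames(6) dist] assms(18) B(2) frames(1) by metis
    define \<phi> where "\<phi> = (\<lambda>p. complex_of_real (angle_of R p))"
    \<comment> \<open>The complex parameter enters only here: the planes stay the same and their
      angles become complex.\<close>
    define \<theta> where "\<theta> = (\<lambda>p. y * complex_of_real (a p) + \<phi> p)"
    have R_skew: "cmat R = skew B \<phi>"
      unfolding \<phi>_def cmat_rskew[symmetric] R_eq[symmetric] ..
    have skew: "mscale y (cmat J) + cmat R = skew B \<theta>"
      unfolding R_skew J_eq cmat_rskew mscale_skew skew_add \<theta>_def ..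
    show ?thesis
      unfolding skew unfolding N0 N1 restr_skew[OF B(1) frames(7)] restr_skew[OF B(1) frames(10)] J_eq
        rrestr_rskew[OF B(1) frames(7)] rrestr_rskew[OF B(1) frames(10)] R_skew B(2)[symmetric]
      by (rule main_identity[OF sorting \<sigma>0(1) \<sigma>1(1) \<sigma>N(1) a_def \<theta>_def \<sigma>0(2) \<sigma>1(2) \<sigma>N(2)])
  qed
  show ?thesis
    \<comment> \<open>The identity was obtained for every \<open>R\<close> and \<open>y\<close>, so
      any positive radius serves as \<delta>.\<close>
    using identity by (intro exI[of _ 1]) simp
qed

end
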